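(* Let $\mathcal X$, $U$, $J$, $\Omega_1,\dots,\Omega_J$, $\chi_\epsilon$, $\pi_\epsilon$ and the Markov processes $Y_{\epsilon,\cdot}$ be as in the context. Suppose that for some $0\le \eta_{\min}<\eta_{\max}\le\infty$ we have $$C_{\mathrm{LBV}} := \sum_{j=1}^J\int_{\eta_{\min}}^{\eta_{\max}} |\partial_\epsilon \ln \pi_\epsilon(\Omega_j)|\,d\epsilon<\infty .$$ Let $\eta_1\in(\eta_{\min},\eta_{\max}]$ be finite and let $\nu>0$. There exist constants $C_N=C_N(U/\eta_1,J,\nu)>0$ and $C_T=C_T(U/\eta_1,J,\nu)>0$ (in particular, not depending on $\delta,\eta,M,N,T,h$ or the initial points below) such that the following holds. Let $\delta>0$ and $\eta\in[\eta_{\min},\eta_1)$ with $\eta>0$, and let $M,N,T\in\mathbb N$, $M\ge 2$, satisfy $$M\ge \Big\lceil \frac{1}{\nu\eta}\Big\rceil,\qquad N\ge \frac{C_N M^2}{\delta^2},\qquad T\ge t_{\mathrm{mix}}\Big(Y_{\eta_1,\cdot},\frac{\delta}{C_T}\Big).$$ Choose $\eta_2,\dots,\eta_M$ so that $\eta_M=\eta$ and $1/\eta_1,\dots,1/\eta_M$ are linearly spaced. Run the ASMC algorithm of the context with the processes $Y_{\epsilon,\cdot}$, these parameters, and arbitrary initial points. Then for every bounded test function $h:\mathcal X\to\mathbb R$ the returned random points $x^1,\dots,x^N$ satisfy $$\Big\|\frac1N\sum_{i=1}^N h(x^i)-\int_{\mathcal X}h\,\pi_\eta\,dx\Big\|_{L^2(\mathbf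 P)}\le \|h\|_{\mathrm{osc}}\,\delta .$$
   Context: Setting. $\mathcal X$ is a configuration space with a fixed reference measure $dx$ (typically $\mathbb R^d$ or the torus $\mathbb T^d$), and $U:\mathcal X\to\mathbb R$ is an energy function, bounded below, with $Z_\epsilon:=\int_{\mathcal X}e^{-U(y)/\epsilon}dy\in(0,\infty)$ for all temperatures $\epsilon$ used. Put $\tilde\pi_\epsilon(x)=e^{-U(x)/\epsilon}$ and $\pi_\epsilon=\tilde\pi_\epsilon/Z_\epsilon$; $\pi_\epsilon$ denotes both the density and the probability measure. Local mixing model. $J\ge2$, and $\mathcal X$ is partitioned into $J$ measurable domains $\Omega_1,\dots,\Omega_J$, with $\pi_\epsilon(\Omega_j)>0$. For every $\epsilon>0$, $\chi_\epsilon\in(0,1)$ is given. $Y_{\epsilon,\cdot}$ is the discrete-time Markov process on $\mathcal X$ whose one-step transition density (with respect to $dy$) is $$p_1^\epsilon(x,y)=(1-\chi_\epsilon)\pi_\epsilon(y)+\chi_\epsilon\sum_{j=1}^J \mathbf 1_{\{x,y\in\Omega_j\}}\frac{\pi_\epsilon(y)}{\pi_\epsilon(\Omega_j)} .$$ Let $p_n^\epsilon$ be its $n$-step transition density. The $\delta$-mixing time is $t_{\mathrm{mix}}(Y_{\epsilon,\cdot},\delta)=\inf\{n\in\mathbb N:\ \sup_{x\in\mathcal X}\|p_n^\epsilon(x,\cdot)-\pi_\epsilon\|_{L^1}\le 2\delta\}$. ASMC algorithm. Parameters: number of levels $M$, temperatures $\eta_1>\dots>\eta_M=\eta$, number of realizations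 $N$, level running time $T$, initial points $y_1^1,\dots,y_1^N\in\mathcal X$. For $k=1,\dots,M-1$: (i) for each $i$, run $Y_{\eta_k,\cdot}$ for time $T$ from $y_k^i$, independently over $i$ (given the past), to obtain $x_k^i$; (ii) given $x_k^1,\dots,x_k^N$, choose $y_{k+1}^1,\dots,y_{k+1}^N$ independently from $\{x_k^1,\dots,x_k^N\}$ with $\mathbf P(y_{k+1}^i=x_k^j)=\tilde r_k(x_k^j)/\sum_{n=1}^N\tilde r_k(x_k^n)$, where $\tilde r_k=\tilde\pi_{\eta_{k+1}}/\tilde\pi_{\eta_k}$. Finally, for each $i$ run $Y_{\eta_M,\cdot}$ for time $T$ from $y_M^i$ (independently over $i$) to obtain $x^i$, and return $(x^1,\dots,x^N)$. Notation: $\|X\|_{L^2(\mathbf P)}=(\mathbf E X^2)^{1/2}$ and $\|h\|_{\mathrm{osc}}=\sup h-\inf h$.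
   Formalization: The constants C_N, C_T may depend on the space, U, η_1, J, ν and also on the domains Ω_j and η_min, η_max, not only on U/η_1, J, ν (false as stated if uniform over the Ω_j); they are independent of χ, δ, η, M, N, T, h and the initial points. *)

theory Defs
  imports "HOL-Probability.Probability"
begin

text \<open>
  The configuration space is \<open>space X\<close>, where \<open>X\<close> carries the reference measure \<open>dx\<close>.
  No sigma-finiteness is asked for: finiteness of a single partition function implies it.
\<close>

section \<open>Gibbs measures\<close>

definition unnorm_pdf :: "('a \<Rightarrow> real) \<Rightarrow> real \<Rightarrow> 'a \<Rightarrow> real" where
  "unnorm_pdf U \<epsilon> x = exp (- U x / \<epsilon>)"

definition partition_fun :: "'a measure \<Rightarrow> ('a \<Rightarrow> real) \<Rightarrow> real \<Rightarrow> real" where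
  "partition_fun X U \<epsilon> = (\<integral>y. unnorm_pdf U \<epsilon> y \<partial>X)"

definition gibbs_pdf :: "'a measure \<Rightarrow> ('a \<Rightarrow> real) \<Rightarrow> real \<Rightarrow> 'a \<Rightarrow> real" where
  "gibbs_pdf X U \<epsilon> x = unnorm_pdf U \<epsilon> x / partition_fun X U \<epsilon>"

definition gibbs :: "'a measure \<Rightarrow> ('a \<Rightarrow> real) \<Rightarrow> real \<Rightarrow> 'a measure" where
  "gibbs X U \<epsilon> = density X (\<lambda>x. ennreal (gibbs_pdf X U \<epsilon> x))"

text \<open>
  The constant takes values in \<^typ>\<open>ennreal\<close>. When the partition function is finite on the open
  interval, the functions being differentiated are smooth there, so \<^const>\<open>deriv\<close> is a genuine
  derivative on the whole domain of integration.
\<close>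

definition C_LBV ::
  "'a measure \<Rightarrow> ('a \<Rightarrow> real) \<Rightarrow> nat \<Rightarrow> (nat \<Rightarrow> 'a set) \<Rightarrow> real \<Rightarrow> ereal \<Rightarrow> ennreal" where
  "C_LBV X U J \<Omega> \<eta>min \<eta>max =
     (\<Sum>j\<in>{1..J}. \<integral>\<^sup>+\<epsilon>\<in>{\<epsilon>. \<eta>min < \<epsilon> \<and> ereal \<epsilon> < \<eta>max}.
        ennreal \<bar>deriv (\<lambda>s. ln (measure (gibbs X U s) (\<Omega> j))) \<epsilon>\<bar> \<partial>lborel)"

section \<open>Markov processes given by a one-step transition density\<close>

text \<open>
  Here \<open>p x y\<close> is a one-step transition density with respect to \<open>X\<close>. The \<open>n\<close>-step density is
  meaningful only for \<open>n \<ge> 1\<close>.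
\<close>

definition n_step_pdf :: "'a measure \<Rightarrow> ('a \<Rightarrow> 'a \<Rightarrow> real) \<Rightarrow> nat \<Rightarrow> 'a \<Rightarrow> 'a \<Rightarrow> real" where
  "n_step_pdf X p n x = ((\<lambda>q y. \<integral>z. q z * p z y \<partial>X) ^^ (n - 1)) (p x)"

text \<open>The infimum is taken in \<^typ>\<open>enat\<close>, so that it is infinite if no \<open>n\<close> qualifies.\<close>

definition t_mix ::
  "'a measure \<Rightarrow> ('a \<Rightarrow> 'a \<Rightarrow> real) \<Rightarrow> ('a \<Rightarrow> real) \<Rightarrow> real \<Rightarrow> enat" where
  "t_mix X p q \<delta> = (INF n\<in>{n. 1 \<le> n \<and>
     (SUP x\<in>space X. \<integral>\<^sup>+y. ennreal \<bar>n_step_pdf X p n x y - q y\<bar> \<partial>X) \<le> ennreal (2 * \<delta>)}. enat n)"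

definition run_law :: "'a measure \<Rightarrow> ('a \<Rightarrow> 'a \<Rightarrow> real) \<Rightarrow> nat \<Rightarrow> 'a \<Rightarrow> 'a measure" where
  "run_law X p T x =
     ((\<lambda>m. m \<bind> (\<lambda>z. density X (\<lambda>y. ennreal (p z y)))) ^^ T) (return X x)"

section \<open>The local mixing model\<close>

definition local_mixing_pdf ::
  "'a measure \<Rightarrow> ('a \<Rightarrow> real) \<Rightarrow> nat \<Rightarrow> (nat \<Rightarrow> 'a set) \<Rightarrow> (real \<Rightarrow> real) \<Rightarrow> real \<Rightarrow> 'a \<Rightarrow> 'a \<Rightarrow> real"
  where
  "local_mixing_pdf X U J \<Omega> chi \<epsilon> x y =
     (1 - chi \<epsilon>) * gibbs_pdf X U \<epsilon> y
     + chi \<epsilon> * (\<Sum>j\<in>{1..J}. (if x \<in> \<Omega> j \<and> y \<in> \<Omega> j then 1 else 0)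
                 * (gibbs_pdf X U \<epsilon> y / measure (gibbs X U \<epsilon>) (\<Omega> j)))"

section \<open>Annealed sequential Monte Carlo\<close>

text \<open>
  A configuration of the \<open>N\<close> realizations is a point of the product space over \<open>{1..N}\<close>;
  \<open>\<^const>\<open>PiM\<close>\<close> of the individual laws expresses conditional independence over the realizations.
\<close>

definition mutate_law ::
  "'a measure \<Rightarrow> ('a \<Rightarrow> 'a \<Rightarrow> real) \<Rightarrow> nat \<Rightarrow> nat \<Rightarrow> (nat \<Rightarrow> 'a) \<Rightarrow> (nat \<Rightarrow> 'a) measure" where
  "mutate_law X p N T y = PiM {1..N} (\<lambda>i. run_law X p T (y i))"

text \<open>
  The draws are draws of an index \<open>j\<close>, so a value that occurs several times among the
  \<open>x j\<close> is chosen with the sum of the corresponding weights.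
\<close>

definition resample_law ::
  "'a measure \<Rightarrow> ('a \<Rightarrow> real) \<Rightarrow> nat \<Rightarrow> (nat \<Rightarrow> 'a) \<Rightarrow> (nat \<Rightarrow> 'a) measure" where
  "resample_law X r N x =
     PiM {1..N} (\<lambda>i. distr (point_measure {1..N} (\<lambda>j. ennreal (r (x j) / (\<Sum>n\<in>{1..N}. r (x n))))) X x)"

definition weight_ratio :: "('a \<Rightarrow> real) \<Rightarrow> real \<Rightarrow> real \<Rightarrow> 'a \<Rightarrow> real" where
  "weight_ratio U \<epsilon> \<epsilon>' x = unnorm_pdf U \<epsilon>' x / unnorm_pdf U \<epsilon> x"

text \<open>
  The \<open>level_law \<dots> k\<close> is the joint law of the realizations at the end of the run at
  temperature \<open>\<theta> (k + 1)\<close>, that is, after \<open>k\<close> resampling steps. The family \<open>p\<close> assigns to each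
  temperature a one-step transition density.
\<close>

primrec level_law ::
  "'a measure \<Rightarrow> ('a \<Rightarrow> real) \<Rightarrow> (real \<Rightarrow> 'a \<Rightarrow> 'a \<Rightarrow> real) \<Rightarrow> nat \<Rightarrow> nat \<Rightarrow> (nat \<Rightarrow> real)
   \<Rightarrow> (nat \<Rightarrow> 'a) \<Rightarrow> nat \<Rightarrow> (nat \<Rightarrow> 'a) measure" where
  "level_law X U p N T \<theta> y 0 = mutate_law X (p (\<theta> 1)) N T y"
| "level_law X U p N T \<theta> y (Suc k) =
     (level_law X U p N T \<theta> y k
        \<bind> resample_law X (weight_ratio U (\<theta> (k + 1)) (\<theta> (k + 2))) N)
        \<bind> mutate_law X (p (\<theta> (k + 2))) N T"

definition asmc_law ::
  "'a measure \<Rightarrow> ('a \<Rightarrow> real) \<Rightarrow> (real \<Rightarrow> 'a \<Rightarrow> 'a \<Rightarrow> real) \<Rightarrow> nat \<Rightarrow> nat \<Rightarrow> nat \<Rightarrow> (nat \<Rightarrow> real)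
   \<Rightarrow> (nat \<Rightarrow> 'a) \<Rightarrow> (nat \<Rightarrow> 'a) measure" where
  "asmc_law X U p M N T \<theta> y = level_law X U p N T \<theta> y (M - 1)"

section \<open>Remaining notation\<close>

definition linearly_spaced :: "nat \<Rightarrow> (nat \<Rightarrow> real) \<Rightarrow> bool" where
  "linearly_spaced M b \<longleftrightarrow> (\<exists>d. \<forall>k\<in>{1..<M}. b (k + 1) - b k = d)"

definition L2_prob_norm :: "'b measure \<Rightarrow> ('b \<Rightarrow> real) \<Rightarrow> real" where
  "L2_prob_norm P f = sqrt (\<integral>\<omega>. (f \<omega>)\<^sup>2 \<partial>P)"

definition osc_on :: "'a set \<Rightarrow> ('a \<Rightarrow> real) \<Rightarrow> real" where
  "osc_on S h = (SUP x\<in>S. h x) - (INF x\<in>S. h x)"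

end

theory Submission
  imports Defs
begin

text \<open>
  The proof attaches a fictitious weight to the particle system. Let \<open>W\<close> be the product, over the levels
  passed so far, of the empirical means of the normalised density ratios \<open>g\<close> between consecutive Gibbs
  measures. For a test function \<open>f\<close> with zero mean under the last Gibbs measure and \<open>\<bar>f\<bar> \<le> B\<close>, every
  real \<open>W\<close> satisfies \<open>\<bar>avg f\<bar> \<le> \<bar>W * avg f\<bar> + B * \<bar>W - 1\<bar>\<close>, so the second moments of \<open>W * avg f\<close> and
  of \<open>W - 1\<close> control the error. Unlike the self-normalised averages, these weighted averages evolve
  linearly in mean: the conditional mean of \<open>W * avg f\<close> given the previous level is
  \<open>W' * avg (g * P f)\<close>, where \<open>W'\<close> is the previous weight and \<open>P\<close> the mutation kernel, and the two
  sampling stages add a variance of order \<open>1/N\<close>. Errors of different levels therefore add up; they are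
  not multiplied.

  What remains is that iterating \<open>f \<mapsto> g * P f\<close> backward through any number of levels keeps functions
  bounded by a fixed multiple of \<open>B\<close>. The iterates of the constant \<open>1\<close> are nonnegative and have mean
  exactly \<open>1\<close> under the Gibbs measure of their level, because \<open>P\<close> leaves it invariant. Perfect mixing
  inside the wells means that \<open>P\<close> has a density of at most \<open>1/m\<close> with respect to the Gibbs measure,
  where \<open>m\<close> is a lower bound for the masses of the wells. Hence \<open>P\<close> turns mean \<open>1\<close> into the pointwise bound \<open>1/m\<close>,
  and one more factor \<open>g \<le> R\<close> gives \<open>K = R/m\<close> at every level (\<open>FK_one_le\<close>). Mixing between the wells is
  used at the first temperature only, where it removes the bias of the initial points.

  The constants \<open>m\<close> and \<open>R\<close> are uniform in the temperature. The logarithms of the masses of the wells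
  have finite variation, which bounds the masses from below (\<open>gibbs_measure_bounded_below\<close>); the ratio of the
  partition functions at inverse temperatures \<open>\<beta>\<close> and \<open>\<beta> + \<Delta>\<close> is largest at the highest temperature,
  since a Laplace transform is log-convex (\<open>gibbs_ratio_bounded\<close>), and consecutive inverse temperatures
  are at most \<open>2 * \<nu>\<close> apart. The particle estimate is \<open>mean_square_error_le\<close>.
\<close>

section \<open>Independent coordinates\<close>

text \<open>
  Boxes generate the product sigma-algebra and are stable under intersection, and the mass of a box is
  a finite product of masses that depend measurably on the parameter.
\<close>
lemma PiM_measurable_prob_algebra:
  assumes I: "finite I" and \<kappa>: "\<And>i. i \<in> I \<Longrightarrow> \<kappa> i \<in> M \<rightarrow>\<^sub>M prob_algebra X"
  shows "(\<lambda>x. PiM I (\<lambda>i. \<kappa> i x)) \<in> M \<rightarrow>\<^sub>M prob_algebra (PiM I (\<lambda>_. X))"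
proof (rule measurable_prob_algebra_generated[where \<Omega>="\<Pi>\<^sub>E i\<in>I. space X"
      and G="prod_algebra I (\<lambda>_. X)"])
  have prob: "prob_space (\<kappa> i x)" and sets: "sets (\<kappa> i x) = sets X"
    if "i \<in> I" "x \<in> space M" for i x
    using measurable_space[OF \<kappa>[OF that(1)] that(2)] by (auto simp: space_prob_algebra)
  show "sets (PiM I (\<lambda>_. X)) = sigma_sets (\<Pi>\<^sub>E i\<in>I. space X) (prod_algebra I (\<lambda>_. X))"
    by (rule sets_PiM)
  show "Int_stable (prod_algebra I (\<lambda>_. X))" by (rule Int_stable_prod_algebra)
  show "prod_algebra I (\<lambda>_. X) \<subseteq> Pow (\<Pi>\<^sub>E i\<in>I. space X)"
    using prod_algebra_sets_into_space[of I "\<lambda>_. X"] by auto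
  show "prob_space (PiM I (\<lambda>i. \<kappa> i x))" if "x \<in> space M" for x
    by (rule prob_space_PiM) (rule prob[OF _ that])
  show "sets (PiM I (\<lambda>i. \<kappa> i x)) = sets (PiM I (\<lambda>_. X))" if "x \<in> space M" for x
    by (rule sets_PiM_cong[OF refl]) (rule sets[OF _ that])
  fix A assume "A \<in> prod_algebra I (\<lambda>_. X)"
  then obtain E where A: "A = (\<Pi>\<^sub>E i\<in>I. E i)" and E: "\<And>i. i \<in> I \<Longrightarrow> E i \<in> sets X"
    using I by (auto simp: prod_algebra_eq_finite Pi_iff)
  have "emeasure (PiM I (\<lambda>i. \<kappa> i x)) A = (\<Prod>i\<in>I. emeasure (\<kappa> i x) (E i))"
    if x: "x \<in> space M" for x
  proof -
    define \<kappa>' where "\<kappa>' i = (if i \<in> I then \<kappa> i x else count_space {undefined})" for i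
    have "prob_space (count_space {a})" for a :: 'c
      by (rule prob_spaceI) simp
    then have "prob_space (\<kappa>' i)" for i
      using prob[OF _ x] by (simp add: \<kappa>'_def)
    then interpret product_prob_space \<kappa>' I
      by (simp add: product_prob_space_def product_prob_space_axioms_def product_sigma_finite_def
          prob_space_imp_sigma_finite)
    have "PiM I (\<lambda>i. \<kappa> i x) = PiM I \<kappa>'"
      by (rule PiM_cong) (auto simp: \<kappa>'_def)
    then show ?thesis
      unfolding A using I E sets[OF _ x] by (simp add: emeasure_PiM \<kappa>'_def)
  qed
  moreover have "(\<lambda>x. \<Prod>i\<in>I. emeasure (\<kappa> i x) (E i)) \<in> borel_measurable M"
    using E measurable_prob_algebraD[OF \<kappa>]
    by (intro borel_measurable_prod_ennreal) (auto intro!: measurable_compose[OF _ measurable_emeasure_subprob_algebra])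
  ultimately show "(\<lambda>x. emeasure (PiM I (\<lambda>i. \<kappa> i x)) A) \<in> borel_measurable M"
    by (subst measurable_cong) auto
qed

text \<open>
  Squared bias plus variance, for independent coordinates that need not be identically distributed. The
  offset \<open>b\<close> is arbitrary so that coordinates can be integrated out one at a time: each of them shifts
  \<open>b\<close> by \<open>c\<close> times its mean and adds at most \<open>c\<^sup>2 B\<^sup>2\<close>.
\<close>
lemma PiM_integral_affine_sum_square_le:
  fixes f :: "'a \<Rightarrow> real"
  assumes I: "finite I"
    and \<nu>: "\<And>i. i \<in> I \<Longrightarrow> prob_space (\<nu> i)" "\<And>i. i \<in> I \<Longrightarrow> sets (\<nu> i) = sets X"
    and f: "f \<in> borel_measurable X" "\<And>x. x \<in> space X \<Longrightarrow> \<bar>f x\<bar> \<le> B"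
  shows "(\<integral>x. (c * (\<Sum>i\<in>I. f (x i)) - b)\<^sup>2 \<partial>PiM I \<nu>)
           \<le> (c * (\<Sum>i\<in>I. \<integral>z. f z \<partial>\<nu> i) - b)\<^sup>2 + c\<^sup>2 * (real (card I) * B\<^sup>2)"
proof -
  \<comment> \<open>The product locale wants a probability measure for every index, also outside \<open>I\<close>.\<close>
  define \<nu>' where "\<nu>' i = (if i \<in> I then \<nu> i else count_space {undefined})" for i
  have "prob_space (count_space {a})" for a :: 'a
    by (rule prob_spaceI) simp
  then have prob': "prob_space (\<nu>' i)" for i
    using \<nu>(1) by (simp add: \<nu>'_def)
  interpret product_prob_space \<nu>' I
    using prob' by (simp add: product_prob_space_def product_prob_space_axioms_def product_sigma_finite_def
        prob_space_imp_sigma_finite)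
  have "J \<subseteq> I \<Longrightarrow> (\<integral>x. (c * (\<Sum>i\<in>J. f (x i)) - b)\<^sup>2 \<partial>PiM J \<nu>')
           \<le> (c * (\<Sum>i\<in>J. \<integral>z. f z \<partial>\<nu>' i) - b)\<^sup>2 + c\<^sup>2 * (real (card J) * B\<^sup>2)"
    if J: "finite J" for J
    using J
  proof (induction J arbitrary: b rule: finite_induct)
    case empty
    show ?case
      using prob_space.prob_space[OF prob_space_PiM[of "{}" \<nu>']] by simp
  next
    case (insert j J)
    have sets': "sets (\<nu>' i) = sets X" if "i \<in> insert j J" for i
      using that insert.prems \<nu>(2) by (auto simp: \<nu>'_def)
    interpret PI: prob_space "PiM (insert j J) \<nu>'" by (rule prob_space_PiM) (rule prob')
    interpret PJ: prob_space "PiM J \<nu>'" by (rule prob_space_PiM) (rule prob')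
    let ?S = "\<lambda>x. \<Sum>i\<in>J. f (x i)"
    have fm: "f \<in> borel_measurable (\<nu>' i)" if "i \<in> insert j J" for i
      using f(1) measurable_cong_sets[OF sets'[OF that] refl] by blast
    have fb: "\<bar>f z\<bar> \<le> B" if "i \<in> insert j J" "z \<in> space (\<nu>' i)" for i z
      using f(2) that sets_eq_imp_space_eq[OF sets'[OF that(1)]] by auto
    have Sm: "(\<lambda>x. \<Sum>i\<in>K. f (x i)) \<in> borel_measurable (PiM K' \<nu>')"
      if "K \<subseteq> K'" "K' \<subseteq> insert j J" for K K'
    proof (rule borel_measurable_sum)
      show "(\<lambda>x. f (x i)) \<in> borel_measurable (PiM K' \<nu>')" if "i \<in> K" for i
        using that \<open>K \<subseteq> K'\<close> \<open>K' \<subseteq> insert j J\<close>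
        by (intro measurable_compose[OF measurable_component_singleton[of i K' \<nu>'] fm[of i]]) auto
    qed
    have Sb: "\<bar>\<Sum>i\<in>K. f (x i)\<bar> \<le> real (card K) * B"
      if "K \<subseteq> K'" "K' \<subseteq> insert j J" "x \<in> space (PiM K' \<nu>')" for K K' x
    proof -
      have "(\<Sum>i\<in>K. \<bar>f (x i)\<bar>) \<le> (\<Sum>i\<in>K. B)"
      proof (rule sum_mono)
        fix i assume "i \<in> K"
        with that have "i \<in> insert j J" "x i \<in> space (\<nu>' i)" by (auto simp: space_PiM)
        then show "\<bar>f (x i)\<bar> \<le> B" by (rule fb)
      qed
      then have "(\<Sum>i\<in>K. \<bar>f (x i)\<bar>) \<le> real (card K) * B" by simp
      then show ?thesis by (rule order_trans[OF sum_abs])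
    qed
    have bound: "\<bar>(c * s - b)\<^sup>2\<bar> \<le> (\<bar>c\<bar> * r + \<bar>b\<bar>)\<^sup>2" if "\<bar>s\<bar> \<le> r" for s r b
    proof -
      have "\<bar>c * s - b\<bar> \<le> \<bar>c\<bar> * \<bar>s\<bar> + \<bar>b\<bar>"
        by (metis abs_mult abs_triangle_ineq4)
      also have "\<dots> \<le> \<bar>c\<bar> * r + \<bar>b\<bar>" using that by (intro add_right_mono mult_left_mono) auto
      finally have "\<bar>c * s - b\<bar>\<^sup>2 \<le> (\<bar>c\<bar> * r + \<bar>b\<bar>)\<^sup>2"
        by (rule power_mono) simp
      then show ?thesis by simp
    qed
    have int: "integrable (PiM K \<nu>') (\<lambda>x. (c * (\<Sum>i\<in>K. f (x i)) - b)\<^sup>2)"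
      if "K \<subseteq> insert j J" for K b
    proof -
      interpret PK: prob_space "PiM K \<nu>'" by (rule prob_space_PiM) (rule prob')
      show ?thesis
        using Sm[OF subset_refl that] bound[OF Sb[OF subset_refl that]]
        by (intro PK.integrable_const_bound[where B="(\<bar>c\<bar> * (card K * B) + \<bar>b\<bar>)\<^sup>2"] AE_I2) auto
    qed
    have intf: "integrable (\<nu>' j) f"
      using fm fb by (intro M.integrable_const_bound[where B=B] AE_I2) auto
    have fb2: "(f z)\<^sup>2 \<le> B\<^sup>2" if "z \<in> space (\<nu>' j)" for z
      using power_mono[OF fb[OF insertI1 that] abs_ge_zero, of 2] by simp
    have intf2: "integrable (\<nu>' j) (\<lambda>z. (f z)\<^sup>2)"
    proof (rule M.integrable_const_bound[where B="B\<^sup>2"])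
      show "AE x in \<nu>' j. norm ((f x)\<^sup>2) \<le> B\<^sup>2"
        using fb2 by (intro AE_I2) simp
    qed (use fm[of j] in measurable)
    let ?a = "\<integral>z. f z \<partial>\<nu>' j"
    have one: "(\<integral>z. (c * (f z + s) - b)\<^sup>2 \<partial>\<nu>' j) \<le> (c * s - (b - c * ?a))\<^sup>2 + c\<^sup>2 * B\<^sup>2" for s
    proof -
      have "(\<integral>z. (c * (f z + s) - b)\<^sup>2 \<partial>\<nu>' j)
          = (\<integral>z. c\<^sup>2 * (f z)\<^sup>2 + (2 * c * (c * s - b)) * f z + (c * s - b)\<^sup>2 \<partial>\<nu>' j)"
        by (rule Bochner_Integration.integral_cong) (auto simp: power2_eq_square algebra_simps)
      also have "\<dots> = c\<^sup>2 * (\<integral>z. (f z)\<^sup>2 \<partial>\<nu>' j) + 2 * c * (c * s - b) * ?a + (c * s - b)\<^sup>2"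
        using intf intf2 M.prob_space by simp
      also have "\<dots> = (c * s - (b - c * ?a))\<^sup>2 + c\<^sup>2 * ((\<integral>z. (f z)\<^sup>2 \<partial>\<nu>' j) - ?a\<^sup>2)"
        by (simp add: power2_eq_square algebra_simps)
      also have "(\<integral>z. (f z)\<^sup>2 \<partial>\<nu>' j) - ?a\<^sup>2 \<le> B\<^sup>2"
      proof -
        have "(\<integral>z. (f z)\<^sup>2 \<partial>\<nu>' j) \<le> (\<integral>z. B\<^sup>2 \<partial>\<nu>' j)"
          using fb2 by (intro integral_mono intf2) simp_all
        also have "\<dots> = B\<^sup>2" using M.prob_space by simp
        finally show ?thesis using zero_le_power2[of ?a] by linarith
      qed
      finally show ?thesis by (simp add: mult_left_mono)
    qed
    have "(\<integral>x. (c * (\<Sum>i\<in>insert j J. f (x i)) - b)\<^sup>2 \<partial>PiM (insert j J) \<nu>')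
        = (\<integral>x. (\<integral>z. (c * (f z + ?S x) - b)\<^sup>2 \<partial>\<nu>' j) \<partial>PiM J \<nu>')"
    proof (subst product_integral_insert[OF insert.hyps int[OF subset_refl]],
        intro Bochner_Integration.integral_cong refl)
      fix x z
      have "(\<Sum>i\<in>J. f ((x(j := z)) i)) = ?S x"
        using insert.hyps by (intro sum.cong) auto
      then show "(c * (\<Sum>i\<in>insert j J. f ((x(j := z)) i)) - b)\<^sup>2 = (c * (f z + ?S x) - b)\<^sup>2"
        using insert.hyps by simp
    qed
    also have "\<dots> \<le> (\<integral>x. (c * ?S x - (b - c * ?a))\<^sup>2 + c\<^sup>2 * B\<^sup>2 \<partial>PiM J \<nu>')"
      by (rule integral_mono_AE') (auto intro!: AE_I2 one integral_nonneg_AE int Bochner_Integration.integrable_add)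
    also have "\<dots> = (\<integral>x. (c * ?S x - (b - c * ?a))\<^sup>2 \<partial>PiM J \<nu>') + c\<^sup>2 * B\<^sup>2"
      using int[of J] PJ.prob_space by (subst Bochner_Integration.integral_add) auto
    also have "\<dots> \<le> (c * (\<Sum>i\<in>J. \<integral>z. f z \<partial>\<nu>' i) - (b - c * ?a))\<^sup>2 + c\<^sup>2 * (real (card J) * B\<^sup>2) + c\<^sup>2 * B\<^sup>2"
      using insert.IH[of "b - c * ?a"] insert.prems by simp
    also have "\<dots> = (c * (\<Sum>i\<in>insert j J. \<integral>z. f z \<partial>\<nu>' i) - b)\<^sup>2 + c\<^sup>2 * (real (card (insert j J)) * B\<^sup>2)"
      using insert.hyps by (simp add: algebra_simps)
    finally show ?case .
  qed
  from this[OF I subset_refl] have "(\<integral>x. (c * (\<Sum>i\<in>I. f (x i)) - b)\<^sup>2 \<partial>PiM I \<nu>')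
           \<le> (c * (\<Sum>i\<in>I. \<integral>z. f z \<partial>\<nu>' i) - b)\<^sup>2 + c\<^sup>2 * (real (card I) * B\<^sup>2)" .
  moreover have "PiM I \<nu>' = PiM I \<nu>" by (rule PiM_cong) (auto simp: \<nu>'_def)
  moreover have "(\<Sum>i\<in>I. \<integral>z. f z \<partial>\<nu>' i) = (\<Sum>i\<in>I. \<integral>z. f z \<partial>\<nu> i)"
    by (rule sum.cong) (auto simp: \<nu>'_def)
  ultimately show ?thesis by simp
qed

section \<open>Reversible transition densities\<close>

lemma one_le_t_mix: "1 \<le> t_mix X p q \<delta>"
  unfolding t_mix_def by (rule INF_greatest) (auto simp: one_enat_def)

lemma run_law_0: "run_law X p 0 x = return X x"
  by (simp add: run_law_def)

lemma run_law_Suc: "run_law X p (Suc T) x = run_law X p T x \<bind> (\<lambda>z. density X (\<lambda>y. ennreal (p z y)))"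
  by (simp add: run_law_def)

lemma kernel_prob_space:
  assumes "K \<in> M \<rightarrow>\<^sub>M prob_algebra X" "x \<in> space M"
  shows "prob_space (K x)" "sets (K x) = sets X" "space (K x) = space X"
  using measurable_space[OF assms] sets_eq_imp_space_eq by (auto simp: space_prob_algebra)

lemma kernel_integral_measurable:
  fixes f :: "'b \<Rightarrow> real"
  assumes "K \<in> M \<rightarrow>\<^sub>M prob_algebra X" "f \<in> borel_measurable X"
  shows "(\<lambda>x. \<integral>y. f y \<partial>K x) \<in> borel_measurable M"
  by (rule measurable_compose[OF measurable_prob_algebraD[OF assms(1)]
        integral_measurable_subprob_algebra[OF assms(2)]])

lemma kernel_integrable:
  fixes f :: "'b \<Rightarrow> real"
  assumes "K \<in> M \<rightarrow>\<^sub>M prob_algebra X" "f \<in> borel_measurable X"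
    and "\<And>y. y \<in> space X \<Longrightarrow> \<bar>f y\<bar> \<le> B" "x \<in> space M"
  shows "integrable (K x) f"
proof -
  note K = kernel_prob_space[OF assms(1,4)]
  interpret prob_space "K x" by (rule K(1))
  show ?thesis
    using assms(2,3) K(3) measurable_cong_sets[OF K(2) refl, of borel]
    by (intro integrable_const_bound[where B=B] AE_I2) auto
qed

lemma kernel_integral_abs_le:
  fixes f :: "'b \<Rightarrow> real"
  assumes "K \<in> M \<rightarrow>\<^sub>M prob_algebra X" "x \<in> space M"
    and "f \<in> borel_measurable X" "\<And>y. y \<in> space X \<Longrightarrow> \<bar>f y\<bar> \<le> B"
  shows "\<bar>\<integral>y. f y \<partial>K x\<bar> \<le> B"
proof -
  note K = kernel_prob_space[OF assms(1,2)]
  interpret prob_space "K x" by (rule K(1))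
  have "norm (\<integral>y. f y \<partial>K x) \<le> (\<integral>y. norm (f y) \<partial>K x)"
    by (rule integral_norm_bound)
  also have "\<dots> \<le> (\<integral>y. B \<partial>K x)"
    using kernel_integrable[OF assms(1,3,4,2)] assms(4) K(3)
    by (intro integral_mono) auto
  also have "\<dots> = B" using prob_space by simp
  finally show ?thesis by simp
qed

lemma kernel_integral_bind:
  fixes f :: "'b \<Rightarrow> real"
  assumes "\<mu> \<in> space (prob_algebra M)" "K \<in> M \<rightarrow>\<^sub>M prob_algebra X"
    and "f \<in> borel_measurable X" "\<And>y. y \<in> space X \<Longrightarrow> \<bar>f y\<bar> \<le> B"
  shows "(\<integral>y. f y \<partial>(\<mu> \<bind> K)) = (\<integral>x. (\<integral>y. f y \<partial>K x) \<partial>\<mu>)"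
proof (rule integral_bind[OF assms(3,4), where B'=1])
  have mu: "sets \<mu> = sets M" "prob_space \<mu>" using assms(1) by (auto simp: space_prob_algebra)
  show "K \<in> \<mu> \<rightarrow>\<^sub>M subprob_algebra X"
    using measurable_prob_algebraD[OF assms(2)] measurable_cong_sets[OF mu(1) refl] by blast
  show "finite_measure \<mu>" using mu(2) by (simp add: prob_space.finite_measure)
  show "AE x in \<mu>. emeasure (K x) (space (K x)) \<le> ennreal 1"
    using kernel_prob_space(1)[OF assms(2)] sets_eq_imp_space_eq[OF mu(1)]
    by (intro AE_I2) (simp add: prob_space.emeasure_space_1)
qed auto

text \<open>
  The local mixing step enters the proof only through reversibility and through the upper bound
  \<open>p x y \<le> c * q y\<close>: from any starting point, a single step already has a law dominated by \<open>c\<close> times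
  the equilibrium.
\<close>
locale reversible_density =
  fixes X :: "'a measure" and p :: "'a \<Rightarrow> 'a \<Rightarrow> real" and q :: "'a \<Rightarrow> real" and c :: real
  assumes sigma_finite: "sigma_finite_measure X"
    and p_measurable: "(\<lambda>(x, y). p x y) \<in> borel_measurable (X \<Otimes>\<^sub>M X)"
    and p_nonneg: "x \<in> space X \<Longrightarrow> y \<in> space X \<Longrightarrow> 0 \<le> p x y"
    and p_mass: "x \<in> space X \<Longrightarrow> (\<integral>\<^sup>+y. ennreal (p x y) \<partial>X) = 1"
    and q_measurable: "q \<in> borel_measurable X"
    and q_nonneg: "x \<in> space X \<Longrightarrow> 0 \<le> q x"
    and q_mass: "(\<integral>\<^sup>+y. ennreal (q y) \<partial>X) = 1"
    and detailed_balance: "x \<in> space X \<Longrightarrow> y \<in> space X \<Longrightarrow> q x * p x y = q y * p y x"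
    and p_le: "x \<in> space X \<Longrightarrow> y \<in> space X \<Longrightarrow> p x y \<le> c * q y"
begin

abbreviation \<pi> :: "'a measure" where "\<pi> \<equiv> density X (\<lambda>y. ennreal (q y))"
abbreviation step :: "'a \<Rightarrow> 'a measure" where "step z \<equiv> density X (\<lambda>y. ennreal (p z y))"

sublocale sigma_finite_measure X by (rule sigma_finite)

lemma p_measurable_section: "x \<in> space X \<Longrightarrow> p x \<in> borel_measurable X"
  using measurable_compose[OF measurable_Pair1' p_measurable] by simp

lemma p_measurable_section': "y \<in> space X \<Longrightarrow> (\<lambda>x. p x y) \<in> borel_measurable X"
  using measurable_compose[OF measurable_Pair2' p_measurable] by simp

lemma p_measurable_Pair [measurable (raw)]:
  assumes "f \<in> M \<rightarrow>\<^sub>M X" "g \<in> M \<rightarrow>\<^sub>M X"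
  shows "(\<lambda>x. p (f x) (g x)) \<in> borel_measurable M"
  using measurable_compose[OF measurable_Pair[OF assms] p_measurable] by simp

declare q_measurable [measurable]

lemma prob_space_\<pi>: "prob_space \<pi>"
  using q_mass by (auto intro!: prob_spaceI simp: emeasure_density cong: nn_integral_cong)

lemma \<pi>_in_prob_algebra: "\<pi> \<in> space (prob_algebra X)"
  using prob_space_\<pi> by (simp add: space_prob_algebra)

lemma prob_space_step: "x \<in> space X \<Longrightarrow> prob_space (step x)"
  using p_mass p_measurable_section
  by (auto intro!: prob_spaceI simp: emeasure_density cong: nn_integral_cong)

lemma step_kernel: "step \<in> X \<rightarrow>\<^sub>M prob_algebra X"
proof (rule measurable_prob_algebraI[OF prob_space_step measurable_subprob_algebra])
  show "subprob_space (step x)" if "x \<in> space X" for x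
    using prob_space_step[OF that] by (rule prob_space_imp_subprob_space)
  fix A assume [measurable]: "A \<in> sets X"
  have "(\<lambda>x. emeasure (step x) A) \<in> borel_measurable X \<longleftrightarrow>
    (\<lambda>x. \<integral>\<^sup>+y. ennreal (p x y) * indicator A y \<partial>X) \<in> borel_measurable X"
    using p_measurable_section by (intro measurable_cong) (simp add: emeasure_density)
  also have \<dots> by measurable
  finally show "(\<lambda>x. emeasure (step x) A) \<in> borel_measurable X" .
qed auto

lemma run_law_kernel: "run_law X p T \<in> X \<rightarrow>\<^sub>M prob_algebra X"
proof (induction T)
  case 0
  then show ?case by (simp add: run_law_def measurable_return_prob_space)
next
  case (Suc T)
  then show ?case
    unfolding run_law_Suc by (rule measurable_bind_prob_space[OF _ step_kernel])
qed

lemma run_law_Suc_integral: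
  fixes f :: "'a \<Rightarrow> real"
  assumes "f \<in> borel_measurable X" "\<And>y. y \<in> space X \<Longrightarrow> \<bar>f y\<bar> \<le> B" "x \<in> space X"
  shows "(\<integral>y. f y \<partial>run_law X p (Suc T) x) = (\<integral>z. (\<integral>y. f y \<partial>step z) \<partial>run_law X p T x)"
  unfolding run_law_Suc
  by (rule kernel_integral_bind[OF measurable_space[OF run_law_kernel assms(3)] step_kernel assms(1,2)])

text \<open>
  Detailed balance and the theorem of Tonelli. Stating invariance for the measures keeps all integrands
  nonnegative; the version for bounded functions follows from it.
\<close>
lemma \<pi>_bind_step: "\<pi> \<bind> step = \<pi>"
proof (rule measure_eqI)
  show "sets (\<pi> \<bind> step) = sets \<pi>"
    using sets_bind'[OF \<pi>_in_prob_algebra step_kernel] by simp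
  fix A assume "A \<in> sets (\<pi> \<bind> step)"
  then have A [measurable]: "A \<in> sets X"
    using sets_bind'[OF \<pi>_in_prob_algebra step_kernel] by simp
  interpret XX: pair_sigma_finite X X by unfold_locales
  have "emeasure (\<pi> \<bind> step) A = (\<integral>\<^sup>+x. emeasure (step x) A \<partial>\<pi>)"
    by (rule emeasure_bind_prob_algebra[OF \<pi>_in_prob_algebra step_kernel A])
  also have "\<dots> = (\<integral>\<^sup>+x. ennreal (q x) * emeasure (step x) A \<partial>X)"
    by (rule nn_integral_density) (auto intro!: measurable_emeasure_kernel[OF measurable_prob_algebraD[OF step_kernel]])
  also have "\<dots> = (\<integral>\<^sup>+x. \<integral>\<^sup>+y. ennreal (q x * p x y) * indicator A y \<partial>X \<partial>X)"
    using p_measurable_section q_nonneg p_nonneg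
    by (intro nn_integral_cong)
      (auto simp: emeasure_density nn_integral_cmult[symmetric] ennreal_mult mult.assoc intro!: nn_integral_cong)
  also have "\<dots> = (\<integral>\<^sup>+y. \<integral>\<^sup>+x. ennreal (q x * p x y) * indicator A y \<partial>X \<partial>X)"
    by (rule XX.Fubini') measurable
  also have "\<dots> = (\<integral>\<^sup>+y. ennreal (q y) * indicator A y \<partial>X)"
  proof (intro nn_integral_cong)
    fix y assume y: "y \<in> space X"
    have "(\<integral>\<^sup>+x. ennreal (q x * p x y) * indicator A y \<partial>X)
        = (\<integral>\<^sup>+x. (ennreal (q y) * indicator A y) * ennreal (p y x) \<partial>X)"
      using y detailed_balance[OF _ y] q_nonneg p_nonneg
      by (intro nn_integral_cong) (simp add: ennreal_mult ac_simps)
    also have "\<dots> = ennreal (q y) * indicator A y"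
      using p_measurable_section[OF y] p_mass[OF y] by (simp add: nn_integral_cmult)
    finally show "(\<integral>\<^sup>+x. ennreal (q x * p x y) * indicator A y \<partial>X) = ennreal (q y) * indicator A y" .
  qed
  also have "\<dots> = emeasure \<pi> A" by (simp add: emeasure_density)
  finally show "emeasure (\<pi> \<bind> step) A = emeasure \<pi> A" .
qed

lemma step_invariant:
  fixes f :: "'a \<Rightarrow> real"
  assumes "f \<in> borel_measurable X" "\<And>y. y \<in> space X \<Longrightarrow> \<bar>f y\<bar> \<le> B"
  shows "(\<integral>x. (\<integral>y. f y \<partial>step x) \<partial>\<pi>) = (\<integral>y. f y \<partial>\<pi>)"
  using kernel_integral_bind[OF \<pi>_in_prob_algebra step_kernel assms] by (simp add: \<pi>_bind_step)

lemma run_law_invariant: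
  fixes f :: "'a \<Rightarrow> real"
  assumes "f \<in> borel_measurable X" "\<And>y. y \<in> space X \<Longrightarrow> \<bar>f y\<bar> \<le> B"
  shows "(\<integral>x. (\<integral>y. f y \<partial>run_law X p T x) \<partial>\<pi>) = (\<integral>y. f y \<partial>\<pi>)"
  using assms
proof (induction T arbitrary: f)
  case 0
  then show ?case by (auto intro!: Bochner_Integration.integral_cong simp: run_law_0 integral_return)
next
  case (Suc T)
  have "(\<integral>x. (\<integral>y. f y \<partial>run_law X p (Suc T) x) \<partial>\<pi>) = (\<integral>x. (\<integral>z. (\<integral>y. f y \<partial>step z) \<partial>run_law X p T x) \<partial>\<pi>)"
    by (intro Bochner_Integration.integral_cong refl run_law_Suc_integral[OF Suc.prems]) simp_all
  also have "\<dots> = (\<integral>z. (\<integral>y. f y \<partial>step z) \<partial>\<pi>)"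
    by (rule Suc.IH[OF kernel_integral_measurable[OF step_kernel Suc.prems(1)]])
      (rule kernel_integral_abs_le[OF step_kernel _ Suc.prems])
  also have "\<dots> = (\<integral>y. f y \<partial>\<pi>)" by (rule step_invariant[OF Suc.prems])
  finally show ?case .
qed

lemma \<pi>_integrable:
  fixes f :: "'a \<Rightarrow> real"
  assumes "f \<in> borel_measurable X" "\<And>y. y \<in> space X \<Longrightarrow> \<bar>f y\<bar> \<le> B"
  shows "integrable \<pi> f"
proof -
  interpret prob_space \<pi> by (rule prob_space_\<pi>)
  show ?thesis using assms by (intro integrable_const_bound[where B=B] AE_I2) auto
qed

lemma step_le:
  fixes f :: "'a \<Rightarrow> real"
  assumes f: "f \<in> borel_measurable X" "\<And>y. y \<in> space X \<Longrightarrow> \<bar>f y\<bar> \<le> B"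
    and nonneg: "\<And>y. y \<in> space X \<Longrightarrow> 0 \<le> f y" and x: "x \<in> space X"
  shows "(\<integral>y. f y \<partial>step x) \<le> c * (\<integral>y. f y \<partial>\<pi>)"
proof -
  note [measurable] = f(1) p_measurable_section[OF x]
  have i1: "integrable X (\<lambda>y. p x y * f y)"
  proof -
    have "integrable (step x) f" by (rule kernel_integrable[OF step_kernel f x])
    then show ?thesis using p_nonneg[OF x] by (subst (asm) integrable_density) auto
  qed
  have i2: "integrable X (\<lambda>y. q y * f y)"
  proof -
    have "integrable \<pi> f" by (rule \<pi>_integrable[OF f])
    then show ?thesis using q_nonneg by (subst (asm) integrable_density) auto
  qed
  have "(\<integral>y. f y \<partial>step x) = (\<integral>y. p x y * f y \<partial>X)"
    using p_nonneg[OF x] by (subst integral_density) auto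
  also have "\<dots> \<le> (\<integral>y. c * (q y * f y) \<partial>X)"
  proof (rule integral_mono[OF i1 integrable_mult_right[OF i2]])
    show "p x y * f y \<le> c * (q y * f y)" if "y \<in> space X" for y
      using mult_right_mono[OF p_le[OF x that] nonneg[OF that]] by (simp add: mult.assoc)
  qed
  also have "\<dots> = c * (\<integral>y. q y * f y \<partial>X)" by simp
  also have "(\<integral>y. q y * f y \<partial>X) = (\<integral>y. f y \<partial>\<pi>)"
    using q_nonneg by (subst integral_density) auto
  finally show ?thesis .
qed

text \<open>
  One step suffices for the bound, and the remaining steps preserve it: by invariance they replace \<open>f\<close>
  by a function with the same mean under \<open>\<pi>\<close>.
\<close>
lemma run_law_le:
  fixes f :: "'a \<Rightarrow> real"
  assumes "f \<in> borel_measurable X" "\<And>y. y \<in> space X \<Longrightarrow> \<bar>f y\<bar> \<le> B"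
    and "\<And>y. y \<in> space X \<Longrightarrow> 0 \<le> f y" and x: "x \<in> space X"
  shows "(\<integral>y. f y \<partial>run_law X p (Suc T) x) \<le> c * (\<integral>y. f y \<partial>\<pi>)"
  using assms(1-3)
proof (induction T arbitrary: f)
  case 0
  have "(\<lambda>z. \<integral>y. f y \<partial>step z) \<in> borel_measurable X"
    by (rule kernel_integral_measurable[OF step_kernel 0(1)])
  then show ?case
    using step_le[OF 0 x] run_law_Suc_integral[OF 0(1,2) x] x by (simp add: run_law_0 integral_return)
next
  case (Suc T)
  have "(\<integral>y. f y \<partial>run_law X p (Suc (Suc T)) x) = (\<integral>z. (\<integral>y. f y \<partial>step z) \<partial>run_law X p (Suc T) x)"
    by (rule run_law_Suc_integral[OF Suc.prems(1,2) x])
  also have "\<dots> \<le> c * (\<integral>z. (\<integral>y. f y \<partial>step z) \<partial>\<pi>)"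
    using Suc.prems
    by (intro Suc.IH kernel_integral_measurable[OF step_kernel] kernel_integral_abs_le[OF step_kernel]
        integral_nonneg_AE AE_I2) auto
  also have "\<dots> = c * (\<integral>y. f y \<partial>\<pi>)" by (simp add: step_invariant[OF Suc.prems(1,2)])
  finally show ?case .
qed

text \<open>
  The \<open>n\<close>-step density is defined by Bochner integrals, which are \<open>0\<close> on functions that are not
  integrable. The bound on \<open>p\<close> makes \<open>\<lambda>z. p z y\<close> bounded and thereby excludes that case.
\<close>
lemma run_law_eq_density:
  assumes x: "x \<in> space X"
  shows "n_step_pdf X p (Suc n) x \<in> borel_measurable X \<and> (\<forall>y\<in>space X. 0 \<le> n_step_pdf X p (Suc n) x y)
    \<and> run_law X p (Suc n) x = density X (\<lambda>y. ennreal (n_step_pdf X p (Suc n) x y))"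
proof (induction n)
  case 0
  have "return X x \<bind> step = step x"
    by (rule bind_return[OF measurable_prob_algebraD[OF step_kernel] x])
  then show ?case
    using p_measurable_section[OF x] p_nonneg[OF x] by (simp add: n_step_pdf_def run_law_Suc run_law_0)
next
  case (Suc n)
  let ?p = "n_step_pdf X p (Suc n) x" and ?p' = "n_step_pdf X p (Suc (Suc n)) x"
  have p' : "?p' = (\<lambda>y. \<integral>z. ?p z * p z y \<partial>X)" by (simp add: n_step_pdf_def)
  have m [measurable]: "?p \<in> borel_measurable X" and nn: "\<And>y. y \<in> space X \<Longrightarrow> 0 \<le> ?p y"
    and eq: "run_law X p (Suc n) x = density X (\<lambda>y. ennreal (?p y))" using Suc by auto
  have m' [measurable]: "?p' \<in> borel_measurable X" unfolding p' by measurable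
  have nn': "0 \<le> ?p' y" if "y \<in> space X" for y
    unfolding p' using nn p_nonneg that by (intro integral_nonneg_AE AE_I2) auto
  have prob: "prob_space (density X (\<lambda>y. ennreal (?p y)))"
    using kernel_prob_space(1)[OF run_law_kernel x] by (simp add: eq[symmetric])
  have inP: "density X (\<lambda>y. ennreal (?p y)) \<in> space (prob_algebra X)"
    using prob by (simp add: space_prob_algebra)
  have int: "integrable X (\<lambda>z. ?p z * p z y)" if y: "y \<in> space X" for y
  proof -
    interpret P: prob_space "density X (\<lambda>y. ennreal (?p y))" by (rule prob)
    have "integrable (density X (\<lambda>y. ennreal (?p y))) (\<lambda>z. p z y)"
      using p_measurable_section'[OF y] p_le[OF _ y] p_nonneg[OF _ y]
      by (intro P.integrable_const_bound[where B="c * q y"] AE_I2) auto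
    then show ?thesis
      using nn p_measurable_section'[OF y] by (subst (asm) integrable_density) auto
  qed
  interpret XX: pair_sigma_finite X X by unfold_locales
  have "run_law X p (Suc (Suc n)) x = density X (\<lambda>y. ennreal (?p' y))"
  proof (rule measure_eqI)
    have sets: "sets (run_law X p (Suc (Suc n)) x) = sets X"
      by (rule kernel_prob_space(2)[OF run_law_kernel x])
    then show "sets (run_law X p (Suc (Suc n)) x) = sets (density X (\<lambda>y. ennreal (?p' y)))" by simp
    fix A assume "A \<in> sets (run_law X p (Suc (Suc n)) x)"
    then have A [measurable]: "A \<in> sets X" using sets by simp
    have "emeasure (run_law X p (Suc (Suc n)) x) A = (\<integral>\<^sup>+z. emeasure (step z) A \<partial>density X (\<lambda>y. ennreal (?p y)))"
      unfolding run_law_Suc[of _ _ "Suc n"] eq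
      by (rule emeasure_bind_prob_algebra[OF inP step_kernel A])
    also have "\<dots> = (\<integral>\<^sup>+z. ennreal (?p z) * emeasure (step z) A \<partial>X)"
      by (rule nn_integral_density) (auto intro!: measurable_emeasure_kernel[OF measurable_prob_algebraD[OF step_kernel]])
    also have "\<dots> = (\<integral>\<^sup>+z. \<integral>\<^sup>+y. ennreal (?p z * p z y) * indicator A y \<partial>X \<partial>X)"
      using p_measurable_section nn p_nonneg
      by (intro nn_integral_cong)
        (auto simp: emeasure_density nn_integral_cmult[symmetric] ennreal_mult mult.assoc intro!: nn_integral_cong)
    also have "\<dots> = (\<integral>\<^sup>+y. \<integral>\<^sup>+z. ennreal (?p z * p z y) * indicator A y \<partial>X \<partial>X)"
      by (rule XX.Fubini') measurable
    also have "\<dots> = (\<integral>\<^sup>+y. ennreal (?p' y) * indicator A y \<partial>X)"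
    proof (intro nn_integral_cong)
      fix y assume y: "y \<in> space X"
      have "(\<integral>\<^sup>+z. ennreal (?p z * p z y) \<partial>X) = ennreal (?p' y)"
        unfolding p' using int[OF y] nn p_nonneg[OF _ y] by (intro nn_integral_eq_integral AE_I2) auto
      then show "(\<integral>\<^sup>+z. ennreal (?p z * p z y) * indicator A y \<partial>X) = ennreal (?p' y) * indicator A y"
        using p_measurable_section'[OF y] by (subst nn_integral_multc) auto
    qed
    also have "\<dots> = emeasure (density X (\<lambda>y. ennreal (?p' y))) A" by (simp add: emeasure_density)
    finally show "emeasure (run_law X p (Suc (Suc n)) x) A = emeasure (density X (\<lambda>y. ennreal (?p' y))) A" .
  qed
  with m' nn' show ?case by blast
qed

text \<open>
  The infimum defining the mixing time is attained at some \<open>n \<le> T\<close>. After time \<open>n\<close> the distance to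
  equilibrium does not grow: a further step amounts to testing with the averaged function
  \<open>\<lambda>z. \<integral>y. f y \<partial>step z\<close>, which has the same bound and the same mean.
\<close>
lemma t_mix_le_imp_run_law_close:
  fixes f :: "'a \<Rightarrow> real"
  assumes T: "t_mix X p q \<delta> \<le> enat T" and \<delta>: "0 \<le> \<delta>"
    and f: "f \<in> borel_measurable X" "\<And>y. y \<in> space X \<Longrightarrow> \<bar>f y\<bar> \<le> B" and x: "x \<in> space X"
  shows "\<bar>(\<integral>y. f y \<partial>run_law X p T x) - (\<integral>y. f y \<partial>\<pi>)\<bar> \<le> 2 * \<delta> * B"
proof -
  let ?S = "{n. 1 \<le> n \<and> (SUP x\<in>space X. \<integral>\<^sup>+y. ennreal \<bar>n_step_pdf X p n x y - q y\<bar> \<partial>X) \<le> ennreal (2 * \<delta>)}"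
  have "?S \<noteq> {}"
  proof
    assume "?S = {}"
    then have "t_mix X p q \<delta> = \<infinity>" unfolding t_mix_def by (simp only: image_empty Inf_empty top_enat_def)
    with T show False by simp
  qed
  then have "t_mix X p q \<delta> \<in> enat ` ?S"
    unfolding t_mix_def by (intro wellorder_InfI[of "enat (SOME n. n \<in> ?S)"] imageI) (metis (lifting) ex_in_conv someI)
  then obtain n where n: "t_mix X p q \<delta> = enat n" "n \<in> ?S" by blast
  then obtain m where m: "n = Suc m" by (cases n) auto
  let ?p = "n_step_pdf X p (Suc m) x"
  have pm [measurable]: "?p \<in> borel_measurable X" and pnn: "\<And>y. y \<in> space X \<Longrightarrow> 0 \<le> ?p y"
    and peq: "run_law X p (Suc m) x = density X (\<lambda>y. ennreal (?p y))"
    using run_law_eq_density[OF x] by blast+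
  have close: "(\<integral>\<^sup>+y. ennreal \<bar>?p y - q y\<bar> \<partial>X) \<le> ennreal (2 * \<delta>)"
    using n(2) x m by (auto intro: SUP_upper order_trans)
  have iabs: "integrable X (\<lambda>y. ?p y - q y)"
    using close by (intro integrableI_bounded) (auto simp: le_less_trans[OF _ ennreal_less_top])
  have close_f: "\<bar>(\<integral>y. f y \<partial>run_law X p (Suc m) x) - (\<integral>y. f y \<partial>\<pi>)\<bar> \<le> 2 * \<delta> * B"
    if f: "f \<in> borel_measurable X" "\<And>y. y \<in> space X \<Longrightarrow> \<bar>f y\<bar> \<le> B" for f
  proof -
    note [measurable] = f(1)
    have i1: "integrable X (\<lambda>y. ?p y * f y)"
    proof -
      have "integrable (run_law X p (Suc m) x) f" by (rule kernel_integrable[OF run_law_kernel f x])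
      then show ?thesis using pnn unfolding peq by (subst (asm) integrable_density) auto
    qed
    have i2: "integrable X (\<lambda>y. q y * f y)"
    proof -
      have "integrable \<pi> f" by (rule \<pi>_integrable[OF f])
      then show ?thesis using q_nonneg by (subst (asm) integrable_density) auto
    qed
    have B: "0 \<le> B" using f(2)[OF x] by linarith
    have "(\<integral>y. f y \<partial>run_law X p (Suc m) x) - (\<integral>y. f y \<partial>\<pi>) = (\<integral>y. ?p y * f y \<partial>X) - (\<integral>y. q y * f y \<partial>X)"
      unfolding peq using pnn q_nonneg by (subst (1 2) integral_density) auto
    also have "\<dots> = (\<integral>y. (?p y - q y) * f y \<partial>X)"
      using i1 i2 by (simp add: left_diff_distrib)
    finally have "\<bar>(\<integral>y. f y \<partial>run_law X p (Suc m) x) - (\<integral>y. f y \<partial>\<pi>)\<bar> \<le> (\<integral>y. \<bar>(?p y - q y) * f y\<bar> \<partial>X)"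
      using integral_abs_bound by metis
    also have "\<dots> \<le> (\<integral>y. \<bar>?p y - q y\<bar> * B \<partial>X)"
    proof (intro integral_mono integrable_abs integrable_mult_left iabs)
      show "integrable X (\<lambda>y. (?p y - q y) * f y)"
        using i1 i2 by (simp add: left_diff_distrib)
      show "\<bar>(?p y - q y) * f y\<bar> \<le> \<bar>?p y - q y\<bar> * B" if "y \<in> space X" for y
        using f(2)[OF that] by (simp add: abs_mult mult_left_mono)
    qed
    also have "\<dots> = (\<integral>y. \<bar>?p y - q y\<bar> \<partial>X) * B" by simp
    also have "(\<integral>y. \<bar>?p y - q y\<bar> \<partial>X) \<le> 2 * \<delta>"
      using close nn_integral_eq_integral[OF integrable_abs[OF iabs]] \<delta> by (auto simp: ennreal_le_iff)
    finally show ?thesis using B by (auto intro: mult_right_mono)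
  qed
  have "Suc m \<le> T" using T n m by simp
  then show ?thesis
    using f
  proof (induction T arbitrary: f rule: dec_induct)
    case base
    then show ?case by (rule close_f)
  next
    case (step T)
    have "\<bar>(\<integral>z. (\<integral>y. f y \<partial>local.step z) \<partial>run_law X p T x) - (\<integral>z. (\<integral>y. f y \<partial>local.step z) \<partial>\<pi>)\<bar> \<le> 2 * \<delta> * B"
      by (rule step.IH[OF kernel_integral_measurable[OF step_kernel step.prems(1)]])
        (rule kernel_integral_abs_le[OF step_kernel _ step.prems])
    then show ?case
      using run_law_Suc_integral[OF step.prems x] step_invariant[OF step.prems] by simp
  qed
qed

end

section \<open>Error analysis of an annealed particle system\<close>

lemma point_measure_draw_prob_space:
  assumes "finite I" "\<And>j. j \<in> I \<Longrightarrow> 0 < v j" "I \<noteq> {}"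
  shows "prob_space (point_measure I (\<lambda>j. ennreal (v j / (\<Sum>n\<in>I. v n))))"
proof -
  have S: "0 < (\<Sum>n\<in>I. v n)" using assms by (intro sum_pos) auto
  have "(\<Sum>j\<in>I. ennreal (v j / (\<Sum>n\<in>I. v n))) = ennreal (\<Sum>j\<in>I. v j / (\<Sum>n\<in>I. v n))"
    using S assms(2) by (intro sum_ennreal divide_nonneg_pos less_imp_le)
  also have "(\<Sum>j\<in>I. v j / (\<Sum>n\<in>I. v n)) = 1"
    using S by (simp only: sum_divide_distrib[symmetric]) simp
  finally show ?thesis
    by (intro prob_space_point_measure assms(1)) simp_all
qed

text \<open>
  Particles passing through targets \<open>\<mu> 0, \<dots>, \<mu> n\<close>. The function \<open>r k\<close> is the unnormalised weight used
  for resampling, and \<open>g k\<close> is its multiple that is the density of \<open>\<mu> (Suc k)\<close> with respect to \<open>\<mu> k\<close>.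
  The assumption \<open>dominated\<close> is the smoothing property of the mutation kernels that replaces global
  mixing.
\<close>
locale annealed_particles =
  fixes X :: "'a measure" and N n :: nat
    and P :: "nat \<Rightarrow> 'a \<Rightarrow> 'a measure" and \<mu> :: "nat \<Rightarrow> 'a measure"
    and r g :: "nat \<Rightarrow> 'a \<Rightarrow> real" and s :: "nat \<Rightarrow> real" and R c :: real
  assumes N: "1 \<le> N"
    and kernel: "k \<le> n \<Longrightarrow> P k \<in> X \<rightarrow>\<^sub>M prob_algebra X"
    and target: "k \<le> n \<Longrightarrow> \<mu> k \<in> space (prob_algebra X)"
    and invariant: "k \<le> n \<Longrightarrow> f \<in> borel_measurable X \<Longrightarrow> (\<And>x. x \<in> space X \<Longrightarrow> \<bar>f x\<bar> \<le> B)
          \<Longrightarrow> (\<integral>x. (\<integral>z. f z \<partial>P k x) \<partial>\<mu> k) = (\<integral>z. f z \<partial>\<mu> k)"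
    and dominated: "k \<le> n \<Longrightarrow> f \<in> borel_measurable X \<Longrightarrow> (\<And>x. x \<in> space X \<Longrightarrow> \<bar>f x\<bar> \<le> B)
          \<Longrightarrow> (\<And>x. x \<in> space X \<Longrightarrow> 0 \<le> f x) \<Longrightarrow> x \<in> space X
          \<Longrightarrow> (\<integral>z. f z \<partial>P k x) \<le> c * (\<integral>z. f z \<partial>\<mu> k)"
    and r_measurable: "k < n \<Longrightarrow> r k \<in> borel_measurable X"
    and r_pos: "k < n \<Longrightarrow> x \<in> space X \<Longrightarrow> 0 < r k x"
    and s_pos: "k < n \<Longrightarrow> 0 < s k"
    and g_eq: "k < n \<Longrightarrow> g k = (\<lambda>x. s k * r k x)"
    and g_le: "k < n \<Longrightarrow> x \<in> space X \<Longrightarrow> g k x \<le> R"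
    and reweight: "k < n \<Longrightarrow> f \<in> borel_measurable X \<Longrightarrow> (\<And>x. x \<in> space X \<Longrightarrow> \<bar>f x\<bar> \<le> B)
          \<Longrightarrow> (\<integral>x. g k x * f x \<partial>\<mu> k) = (\<integral>x. f x \<partial>\<mu> (Suc k))"
    and R: "1 \<le> R" and c: "1 \<le> c"
begin

abbreviation "CX \<equiv> PiM {1..N} (\<lambda>_. X)"

definition avg :: "(nat \<Rightarrow> 'a) \<Rightarrow> ('a \<Rightarrow> real) \<Rightarrow> real" where
  "avg x f = 1 / real N * (\<Sum>i\<in>{1..N}. f (x i))"

definition mutate :: "nat \<Rightarrow> (nat \<Rightarrow> 'a) \<Rightarrow> (nat \<Rightarrow> 'a) measure" where
  "mutate k y = PiM {1..N} (\<lambda>i. P k (y i))"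

primrec law :: "(nat \<Rightarrow> 'a) \<Rightarrow> nat \<Rightarrow> (nat \<Rightarrow> 'a) measure" where
  "law y 0 = mutate 0 y"
| "law y (Suc k) = (law y k \<bind> resample_law X (r k) N) \<bind> mutate (Suc k)"

definition next_level :: "nat \<Rightarrow> (nat \<Rightarrow> 'a) \<Rightarrow> (nat \<Rightarrow> 'a) measure" where
  "next_level k x = resample_law X (r k) N x \<bind> mutate (Suc k)"

lemma component: "x \<in> space CX \<Longrightarrow> i \<in> {1..N} \<Longrightarrow> x i \<in> space X"
  by (auto simp: space_PiM)

lemma avg_measurable [measurable]:
  assumes [measurable]: "f \<in> borel_measurable X"
  shows "(\<lambda>x. avg x f) \<in> borel_measurable CX"
  unfolding avg_def by measurable

lemma avg_mono:
  assumes "\<And>z. z \<in> space X \<Longrightarrow> f z \<le> f' z" "\<And>i. i \<in> {1..N} \<Longrightarrow> x i \<in> space X"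
  shows "avg x f \<le> avg x f'"
  unfolding avg_def using assms by (intro mult_left_mono sum_mono) auto

lemma avg_cong:
  assumes "\<And>z. z \<in> space X \<Longrightarrow> f z = f' z" "x \<in> space CX"
  shows "avg x f = avg x f'"
  unfolding avg_def using assms component by (intro arg_cong2[where f="(*)"] sum.cong) auto

lemma avg_const: "avg x (\<lambda>_. t) = t"
  using N by (simp add: avg_def)

lemma avg_abs_le:
  assumes "\<And>z. z \<in> space X \<Longrightarrow> \<bar>f z\<bar> \<le> B" "\<And>i. i \<in> {1..N} \<Longrightarrow> x i \<in> space X"
  shows "\<bar>avg x f\<bar> \<le> B"
proof -
  have "avg x f \<le> avg x (\<lambda>_. B)" "avg x (\<lambda>_. - B) \<le> avg x f"
    using assms by (force intro!: avg_mono)+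
  then show ?thesis by (simp add: avg_const)
qed

lemma r_sum_pos:
  assumes "k < n" "x \<in> space CX"
  shows "0 < (\<Sum>j\<in>{1..N}. r k (x j))"
  using r_pos[OF assms(1) component[OF assms(2)]] N by (intro sum_pos) auto

definition draw :: "nat \<Rightarrow> (nat \<Rightarrow> 'a) \<Rightarrow> 'a measure" where
  "draw k x = distr (point_measure {1..N} (\<lambda>j. ennreal (r k (x j) / (\<Sum>m\<in>{1..N}. r k (x m))))) X x"

lemma draw_kernel:
  assumes k: "k < n"
  shows "draw k \<in> CX \<rightarrow>\<^sub>M prob_algebra X"
proof (rule measurable_prob_algebraI)
  let ?pm = "\<lambda>x. point_measure {1..N} (\<lambda>j. ennreal (r k (x j) / (\<Sum>m\<in>{1..N}. r k (x m))))"
  have m: "x \<in> ?pm x \<rightarrow>\<^sub>M X" if "x \<in> space CX" for x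
    using component[OF that] by auto
  show prob: "prob_space (draw k x)" if "x \<in> space CX" for x
  proof -
    have pos: "0 < r k (x j)" if "j \<in> {1..N}" for j
      by (rule r_pos[OF k component[OF \<open>x \<in> space CX\<close> that]])
    have "{1..N} \<noteq> {}" using N by simp
    then have "prob_space (?pm x)"
      by (intro point_measure_draw_prob_space[of "{1..N}" "\<lambda>j. r k (x j)"] pos finite_atLeastAtMost)
    then show ?thesis unfolding draw_def by (rule prob_space.prob_space_distr[OF _ m[OF that]])
  qed
  show "draw k \<in> CX \<rightarrow>\<^sub>M subprob_algebra X"
  proof (rule measurable_subprob_algebra)
    show "subprob_space (draw k x)" if "x \<in> space CX" for x
      using prob[OF that] by (rule prob_space_imp_subprob_space)
    show "sets (draw k x) = sets X" for x by (simp add: draw_def)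
    fix A assume A: "A \<in> sets X"
    have "emeasure (draw k x) A
        = (\<Sum>j\<in>{1..N}. ennreal (r k (x j) / (\<Sum>m\<in>{1..N}. r k (x m))) * indicator A (x j))"
      if x: "x \<in> space CX" for x
    proof -
      have "emeasure (draw k x) A = emeasure (?pm x) (x -` A \<inter> {1..N})"
        unfolding draw_def using emeasure_distr[OF m[OF x] A] by (simp add: space_point_measure)
      also have "\<dots> = (\<Sum>j\<in>x -` A \<inter> {1..N}. ennreal (r k (x j) / (\<Sum>m\<in>{1..N}. r k (x m))))"
        by (rule emeasure_point_measure_finite) auto
      also have "\<dots> = (\<Sum>j\<in>{1..N}. ennreal (r k (x j) / (\<Sum>m\<in>{1..N}. r k (x m))) * indicator A (x j))"
        by (rule sum.mono_neutral_cong_left) (auto simp: indicator_def)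
      finally show ?thesis .
    qed
    note eq = this
    have "(\<lambda>x. emeasure (draw k x) A) \<in> borel_measurable CX \<longleftrightarrow>
        (\<lambda>x. \<Sum>j\<in>{1..N}. ennreal (r k (x j) / (\<Sum>m\<in>{1..N}. r k (x m))) * indicator A (x j))
        \<in> borel_measurable CX"
      by (rule measurable_cong) (rule eq)
    also have \<dots>
    proof -
      have comp: "(\<lambda>x. x j) \<in> CX \<rightarrow>\<^sub>M X" if "j \<in> {1..N}" for j
        by (rule measurable_component_singleton[OF that])
      have rm: "(\<lambda>x. r k (x j)) \<in> borel_measurable CX" if "j \<in> {1..N}" for j
        by (rule measurable_compose[OF comp[OF that] r_measurable[OF k]])
      have "(\<lambda>x. indicator A (x j) :: ennreal) \<in> borel_measurable CX" if "j \<in> {1..N}" for j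
        by (rule measurable_compose[OF comp[OF that] borel_measurable_indicator[OF A]])
      then show ?thesis
        by (intro borel_measurable_sum borel_measurable_times_ennreal
            measurable_compose[OF borel_measurable_divide[OF rm borel_measurable_sum[OF rm]] measurable_ennreal])
    qed
    finally show "(\<lambda>x. emeasure (draw k x) A) \<in> borel_measurable CX" .
  qed
qed

lemma draw_integral:
  fixes f :: "'a \<Rightarrow> real"
  assumes k: "k < n" and x: "x \<in> space CX" and f: "f \<in> borel_measurable X"
  shows "(\<integral>z. f z \<partial>draw k x) = (\<Sum>j\<in>{1..N}. r k (x j) / (\<Sum>m\<in>{1..N}. r k (x m)) * f (x j))"
proof -
  have nn: "0 \<le> r k (x j) / (\<Sum>m\<in>{1..N}. r k (x m))" if "j \<in> {1..N}" for j
    using r_pos[OF k component[OF x that]] r_sum_pos[OF k x] by simp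
  have "x \<in> point_measure {1..N} (\<lambda>j. ennreal (r k (x j) / (\<Sum>m\<in>{1..N}. r k (x m)))) \<rightarrow>\<^sub>M X"
    using component[OF x] by auto
  then have "(\<integral>z. f z \<partial>draw k x)
      = (\<integral>j. f (x j) \<partial>point_measure {1..N} (\<lambda>j. ennreal (r k (x j) / (\<Sum>m\<in>{1..N}. r k (x m)))))"
    unfolding draw_def by (rule integral_distr[OF _ f])
  also have "\<dots> = (\<Sum>j\<in>{1..N}. (r k (x j) / (\<Sum>m\<in>{1..N}. r k (x m))) *\<^sub>R f (x j))"
    using nn by (intro lebesgue_integral_point_measure_finite) auto
  finally show ?thesis by simp
qed

lemma resample_kernel:
  assumes k: "k < n"
  shows "resample_law X (r k) N \<in> CX \<rightarrow>\<^sub>M prob_algebra CX"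
proof -
  have "(\<lambda>x. PiM {1..N} (\<lambda>i. draw k x)) \<in> CX \<rightarrow>\<^sub>M prob_algebra CX"
    by (rule PiM_measurable_prob_algebra[OF finite_atLeastAtMost draw_kernel[OF k]])
  then show ?thesis
    unfolding resample_law_def draw_def .
qed

lemma mutate_kernel:
  assumes k: "k \<le> n"
  shows "mutate k \<in> CX \<rightarrow>\<^sub>M prob_algebra CX"
  unfolding mutate_def[abs_def]
proof (rule PiM_measurable_prob_algebra)
  show "(\<lambda>y. P k (y i)) \<in> CX \<rightarrow>\<^sub>M prob_algebra X" if "i \<in> {1..N}" for i
    using measurable_compose[OF measurable_component_singleton[OF that, of "\<lambda>_. X"] kernel[OF k]] .
qed simp

lemma next_level_kernel: "k < n \<Longrightarrow> next_level k \<in> CX \<rightarrow>\<^sub>M prob_algebra CX"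
  unfolding next_level_def by (intro measurable_bind_prob_space[OF resample_kernel mutate_kernel]) auto

lemma law_0_in_prob_algebra:
  assumes "\<And>i. i \<in> {1..N} \<Longrightarrow> y i \<in> space X"
  shows "law y 0 \<in> space (prob_algebra CX)"
  using kernel_prob_space[OF kernel, of 0] assms
  by (auto simp: mutate_def space_prob_algebra intro!: prob_space_PiM sets_PiM_cong)

lemma law_in_prob_algebra:
  assumes "\<And>i. i \<in> {1..N} \<Longrightarrow> y i \<in> space X" "k \<le> n"
  shows "law y k \<in> space (prob_algebra CX)"
  using assms(2)
proof (induction k)
  case 0
  show ?case by (rule law_0_in_prob_algebra[OF assms(1)])
next
  case (Suc k)
  have "(\<lambda>_. law y k \<bind> resample_law X (r k) N) \<in> count_space UNIV \<rightarrow>\<^sub>M prob_algebra CX"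
    using Suc by (intro measurable_bind_prob_space[OF _ resample_kernel]) auto
  from measurable_bind_prob_space[OF this mutate_kernel[OF Suc.prems]]
  have "(\<lambda>_. law y (Suc k)) \<in> count_space UNIV \<rightarrow>\<^sub>M prob_algebra CX"
    unfolding law.simps .
  then show ?case by (rule measurable_space) simp
qed

lemma law_Suc:
  assumes y: "\<And>i. i \<in> {1..N} \<Longrightarrow> y i \<in> space X" and k: "k < n"
  shows "law y (Suc k) = law y k \<bind> next_level k"
proof -
  have "sets (law y k) = sets CX"
    using law_in_prob_algebra[of y k] y k by (simp add: space_prob_algebra)
  then have "resample_law X (r k) N \<in> law y k \<rightarrow>\<^sub>M subprob_algebra CX"
    using measurable_prob_algebraD[OF resample_kernel[OF k]] measurable_cong_sets by blast
  then show ?thesis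
    unfolding law.simps next_level_def[abs_def]
    by (rule bind_assoc[OF _ measurable_prob_algebraD[OF mutate_kernel]]) (use k in auto)
qed

lemma avg_square_bound:
  fixes w :: real
  assumes "\<And>z. z \<in> space X \<Longrightarrow> \<bar>f z\<bar> \<le> B" "x \<in> space CX"
  shows "\<bar>(w * avg x f - b)\<^sup>2\<bar> \<le> (\<bar>w\<bar> * B + \<bar>b\<bar>)\<^sup>2"
proof -
  have "\<bar>w * avg x f - b\<bar> \<le> \<bar>w\<bar> * \<bar>avg x f\<bar> + \<bar>b\<bar>"
    by (metis abs_mult abs_triangle_ineq4)
  also have "\<dots> \<le> \<bar>w\<bar> * B + \<bar>b\<bar>"
    using avg_abs_le[of f B x] assms component by (intro add_right_mono mult_left_mono) auto
  finally have "\<bar>w * avg x f - b\<bar>\<^sup>2 \<le> (\<bar>w\<bar> * B + \<bar>b\<bar>)\<^sup>2"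
    by (rule power_mono) simp
  then show ?thesis by simp
qed

lemma mutate_square_le:
  assumes k: "k \<le> n" and y: "\<And>i. i \<in> {1..N} \<Longrightarrow> y i \<in> space X"
    and f: "f \<in> borel_measurable X" "\<And>z. z \<in> space X \<Longrightarrow> \<bar>f z\<bar> \<le> B"
  shows "(\<integral>x. (w * avg x f - b)\<^sup>2 \<partial>mutate k y)
           \<le> (w * avg y (\<lambda>z. \<integral>u. f u \<partial>P k z) - b)\<^sup>2 + w\<^sup>2 * B\<^sup>2 / N"
proof -
  have "(\<integral>x. (w / N * (\<Sum>i\<in>{1..N}. f (x i)) - b)\<^sup>2 \<partial>mutate k y)
       \<le> (w / N * (\<Sum>i\<in>{1..N}. \<integral>u. f u \<partial>P k (y i)) - b)\<^sup>2 + (w / N)\<^sup>2 * (real (card {1..N}) * B\<^sup>2)"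
    unfolding mutate_def
    using kernel_prob_space[OF kernel[OF k] y]
    by (intro PiM_integral_affine_sum_square_le[where X=X] f) auto
  then show ?thesis using N by (simp add: avg_def power2_eq_square)
qed

lemma resample_square_le:
  assumes k: "k < n" and x: "x \<in> space CX"
    and f: "f \<in> borel_measurable X" "\<And>z. z \<in> space X \<Longrightarrow> \<bar>f z\<bar> \<le> B"
  shows "(\<integral>y. (w * avg y f - b)\<^sup>2 \<partial>resample_law X (r k) N x)
           \<le> (w * (\<integral>z. f z \<partial>draw k x) - b)\<^sup>2 + w\<^sup>2 * B\<^sup>2 / N"
proof -
  have "(\<integral>y. (w / N * (\<Sum>i\<in>{1..N}. f (y i)) - b)\<^sup>2 \<partial>resample_law X (r k) N x)
       \<le> (w / N * (\<Sum>i\<in>{1..N}. \<integral>z. f z \<partial>draw k x) - b)\<^sup>2 + (w / N)\<^sup>2 * (real (card {1..N}) * B\<^sup>2)"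
    unfolding resample_law_def draw_def[symmetric]
    using kernel_prob_space[OF draw_kernel[OF k] x]
    by (intro PiM_integral_affine_sum_square_le[where X=X] f) auto
  then show ?thesis using N by (simp add: avg_def power2_eq_square)
qed

text \<open>
  One level, seen by weighted averages. The resampling probabilities are the weights divided by their
  sum; multiplying by the empirical mean of \<open>g k\<close> cancels this random denominator, so that the mean
  becomes the unnormalised average of \<open>g k * P f\<close>. Resampling and mutation contribute one variance term
  each, hence the factor \<open>2\<close>.
\<close>
lemma next_level_square_le:
  assumes k: "k < n" and x: "x \<in> space CX"
    and f: "f \<in> borel_measurable X" "\<And>z. z \<in> space X \<Longrightarrow> \<bar>f z\<bar> \<le> B"
  shows "(\<integral>x'. (w * avg x (g k) * avg x' f - b)\<^sup>2 \<partial>next_level k x)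
           \<le> (w * avg x (\<lambda>z. g k z * (\<integral>u. f u \<partial>P (Suc k) z)) - b)\<^sup>2
              + (w * avg x (g k))\<^sup>2 * (2 * B\<^sup>2 / N)"
proof -
  define w' where "w' = w * avg x (g k)"
  let ?Pf = "\<lambda>z. \<integral>u. f u \<partial>P (Suc k) z"
  have k': "Suc k \<le> n" using k by simp
  have Pf: "?Pf \<in> borel_measurable X" "\<And>z. z \<in> space X \<Longrightarrow> \<bar>?Pf z\<bar> \<le> B"
    using kernel_integral_measurable[OF kernel[OF k'] f(1)] kernel_integral_abs_le[OF kernel[OF k'] _ f] by auto
  have int: "(\<lambda>x'. (w' * avg x' h - b)\<^sup>2) \<in> borel_measurable CX" if "h \<in> borel_measurable X" for h
    using that by measurable
  have rx: "resample_law X (r k) N x \<in> space (prob_algebra CX)"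
    by (rule measurable_space[OF resample_kernel[OF k] x])
  interpret rp: prob_space "resample_law X (r k) N x"
    by (rule kernel_prob_space(1)[OF resample_kernel[OF k] x])
  have i1: "integrable (resample_law X (r k) N x) (\<lambda>y. (w' * avg y ?Pf - b)\<^sup>2)"
    by (rule kernel_integrable[OF resample_kernel[OF k] int[OF Pf(1)] avg_square_bound[OF Pf(2)] x])
  have i2: "integrable (resample_law X (r k) N x) (\<lambda>y. \<integral>x'. (w' * avg x' f - b)\<^sup>2 \<partial>mutate (Suc k) y)"
    by (rule kernel_integrable[OF resample_kernel[OF k] kernel_integral_measurable[OF mutate_kernel[OF k'] int[OF f(1)]]
          kernel_integral_abs_le[OF mutate_kernel[OF k'] _ int[OF f(1)] avg_square_bound[OF f(2)]] x])
  have "(\<integral>x'. (w' * avg x' f - b)\<^sup>2 \<partial>next_level k x)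
      = (\<integral>y. (\<integral>x'. (w' * avg x' f - b)\<^sup>2 \<partial>mutate (Suc k) y) \<partial>resample_law X (r k) N x)"
    unfolding next_level_def
    by (rule kernel_integral_bind[OF rx mutate_kernel[OF k'] int[OF f(1)] avg_square_bound[OF f(2)]])
  also have "\<dots> \<le> (\<integral>y. (w' * avg y ?Pf - b)\<^sup>2 + w'\<^sup>2 * B\<^sup>2 / N \<partial>resample_law X (r k) N x)"
  proof (intro integral_mono i2 Bochner_Integration.integrable_add i1 rp.integrable_const)
    fix y assume "y \<in> space (resample_law X (r k) N x)"
    then have "y \<in> space CX" using kernel_prob_space(3)[OF resample_kernel[OF k] x] by simp
    then show "(\<integral>x'. (w' * avg x' f - b)\<^sup>2 \<partial>mutate (Suc k) y) \<le> (w' * avg y ?Pf - b)\<^sup>2 + w'\<^sup>2 * B\<^sup>2 / N"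
      by (intro mutate_square_le[OF k' component f])
  qed
  also have "\<dots> = (\<integral>y. (w' * avg y ?Pf - b)\<^sup>2 \<partial>resample_law X (r k) N x) + w'\<^sup>2 * B\<^sup>2 / N"
    using i1 rp.prob_space by simp
  also have "\<dots> \<le> (w' * (\<integral>z. ?Pf z \<partial>draw k x) - b)\<^sup>2 + w'\<^sup>2 * B\<^sup>2 / N + w'\<^sup>2 * B\<^sup>2 / N"
    by (intro add_right_mono resample_square_le[OF k x Pf])
  also have "w' * (\<integral>z. ?Pf z \<partial>draw k x) = w * avg x (\<lambda>z. g k z * ?Pf z)"
  proof -
    let ?S = "\<Sum>m\<in>{1..N}. r k (x m)"
    have S: "?S > 0" by (rule r_sum_pos[OF k x])
    have "avg x (g k) = s k / N * ?S"
      by (simp add: avg_def g_eq[OF k] sum_distrib_left)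
    moreover have "(\<integral>z. ?Pf z \<partial>draw k x) = (\<Sum>j\<in>{1..N}. r k (x j) * ?Pf (x j)) / ?S"
      using draw_integral[OF k x Pf(1)] by (simp add: sum_divide_distrib)
    moreover have "avg x (\<lambda>z. g k z * ?Pf z) = s k / N * (\<Sum>j\<in>{1..N}. r k (x j) * ?Pf (x j))"
      by (simp add: avg_def g_eq[OF k] sum_distrib_left mult.assoc)
    ultimately show ?thesis using S by (simp add: w'_def)
  qed
  finally show ?thesis by (simp add: w'_def algebra_simps)
qed

text \<open>
  The backward Feynman-Kac semigroup: \<open>FK d k f x\<close> is the expectation of
  \<open>g k (Y\<^sub>k) \<cdots> g (k + d - 1) (Y\<^sub>k\<^sub>+\<^sub>d\<^sub>-\<^sub>1) f (Y\<^sub>k\<^sub>+\<^sub>d)\<close> for the chain \<open>Y\<close> that starts in \<open>x\<close> at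
  level \<open>k\<close> and moves by the mutation kernels.
\<close>
primrec FK :: "nat \<Rightarrow> nat \<Rightarrow> ('a \<Rightarrow> real) \<Rightarrow> 'a \<Rightarrow> real" where
  "FK 0 k f = f"
| "FK (Suc d) k f = (\<lambda>x. g k x * (\<integral>z. FK d (Suc k) f z \<partial>P (Suc k) x))"

lemma g_measurable: "k < n \<Longrightarrow> g k \<in> borel_measurable X"
  using r_measurable by (simp add: g_eq)

lemma g_nonneg: "k < n \<Longrightarrow> x \<in> space X \<Longrightarrow> 0 \<le> g k x"
  using r_pos s_pos by (simp add: g_eq less_imp_le)

lemma FK_measurable:
  "k + d \<le> n \<Longrightarrow> f \<in> borel_measurable X \<Longrightarrow> FK d k f \<in> borel_measurable X"
  by (induction d arbitrary: k)
    (auto intro!: borel_measurable_times g_measurable kernel_integral_measurable[OF kernel])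

text \<open>
  This crude bound grows with the number of levels. It serves for integrability; \<open>FK_abs_le'\<close> is the
  uniform one.
\<close>
lemma FK_bounded:
  assumes "f \<in> borel_measurable X" "\<And>x. x \<in> space X \<Longrightarrow> \<bar>f x\<bar> \<le> B"
  shows "k + d \<le> n \<Longrightarrow> x \<in> space X \<Longrightarrow> \<bar>FK d k f x\<bar> \<le> R ^ d * B"
proof (induction d arbitrary: k x)
  case 0
  then show ?case using assms by simp
next
  case (Suc d)
  have "\<bar>\<integral>z. FK d (Suc k) f z \<partial>P (Suc k) x\<bar> \<le> R ^ d * B"
    using Suc assms(1) by (intro kernel_integral_abs_le[OF kernel] FK_measurable Suc.IH) auto
  moreover have "\<bar>g k x\<bar> \<le> R" using g_nonneg[of k x] g_le[of k x] Suc.prems by simp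
  ultimately show ?case using R by (auto simp: abs_mult mult.assoc intro!: mult_mono)
qed

text \<open>
  Reweighting carries means under \<open>\<mu> k\<close> to means under \<open>\<mu> (Suc k)\<close>, and mutation preserves the latter.
\<close>
lemma FK_integral:
  assumes "f \<in> borel_measurable X" "\<And>x. x \<in> space X \<Longrightarrow> \<bar>f x\<bar> \<le> B"
  shows "k + d \<le> n \<Longrightarrow> (\<integral>x. FK d k f x \<partial>\<mu> k) = (\<integral>x. f x \<partial>\<mu> (k + d))"
proof (induction d arbitrary: k)
  case 0
  then show ?case by simp
next
  case (Suc d)
  note F = FK_measurable[OF _ assms(1), of "Suc k" d] FK_bounded[OF assms, of "Suc k" d]
  have "(\<integral>x. FK (Suc d) k f x \<partial>\<mu> k) = (\<integral>x. (\<integral>z. FK d (Suc k) f z \<partial>P (Suc k) x) \<partial>\<mu> (Suc k))"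
    unfolding FK.simps
  proof (rule reweight)
    show "(\<lambda>x. \<integral>z. FK d (Suc k) f z \<partial>P (Suc k) x) \<in> borel_measurable X"
      using Suc.prems F by (intro kernel_integral_measurable[OF kernel]) auto
    show "\<bar>\<integral>z. FK d (Suc k) f z \<partial>P (Suc k) x\<bar> \<le> R ^ d * B" if "x \<in> space X" for x
      using Suc.prems F that by (intro kernel_integral_abs_le[OF kernel]) auto
  qed (use Suc.prems in auto)
  also have "\<dots> = (\<integral>z. FK d (Suc k) f z \<partial>\<mu> (Suc k))"
    using Suc.prems F by (intro invariant) auto
  also have "\<dots> = (\<integral>x. f x \<partial>\<mu> (k + Suc d))" using Suc by simp
  finally show ?case .
qed

abbreviation "one \<equiv> (\<lambda>_::'a. 1::real)"

abbreviation "K \<equiv> R * c"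

lemma K_ge_1: "1 \<le> K"
  using R c mult_mono[of 1 R 1 c] by simp

lemma FK_one_nonneg: "k + d \<le> n \<Longrightarrow> x \<in> space X \<Longrightarrow> 0 \<le> FK d k one x"
proof (induction d arbitrary: k x)
  case (Suc d)
  then show ?case
    using kernel_prob_space(3)[OF kernel, of "Suc k" x]
    by (auto intro!: mult_nonneg_nonneg g_nonneg integral_nonneg_AE AE_I2)
qed simp

text \<open>
  The stability estimate. The propagated function of the next level has mean \<open>1\<close> under its target; averaging it
  with the mutation kernel turns this mean into the pointwise bound \<open>c\<close>, and reweighting costs the
  factor \<open>R\<close>. No constant accumulates with \<open>d\<close>.
\<close>
lemma FK_one_le:
  assumes "k + d \<le> n" "x \<in> space X"
  shows "FK d k one x \<le> K"
proof (cases d)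
  case 0
  then show ?thesis using K_ge_1 by simp
next
  case (Suc e)
  have e: "Suc k + e \<le> n" using assms(1) Suc by simp
  have B: "\<And>x. x \<in> space X \<Longrightarrow> \<bar>one x\<bar> \<le> 1" by simp
  have "(\<integral>z. FK e (Suc k) one z \<partial>P (Suc k) x) \<le> c * (\<integral>z. FK e (Suc k) one z \<partial>\<mu> (Suc k))"
    using e assms(2)
    by (intro dominated[where B="R ^ e * 1"] FK_measurable FK_one_nonneg FK_bounded[where f=one and B=1]) auto
  also have "(\<integral>z. FK e (Suc k) one z \<partial>\<mu> (Suc k)) = 1"
    using FK_integral[OF _ B e] target[OF e] by (simp add: space_prob_algebra prob_space.prob_space)
  finally have "(\<integral>z. FK e (Suc k) one z \<partial>P (Suc k) x) \<le> c" by simp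
  moreover have "0 \<le> (\<integral>z. FK e (Suc k) one z \<partial>P (Suc k) x)"
    using kernel_prob_space(3)[OF kernel, of "Suc k" x] assms(2) FK_one_nonneg[OF e] e
    by (intro integral_nonneg_AE AE_I2) auto
  ultimately show ?thesis
    using assms Suc g_nonneg[of k x] g_le[of k x] R by (auto intro!: mult_mono)
qed

lemma FK_abs_le:
  assumes f: "f \<in> borel_measurable X" "\<And>x. x \<in> space X \<Longrightarrow> \<bar>f x\<bar> \<le> B"
  shows "k + d \<le> n \<Longrightarrow> x \<in> space X \<Longrightarrow> \<bar>FK d k f x\<bar> \<le> B * FK d k one x"
proof (induction d arbitrary: k x)
  case 0
  then show ?case using f by simp
next
  case (Suc d)
  have k: "Suc k + d \<le> n" "Suc k \<le> n" using Suc.prems by auto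
  have B: "\<And>x. x \<in> space X \<Longrightarrow> \<bar>one x\<bar> \<le> 1" by simp
  have i: "integrable (P (Suc k) x) (FK d (Suc k) h)" if "h \<in> borel_measurable X"
    "\<And>x. x \<in> space X \<Longrightarrow> \<bar>h x\<bar> \<le> B" for h B
    by (rule kernel_integrable[OF kernel[OF k(2)] FK_measurable[OF k(1) that(1)] FK_bounded[OF that k(1)] Suc.prems(2)])
  have "\<bar>\<integral>z. FK d (Suc k) f z \<partial>P (Suc k) x\<bar> \<le> (\<integral>z. \<bar>FK d (Suc k) f z\<bar> \<partial>P (Suc k) x)"
    by (rule integral_abs_bound)
  also have "\<dots> \<le> (\<integral>z. B * FK d (Suc k) one z \<partial>P (Suc k) x)"
    using kernel_prob_space(3)[OF kernel[OF k(2)] Suc.prems(2)]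
    by (intro integral_mono integrable_abs integrable_mult_right i[OF f] i[OF _ B] Suc.IH k(1)) auto
  also have "\<dots> = B * (\<integral>z. FK d (Suc k) one z \<partial>P (Suc k) x)" by simp
  finally have "\<bar>g k x\<bar> * \<bar>\<integral>z. FK d (Suc k) f z \<partial>P (Suc k) x\<bar>
      \<le> \<bar>g k x\<bar> * (B * (\<integral>z. FK d (Suc k) one z \<partial>P (Suc k) x))"
    by (rule mult_left_mono) simp
  then show ?case
    using Suc.prems g_nonneg[of k x] by (simp add: abs_mult mult.left_commute)
qed

lemma FK_abs_le':
  assumes f: "f \<in> borel_measurable X" "\<And>x. x \<in> space X \<Longrightarrow> \<bar>f x\<bar> \<le> B"
    and "k + d \<le> n" "x \<in> space X"
  shows "\<bar>FK d k f x\<bar> \<le> B * K"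
proof -
  have "0 \<le> B" using f(2)[OF assms(4)] by linarith
  then show ?thesis
    using FK_abs_le[OF assms] mult_left_mono[OF FK_one_le[OF assms(3,4)], of B] by linarith
qed

text \<open>
  A bound, valid for every real \<open>w\<close>, on the expected final squared error of the particle system that
  is in configuration \<open>x\<close> at level \<open>k\<close>, with \<open>d\<close> levels ahead; the number \<open>w\<close> plays the role of the
  fictitious weight. The first two terms are the squared biases of the weighted mean of \<open>f\<close> and of the
  weight itself. The sum collects the noise that the levels ahead will produce: the noise of a level is
  proportional to the square of the weight reached there, and \<open>w * avg x (FK e k one)\<close> is the mean of
  that weight after \<open>e\<close> levels. The leading \<open>2\<close> in its coefficient leaves room for the variance of the
  weights, which is again of this form. The subtracted zeros give all terms the shape handled by
  \<open>next_level_square_le\<close>.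
\<close>
definition ghost_bound :: "real \<Rightarrow> ('a \<Rightarrow> real) \<Rightarrow> nat \<Rightarrow> nat \<Rightarrow> real \<Rightarrow> (nat \<Rightarrow> 'a) \<Rightarrow> real" where
  "ghost_bound B f d k w x = 2 * (w * avg x (FK d k f) - 0)\<^sup>2 + 2 * B\<^sup>2 * (w * avg x (FK d k one) - 1)\<^sup>2
     + 2 * (8 * B\<^sup>2 * K\<^sup>2 / N) * (\<Sum>e\<in>{1..d}. (w * avg x (FK e k one) - 0)\<^sup>2)"

lemma square_kernel_integrable:
  assumes "\<kappa> \<in> M \<rightarrow>\<^sub>M prob_algebra CX" "x \<in> space M"
    and "f \<in> borel_measurable X" "\<And>z. z \<in> space X \<Longrightarrow> \<bar>f z\<bar> \<le> B"
  shows "integrable (\<kappa> x) (\<lambda>x'. (w * avg x' f - b)\<^sup>2)"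
proof (rule kernel_integrable[OF assms(1) _ _ assms(2)])
  show "(\<lambda>x'. (w * avg x' f - b)\<^sup>2) \<in> borel_measurable CX"
    using assms(3) by measurable
qed (rule avg_square_bound[OF assms(4)])

lemma ghost_bound_integrable:
  assumes \<kappa>: "\<kappa> \<in> M \<rightarrow>\<^sub>M prob_algebra CX" "x \<in> space M"
    and f: "f \<in> borel_measurable X" "\<And>z. z \<in> space X \<Longrightarrow> \<bar>f z\<bar> \<le> B" and k: "k + d \<le> n"
  shows "integrable (\<kappa> x) (ghost_bound B f d k w)"
    and "(\<integral>x'. ghost_bound B f d k w x' \<partial>\<kappa> x) =
        2 * (\<integral>x'. (w * avg x' (FK d k f) - 0)\<^sup>2 \<partial>\<kappa> x)
      + 2 * B\<^sup>2 * (\<integral>x'. (w * avg x' (FK d k one) - 1)\<^sup>2 \<partial>\<kappa> x)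
      + 2 * (8 * B\<^sup>2 * K\<^sup>2 / N) * (\<Sum>e\<in>{1..d}. \<integral>x'. (w * avg x' (FK e k one) - 0)\<^sup>2 \<partial>\<kappa> x)"
proof -
  have F: "integrable (\<kappa> x) (\<lambda>x'. (w * avg x' (FK d k f) - 0)\<^sup>2)"
    by (rule square_kernel_integrable[OF \<kappa> FK_measurable[OF k f(1)] FK_bounded[OF f k]])
  have O: "integrable (\<kappa> x) (\<lambda>x'. (w * avg x' (FK e k one) - b)\<^sup>2)" if "e \<le> d" for e b
    using k that
    by (intro square_kernel_integrable[OF \<kappa> FK_measurable FK_bounded[where f=one and B=1 and d=e and k=k]]) auto
  have S: "integrable (\<kappa> x) (\<lambda>x'. \<Sum>e\<in>{1..d}. (w * avg x' (FK e k one) - 0)\<^sup>2)"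
    using O[of _ 0] by (intro Bochner_Integration.integrable_sum) auto
  have sum_eq: "(\<integral>x'. (\<Sum>e\<in>{1..d}. (w * avg x' (FK e k one) - 0)\<^sup>2) \<partial>\<kappa> x)
      = (\<Sum>e\<in>{1..d}. \<integral>x'. (w * avg x' (FK e k one) - 0)\<^sup>2 \<partial>\<kappa> x)"
    using O[of _ 0] by (intro Bochner_Integration.integral_sum) auto
  have FO: "integrable (\<kappa> x) (\<lambda>x'. 2 * (w * avg x' (FK d k f) - 0)\<^sup>2 + 2 * B\<^sup>2 * (w * avg x' (FK d k one) - 1)\<^sup>2)"
    by (intro Bochner_Integration.integrable_add integrable_mult_right F O) simp
  show "integrable (\<kappa> x) (ghost_bound B f d k w)"
    unfolding ghost_bound_def[abs_def] by (intro Bochner_Integration.integrable_add integrable_mult_right FO S)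
  show "(\<integral>x'. ghost_bound B f d k w x' \<partial>\<kappa> x) =
        2 * (\<integral>x'. (w * avg x' (FK d k f) - 0)\<^sup>2 \<partial>\<kappa> x)
      + 2 * B\<^sup>2 * (\<integral>x'. (w * avg x' (FK d k one) - 1)\<^sup>2 \<partial>\<kappa> x)
      + 2 * (8 * B\<^sup>2 * K\<^sup>2 / N) * (\<Sum>e\<in>{1..d}. \<integral>x'. (w * avg x' (FK e k one) - 0)\<^sup>2 \<partial>\<kappa> x)"
    unfolding ghost_bound_def Bochner_Integration.integral_add[OF FO integrable_mult_right[OF S]]
      Bochner_Integration.integral_add[OF integrable_mult_right[OF F] integrable_mult_right[OF O[OF order_refl]]]
      integral_mult_right_zero sum_eq ..
qed

text \<open>
  Passing a level turns \<open>w\<close> into \<open>w * avg x (g k)\<close> and creates noise proportional to the square of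
  that number. This square is the summand \<open>e = 1\<close> of the bound at level \<open>k\<close>, so that the new noise is
  paid for by this summand, provided that \<open>N\<close> is large compared with the number of levels.
\<close>
lemma ghost_bound_step:
  assumes k: "Suc k + d \<le> n" and x: "x \<in> space CX" and small: "4 * K\<^sup>2 * real n \<le> real N"
    and f: "f \<in> borel_measurable X" "\<And>z. z \<in> space X \<Longrightarrow> \<bar>f z\<bar> \<le> B"
  shows "(\<integral>x'. ghost_bound B f d (Suc k) (w * avg x (g k)) x' \<partial>next_level k x) \<le> ghost_bound B f (Suc d) k w x"
proof -
  let ?w = "w * avg x (g k)"
  have k': "k < n" "Suc k \<le> n" using k by auto
  have B1: "\<And>x. x \<in> space X \<Longrightarrow> \<bar>one x\<bar> \<le> 1" by simp
  have F: "(\<integral>x'. (?w * avg x' (FK d (Suc k) f) - 0)\<^sup>2 \<partial>next_level k x)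
      \<le> (w * avg x (FK (Suc d) k f) - 0)\<^sup>2 + ?w\<^sup>2 * (2 * (B * K)\<^sup>2 / N)"
    unfolding FK.simps
    by (rule next_level_square_le[OF k'(1) x FK_measurable[OF k f(1)] FK_abs_le'[OF f k]])
  have O: "(\<integral>x'. (?w * avg x' (FK e (Suc k) one) - b)\<^sup>2 \<partial>next_level k x)
      \<le> (w * avg x (FK (Suc e) k one) - b)\<^sup>2 + ?w\<^sup>2 * (2 * K\<^sup>2 / N)" if "e \<le> d" for e b
  proof -
    have e: "Suc k + e \<le> n" using that k by simp
    have "\<bar>FK e (Suc k) one z\<bar> \<le> K" if "z \<in> space X" for z
      using FK_abs_le'[of one 1, OF _ B1 e that] by simp
    then show ?thesis
      unfolding FK.simps
      by (intro next_level_square_le[OF k'(1) x] FK_measurable[OF e]) auto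
  qed
  define \<alpha> where "\<alpha> = 2 * (8 * B\<^sup>2 * K\<^sup>2 / N)"
  have \<alpha>: "0 \<le> \<alpha>" by (simp add: \<alpha>_def)
  let ?S = "\<lambda>e. (w * avg x (FK e k one) - 0)\<^sup>2"
  have first: "?S 1 = ?w\<^sup>2"
  proof -
    have "avg x (FK 1 k one) = avg x (g k)"
      using kernel_prob_space(1)[OF kernel[OF k'(2)]] x
      by (intro avg_cong) (auto simp: prob_space.prob_space)
    then show ?thesis by simp
  qed
  have split: "(\<Sum>e\<in>{1..Suc d}. ?S e) = ?w\<^sup>2 + (\<Sum>e\<in>{1..d}. ?S (Suc e))"
  proof -
    have "(\<Sum>e\<in>{1..Suc d}. ?S e) = ?S 1 + (\<Sum>e\<in>{Suc 1..Suc d}. ?S e)"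
      by (rule sum.atLeast_Suc_atMost) simp
    then show ?thesis unfolding first by (simp only: sum.shift_bounds_cl_Suc_ivl)
  qed
  have absorb: "2 * (?w\<^sup>2 * (2 * (B * K)\<^sup>2 / N)) + 2 * B\<^sup>2 * (?w\<^sup>2 * (2 * K\<^sup>2 / N))
      + \<alpha> * (real d * (?w\<^sup>2 * (2 * K\<^sup>2 / N))) \<le> \<alpha> * ?w\<^sup>2"
  proof -
    have "real d * (4 * K\<^sup>2) \<le> real n * (4 * K\<^sup>2)"
      using k by (intro mult_right_mono) auto
    also have "\<dots> \<le> N" using small by (simp add: mult_ac)
    finally have "real d * (2 * K\<^sup>2 / N) \<le> 1 / 2"
      using N by (simp add: field_simps)
    then have half: "(\<alpha> * ?w\<^sup>2) * (real d * (2 * K\<^sup>2 / N)) \<le> (\<alpha> * ?w\<^sup>2) * (1 / 2)"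
      using \<alpha> by (intro mult_left_mono) auto
    have noise: "2 * (?w\<^sup>2 * (2 * (B * K)\<^sup>2 / N)) + 2 * B\<^sup>2 * (?w\<^sup>2 * (2 * K\<^sup>2 / N)) = \<alpha> * ?w\<^sup>2 / 2"
      by (simp add: \<alpha>_def power_mult_distrib)
    have "\<alpha> * (real d * (?w\<^sup>2 * (2 * K\<^sup>2 / N))) = (\<alpha> * ?w\<^sup>2) * (real d * (2 * K\<^sup>2 / N))"
      by (simp only: mult_ac)
    also have "\<dots> \<le> \<alpha> * ?w\<^sup>2 / 2"
      using half by (simp only: times_divide_eq_right mult_1_right)
    finally have "\<alpha> * (real d * (?w\<^sup>2 * (2 * K\<^sup>2 / N))) \<le> \<alpha> * ?w\<^sup>2 / 2" .
    from add_mono[OF eq_refl[OF noise] this] show ?thesis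
      by (simp only: field_sum_of_halves)
  qed
  have "(\<integral>x'. ghost_bound B f d (Suc k) ?w x' \<partial>next_level k x) =
        2 * (\<integral>x'. (?w * avg x' (FK d (Suc k) f) - 0)\<^sup>2 \<partial>next_level k x)
      + 2 * B\<^sup>2 * (\<integral>x'. (?w * avg x' (FK d (Suc k) one) - 1)\<^sup>2 \<partial>next_level k x)
      + \<alpha> * (\<Sum>e\<in>{1..d}. \<integral>x'. (?w * avg x' (FK e (Suc k) one) - 0)\<^sup>2 \<partial>next_level k x)"
    unfolding \<alpha>_def by (rule ghost_bound_integrable(2)[OF next_level_kernel[OF k'(1)] x f k])
  also have "\<dots> \<le> 2 * ((w * avg x (FK (Suc d) k f) - 0)\<^sup>2 + ?w\<^sup>2 * (2 * (B * K)\<^sup>2 / N))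
      + 2 * B\<^sup>2 * ((w * avg x (FK (Suc d) k one) - 1)\<^sup>2 + ?w\<^sup>2 * (2 * K\<^sup>2 / N))
      + \<alpha> * (\<Sum>e\<in>{1..d}. ?S (Suc e) + ?w\<^sup>2 * (2 * K\<^sup>2 / N))"
  proof (intro add_mono mult_left_mono F sum_mono \<alpha>)
    show "(\<integral>x'. (?w * avg x' (FK d (Suc k) one) - 1)\<^sup>2 \<partial>next_level k x)
        \<le> (w * avg x (FK (Suc d) k one) - 1)\<^sup>2 + ?w\<^sup>2 * (2 * K\<^sup>2 / N)"
      by (rule O) simp
    show "(\<integral>x'. (?w * avg x' (FK e (Suc k) one) - 0)\<^sup>2 \<partial>next_level k x) \<le> ?S (Suc e) + ?w\<^sup>2 * (2 * K\<^sup>2 / N)"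
      if "e \<in> {1..d}" for e
      using that by (intro O) simp
  qed simp_all
  also have "\<dots> = 2 * (w * avg x (FK (Suc d) k f) - 0)\<^sup>2 + 2 * B\<^sup>2 * (w * avg x (FK (Suc d) k one) - 1)\<^sup>2
      + \<alpha> * (\<Sum>e\<in>{1..d}. ?S (Suc e))
      + (2 * (?w\<^sup>2 * (2 * (B * K)\<^sup>2 / N)) + 2 * B\<^sup>2 * (?w\<^sup>2 * (2 * K\<^sup>2 / N))
      + \<alpha> * (real d * (?w\<^sup>2 * (2 * K\<^sup>2 / N))))"
    unfolding sum.distrib sum_constant distrib_left by simp
  also have "\<dots> \<le> ghost_bound B f (Suc d) k w x"
    unfolding ghost_bound_def split \<alpha>_def[symmetric] using absorb by (simp only: distrib_left)
  finally show ?thesis .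
qed

text \<open>
  Backward induction over the levels. The function \<open>E\<close> is the conditional expectation of the final
  squared error given the configuration at level \<open>n - d\<close>. The weight never has to be part of the state,
  because the bound holds for all \<open>w\<close> at once.
\<close>
lemma value_le_ghost_bound:
  assumes y: "\<And>i. i \<in> {1..N} \<Longrightarrow> y i \<in> space X" and small: "4 * K\<^sup>2 * real n \<le> real N"
    and f: "f \<in> borel_measurable X" "\<And>z. z \<in> space X \<Longrightarrow> \<bar>f z\<bar> \<le> B"
  shows "d \<le> n \<Longrightarrow> \<exists>E. E \<in> borel_measurable CX \<and> (\<forall>x\<in>space CX. \<bar>E x\<bar> \<le> B\<^sup>2)
     \<and> (\<integral>x. E x \<partial>law y (n - d)) = (\<integral>x. (avg x f)\<^sup>2 \<partial>law y n)
     \<and> (\<forall>x\<in>space CX. \<forall>w. E x \<le> ghost_bound B f d (n - d) w x)"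
proof (induction d)
  case 0
  \<comment> \<open>At the last level the bound is the triangle inequality for \<open>avg x f = w * avg x f - (w - 1) * avg x f\<close>.\<close>
  have "(avg x f)\<^sup>2 \<le> B\<^sup>2" if "x \<in> space CX" for x
    using power_mono[OF avg_abs_le[OF f(2) component[OF that]] abs_ge_zero, where n=2] by simp
  moreover have "(avg x f)\<^sup>2 \<le> ghost_bound B f 0 (n - 0) w x" if x: "x \<in> space CX" for w x
  proof -
    have "\<bar>avg x f\<bar> \<le> \<bar>w * avg x f\<bar> + \<bar>(w - 1) * avg x f\<bar>"
      using abs_triangle_ineq4[of "w * avg x f" "(w - 1) * avg x f"] by (simp add: algebra_simps)
    also have "\<dots> \<le> \<bar>w * avg x f\<bar> + B * \<bar>w - 1\<bar>"
      using mult_right_mono[OF avg_abs_le[OF f(2) component[OF x]], where c="\<bar>w - 1\<bar>"]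
      by (simp add: abs_mult mult.commute)
    finally have "\<bar>avg x f\<bar>\<^sup>2 \<le> (\<bar>w * avg x f\<bar> + B * \<bar>w - 1\<bar>)\<^sup>2"
      by (rule power_mono) simp
    also have "\<dots> \<le> 2 * \<bar>w * avg x f\<bar>\<^sup>2 + 2 * (B * \<bar>w - 1\<bar>)\<^sup>2"
      using sum_squares_bound[of "\<bar>w * avg x f\<bar>" "B * \<bar>w - 1\<bar>"] unfolding power2_sum by linarith
    finally show ?thesis by (simp add: ghost_bound_def avg_const power_mult_distrib)
  qed
  moreover have "(\<lambda>x. (avg x f)\<^sup>2) \<in> borel_measurable CX"
    using f(1) by measurable
  ultimately show ?case
    by (intro exI[of _ "\<lambda>x. (avg x f)\<^sup>2"]) auto
next
  case (Suc d)
  define k where "k = n - Suc d"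
  have k: "Suc k + d \<le> n" "k < n" "n - d = Suc k" "k \<le> n" using Suc.prems by (auto simp: k_def)
  obtain E where E: "E \<in> borel_measurable CX" "\<And>x. x \<in> space CX \<Longrightarrow> \<bar>E x\<bar> \<le> B\<^sup>2"
    "(\<integral>x. E x \<partial>law y (Suc k)) = (\<integral>x. (avg x f)\<^sup>2 \<partial>law y n)"
    "\<And>x w. x \<in> space CX \<Longrightarrow> E x \<le> ghost_bound B f d (Suc k) w x"
    using Suc k(3) by auto
  let ?E = "\<lambda>x. \<integral>x'. E x' \<partial>next_level k x"
  have "?E \<in> borel_measurable CX" by (rule kernel_integral_measurable[OF next_level_kernel[OF k(2)] E(1)])
  moreover have "\<bar>?E x\<bar> \<le> B\<^sup>2" if "x \<in> space CX" for x
    by (rule kernel_integral_abs_le[OF next_level_kernel[OF k(2)] that E(1,2)])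
  moreover have "(\<integral>x. ?E x \<partial>law y k) = (\<integral>x. (avg x f)\<^sup>2 \<partial>law y n)"
  proof -
    have law_k: "law y k \<in> space (prob_algebra CX)"
      using law_in_prob_algebra[of y k] y k(4) by simp
    have law_Suc_k: "law y (Suc k) = law y k \<bind> next_level k"
      using law_Suc[of y k] y k(2) by simp
    show ?thesis
      unfolding E(3)[symmetric] law_Suc_k
      by (rule kernel_integral_bind[OF law_k next_level_kernel[OF k(2)] E(1,2), symmetric])
  qed
  moreover have "?E x \<le> ghost_bound B f (Suc d) k w x" if x: "x \<in> space CX" for x w
  proof -
    have "?E x \<le> (\<integral>x'. ghost_bound B f d (Suc k) (w * avg x (g k)) x' \<partial>next_level k x)"
      using kernel_prob_space(3)[OF next_level_kernel[OF k(2)] x] E(4)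
      by (intro integral_mono kernel_integrable[OF next_level_kernel[OF k(2)] E(1,2) x]
          ghost_bound_integrable(1)[OF next_level_kernel[OF k(2)] x f k(1)]) auto
    also have "\<dots> \<le> ghost_bound B f (Suc d) k w x" by (rule ghost_bound_step[OF k(1) x small f])
    finally show ?thesis .
  qed
  ultimately show ?case unfolding k_def[symmetric] by (intro exI[of _ ?E]) auto
qed

text \<open>
  The bound of \<open>value_le_ghost_bound\<close> with weight \<open>1\<close>, averaged over the first level. Under \<open>\<mu> 0\<close> the
  propagated functions have exact means \<open>0\<close> and \<open>1\<close>, so that the deviation \<open>\<tau>\<close> of the first run from
  equilibrium is the only source of bias.
\<close>
lemma mean_square_error_le:
  assumes y: "\<And>i. i \<in> {1..N} \<Longrightarrow> y i \<in> space X" and small: "4 * K\<^sup>2 * real n \<le> real N"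
    and mixing: "\<And>\<phi> B x. \<phi> \<in> borel_measurable X \<Longrightarrow> (\<And>z. z \<in> space X \<Longrightarrow> \<bar>\<phi> z\<bar> \<le> B) \<Longrightarrow> x \<in> space X
        \<Longrightarrow> \<bar>(\<integral>z. \<phi> z \<partial>P 0 x) - (\<integral>z. \<phi> z \<partial>\<mu> 0)\<bar> \<le> \<tau> * B"
    and f: "f \<in> borel_measurable X" "\<And>z. z \<in> space X \<Longrightarrow> \<bar>f z\<bar> \<le> B" "(\<integral>z. f z \<partial>\<mu> n) = 0"
  shows "(\<integral>x. (avg x f)\<^sup>2 \<partial>law y n) \<le> B\<^sup>2 * (4 * \<tau>\<^sup>2 * K\<^sup>2 + 4 * K\<^sup>2 / N + 16 * K ^ 4 * n / N)"
proof -
  have B1: "\<And>x. x \<in> space X \<Longrightarrow> \<bar>one x\<bar> \<le> 1" by simp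
  obtain E where E: "E \<in> borel_measurable CX" "\<And>x. x \<in> space CX \<Longrightarrow> \<bar>E x\<bar> \<le> B\<^sup>2"
    "(\<integral>x. E x \<partial>law y 0) = (\<integral>x. (avg x f)\<^sup>2 \<partial>law y n)"
    "\<And>x w. x \<in> space CX \<Longrightarrow> E x \<le> ghost_bound B f n 0 w x"
    using value_le_ghost_bound[where y=y, OF _ small f(1,2) order_refl] y by auto
  let ?\<alpha> = "2 * (8 * B\<^sup>2 * K\<^sup>2 / N)"
  have mean: "\<bar>avg y (\<lambda>z. \<integral>u. \<phi> u \<partial>P 0 z) - (\<integral>z. \<phi> z \<partial>\<mu> 0)\<bar> \<le> \<tau> * C"
    if "\<phi> \<in> borel_measurable X" "\<And>z. z \<in> space X \<Longrightarrow> \<bar>\<phi> z\<bar> \<le> C" for \<phi> C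
  proof -
    have "avg y (\<lambda>z. (\<integral>u. \<phi> u \<partial>P 0 z) - (\<integral>z. \<phi> z \<partial>\<mu> 0)) = avg y (\<lambda>z. \<integral>u. \<phi> u \<partial>P 0 z) - (\<integral>z. \<phi> z \<partial>\<mu> 0)"
      using N by (simp add: avg_def sum_subtractf field_simps)
    moreover have "\<bar>avg y (\<lambda>z. (\<integral>u. \<phi> u \<partial>P 0 z) - (\<integral>z. \<phi> z \<partial>\<mu> 0))\<bar> \<le> \<tau> * C"
      by (rule avg_abs_le[OF mixing[OF that] y])
    ultimately show ?thesis by (simp only:)
  qed
  have sq: "(\<integral>x. (1 * avg x \<phi> - b)\<^sup>2 \<partial>law y 0) \<le> (\<tau> * C)\<^sup>2 + C\<^sup>2 / N"
    if \<phi>: "\<phi> \<in> borel_measurable X" "\<And>z. z \<in> space X \<Longrightarrow> \<bar>\<phi> z\<bar> \<le> C" and b: "(\<integral>z. \<phi> z \<partial>\<mu> 0) = b" for \<phi> C b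
  proof -
    have "(\<integral>x. (1 * avg x \<phi> - b)\<^sup>2 \<partial>law y 0) \<le> (1 * avg y (\<lambda>z. \<integral>u. \<phi> u \<partial>P 0 z) - b)\<^sup>2 + 1\<^sup>2 * C\<^sup>2 / N"
      unfolding law.simps by (rule mutate_square_le[OF le0 y \<phi>])
    moreover have "\<bar>avg y (\<lambda>z. \<integral>u. \<phi> u \<partial>P 0 z) - b\<bar>\<^sup>2 \<le> (\<tau> * C)\<^sup>2"
      by (rule power_mono[OF mean[OF \<phi>, unfolded b] abs_ge_zero])
    ultimately show ?thesis by simp
  qed
  have law0: "(\<lambda>_. law y 0) \<in> count_space {()} \<rightarrow>\<^sub>M prob_algebra CX"
    using law_0_in_prob_algebra[OF y] by simp
  have u: "() \<in> space (count_space {()})" by simp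
  have n: "0 + n \<le> n" by simp
  note FKf = FK_measurable[OF n f(1)] FK_abs_le'[OF f(1,2) n]
  have FK1: "FK e 0 one \<in> borel_measurable X" "z \<in> space X \<Longrightarrow> \<bar>FK e 0 one z\<bar> \<le> K" if "e \<le> n" for e z
    using FK_measurable[of 0 e one] FK_abs_le'[of one 1 0 e z, OF _ B1] that by auto
  have "(\<integral>x. E x \<partial>law y 0) \<le> (\<integral>x. ghost_bound B f n 0 1 x \<partial>law y 0)"
    using kernel_prob_space(3)[OF law0 u] E(4)
    by (intro integral_mono kernel_integrable[OF law0 E(1,2) u] ghost_bound_integrable(1)[OF law0 u f(1,2) n]) auto
  also have "\<dots> = 2 * (\<integral>x'. (1 * avg x' (FK n 0 f) - 0)\<^sup>2 \<partial>law y 0)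
      + 2 * B\<^sup>2 * (\<integral>x'. (1 * avg x' (FK n 0 one) - 1)\<^sup>2 \<partial>law y 0)
      + ?\<alpha> * (\<Sum>e\<in>{1..n}. \<integral>x'. (1 * avg x' (FK e 0 one) - 0)\<^sup>2 \<partial>law y 0)"
    by (rule ghost_bound_integrable(2)[OF law0 u f(1,2) n])
  also have "\<dots> \<le> 2 * ((\<tau> * (B * K))\<^sup>2 + (B * K)\<^sup>2 / N) + 2 * B\<^sup>2 * ((\<tau> * K)\<^sup>2 + K\<^sup>2 / N) + ?\<alpha> * (\<Sum>e\<in>{1..n}. K\<^sup>2)"
  proof (intro add_mono mult_left_mono sum_mono)
    show "(\<integral>x'. (1 * avg x' (FK n 0 f) - 0)\<^sup>2 \<partial>law y 0) \<le> (\<tau> * (B * K))\<^sup>2 + (B * K)\<^sup>2 / N"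
      using FK_integral[OF f(1,2) n] f(3) by (intro sq FKf) auto
    show "(\<integral>x'. (1 * avg x' (FK n 0 one) - 1)\<^sup>2 \<partial>law y 0) \<le> (\<tau> * K)\<^sup>2 + K\<^sup>2 / N"
      using FK_integral[OF _ B1 n] target[of n]
      by (intro sq FK1) (auto simp: space_prob_algebra prob_space.prob_space)
    fix e assume "e \<in> {1..n}"
    then have e: "e \<le> n" by simp
    have "\<bar>\<integral>x'. (1 * avg x' (FK e 0 one) - 0)\<^sup>2 \<partial>law y 0\<bar> \<le> (\<bar>1\<bar> * K + \<bar>0\<bar>)\<^sup>2"
    proof (rule kernel_integral_abs_le[OF law0 u])
      show "(\<lambda>x'. (1 * avg x' (FK e 0 one) - 0)\<^sup>2) \<in> borel_measurable CX"
        using FK1(1)[OF e] by measurable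
    qed (rule avg_square_bound[OF FK1(2)[OF e]])
    then show "(\<integral>x'. (1 * avg x' (FK e 0 one) - 0)\<^sup>2 \<partial>law y 0) \<le> K\<^sup>2" by simp
  qed auto
  also have "\<dots> = B\<^sup>2 * (4 * \<tau>\<^sup>2 * K\<^sup>2 + 4 * K\<^sup>2 / N + 16 * K ^ 4 * n / N)"
    using N by (simp add: power_mult_distrib field_simps power4_eq_xxxx power2_eq_square)
  finally show ?thesis using E(3) by simp
qed

end

section \<open>Laplace transforms and ratios of partition functions\<close>

lemma exp_neg_mult_le:
  fixes s v :: real
  assumes "0 < s" "0 \<le> v"
  shows "v * exp (- s * v) \<le> 1 / s"
proof -
  have "s * v \<le> exp (s * v)" using exp_ge_add_one_self[of "s * v"] by linarith
  then have "s * (v * exp (- s * v)) \<le> 1" by (simp add: exp_minus field_simps)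
  then show ?thesis using assms by (simp add: field_simps)
qed

lemma laplace_integrable_mono:
  fixes V :: "'a \<Rightarrow> real"
  assumes "V \<in> borel_measurable X" "\<And>x. x \<in> space X \<Longrightarrow> 0 \<le> V x"
    and "integrable X (\<lambda>x. exp (- \<beta> * V x))" "\<beta> \<le> \<beta>'"
  shows "integrable X (\<lambda>x. exp (- \<beta>' * V x))"
  using assms by (intro Bochner_Integration.integrable_bound[OF assms(3)]) (auto intro!: AE_I2 mult_right_mono)

text \<open>
  The integrand is positive everywhere, so its integral vanishes only if the whole space is a null set;
  then it vanishes for every \<open>\<beta>\<close>.
\<close>
lemma laplace_pos:
  fixes V :: "'a \<Rightarrow> real"
  assumes "integrable X (\<lambda>x. exp (- \<beta>' * V x))" "0 < (\<integral>x. exp (- \<beta> * V x) \<partial>X)"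
  shows "0 < (\<integral>x. exp (- \<beta>' * V x) \<partial>X)"
proof -
  have "(\<integral>x. exp (- \<beta>' * V x) \<partial>X) \<noteq> 0"
  proof
    assume "(\<integral>x. exp (- \<beta>' * V x) \<partial>X) = 0"
    then have "AE x in X. exp (- \<beta>' * V x) = 0"
      using integral_nonneg_eq_0_iff_AE[OF assms(1)] by simp
    then have "AE x in X. exp (- \<beta> * V x) = 0" by (rule AE_mp) simp
    then have "(\<integral>x. exp (- \<beta> * V x) \<partial>X) = 0" by (rule integral_eq_zero_AE)
    with assms(2) show False by simp
  qed
  moreover have "0 \<le> (\<integral>x. exp (- \<beta>' * V x) \<partial>X)" by (intro integral_nonneg_AE AE_I2) simp
  ultimately show ?thesis by linarith
qed

text \<open>
  Log-convexity in the form of Chebyshev's association inequality: \<open>exp (- s V)\<close> and \<open>exp (- \<Delta> V)\<close> are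
  both decreasing in \<open>V\<close>, hence positively correlated under the probability density proportional to
  \<open>exp (- \<beta> V)\<close>.
\<close>
lemma laplace_log_convex:
  fixes V :: "'a \<Rightarrow> real"
  assumes V: "V \<in> borel_measurable X" "\<And>x. x \<in> space X \<Longrightarrow> 0 \<le> V x"
    and int: "integrable X (\<lambda>x. exp (- \<beta> * V x))" and pos: "0 < (\<integral>x. exp (- \<beta> * V x) \<partial>X)"
    and s: "0 \<le> s" and \<Delta>: "0 \<le> \<Delta>"
  shows "(\<integral>x. exp (- (\<beta> + s) * V x) \<partial>X) * (\<integral>x. exp (- (\<beta> + \<Delta>) * V x) \<partial>X)
      \<le> (\<integral>x. exp (- \<beta> * V x) \<partial>X) * (\<integral>x. exp (- (\<beta> + s + \<Delta>) * V x) \<partial>X)"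
proof (cases "s = 0")
  case False
  then have s: "0 < s" using s by simp
  let ?Z = "\<lambda>t. \<integral>x. exp (- (\<beta> + t) * V x) \<partial>X"
  have i: "integrable X (\<lambda>x. exp (- (\<beta> + t) * V x))" if "0 \<le> t" for t
    using laplace_integrable_mono[OF V int, of "\<beta> + t"] that by simp
  have Z0: "0 < ?Z 0" using pos by simp
  have Zs: "0 < ?Z s" using laplace_pos[OF i pos] s by simp
  define m where "m = ?Z s / ?Z 0"
  have m: "0 < m" using Z0 Zs by (simp add: m_def)
  \<comment> \<open>At \<open>V x = v\<close> the function \<open>exp (- s V)\<close> crosses its mean \<open>m\<close>. Both factors below change sign there.\<close>
  define v where "v = - ln m / s"
  have ev: "exp (- s * v) = m" using m s by (simp add: v_def)
  have "0 \<le> (\<integral>x. exp (- (\<beta> + (s + \<Delta>)) * V x) - m * exp (- (\<beta> + \<Delta>) * V x)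
      - exp (- \<Delta> * v) * (exp (- (\<beta> + s) * V x) - m * exp (- (\<beta> + 0) * V x)) \<partial>X)"
  proof (intro integral_nonneg_AE AE_I2)
    fix x
    have "0 \<le> (exp (- \<Delta> * V x) - exp (- \<Delta> * v)) * (exp (- s * V x) - exp (- s * v))"
    proof (cases "V x \<le> v")
      case True
      then show ?thesis using s \<Delta> by (intro mult_nonneg_nonneg) (auto intro: mult_left_mono)
    next
      case False
      then show ?thesis using s \<Delta> by (intro mult_nonpos_nonpos) (auto intro: mult_left_mono)
    qed
    then have "0 \<le> exp (- \<beta> * V x) * ((exp (- \<Delta> * V x) - exp (- \<Delta> * v)) * (exp (- s * V x) - m))"
      unfolding ev by simp
    also have "\<dots> = exp (- (\<beta> + (s + \<Delta>)) * V x) - m * exp (- (\<beta> + \<Delta>) * V x)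
      - exp (- \<Delta> * v) * (exp (- (\<beta> + s) * V x) - m * exp (- (\<beta> + 0) * V x))"
    proof -
      have e1: "exp (- (\<beta> + (s + \<Delta>)) * V x) = exp (- \<beta> * V x) * exp (- \<Delta> * V x) * exp (- s * V x)"
        by (simp only: mult_exp_exp) (simp add: algebra_simps)
      have e0: "exp (- (\<beta> + 0) * V x) = exp (- \<beta> * V x)" by simp
      have e2: "exp (- (\<beta> + t) * V x) = exp (- \<beta> * V x) * exp (- t * V x)" for t
        by (simp only: mult_exp_exp) (simp add: algebra_simps)
      show ?thesis unfolding e0 e1 e2[of \<Delta>] e2[of s]
        by (simp only: left_diff_distrib right_diff_distrib mult_ac)
    qed
    finally show "0 \<le> \<dots>" .
  qed
  also have "\<dots> = ?Z (s + \<Delta>) - m * ?Z \<Delta> - exp (- \<Delta> * v) * (?Z s - m * ?Z 0)"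
    using i[of "s + \<Delta>"] i[of \<Delta>] i[of s] i[of 0] s \<Delta> by simp
  also have "?Z s - m * ?Z 0 = 0" using Z0 by (simp add: m_def)
  finally have "m * ?Z \<Delta> \<le> ?Z (s + \<Delta>)" by simp
  then show ?thesis using Z0 by (simp add: m_def field_simps)
qed simp

text \<open>
  After shifting the energy to make it nonnegative, the exponential is at most \<open>1\<close> and the ratio of the
  partition functions decreases in \<open>\<beta>\<close> by log-convexity and increases in \<open>\<Delta>\<close>. The shift cancels
  between numerator and denominator.
\<close>
lemma gibbs_ratio_bounded:
  fixes U :: "'a \<Rightarrow> real"
  assumes U: "U \<in> borel_measurable X" "bdd_below (U ` space X)"
    and int: "integrable X (\<lambda>x. exp (- \<beta>1 * U x))" and pos: "0 < (\<integral>x. exp (- \<beta>1 * U x) \<partial>X)"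
    and D: "0 \<le> D"
  shows "\<exists>R\<ge>1. \<forall>\<beta> \<Delta> x. \<beta>1 \<le> \<beta> \<longrightarrow> 0 \<le> \<Delta> \<longrightarrow> \<Delta> \<le> D \<longrightarrow> x \<in> space X \<longrightarrow>
      exp (- \<Delta> * U x) * (\<integral>y. exp (- \<beta> * U y) \<partial>X) / (\<integral>y. exp (- (\<beta> + \<Delta>) * U y) \<partial>X) \<le> R"
proof -
  obtain b where b: "\<And>x. x \<in> space X \<Longrightarrow> b \<le> U x"
    using U(2) by (auto simp: bdd_below_def)
  define V where "V x = U x - b" for x
  let ?Z = "\<lambda>\<beta>. \<integral>y. exp (- \<beta> * V y) \<partial>X"
  have V: "V \<in> borel_measurable X" "\<And>x. x \<in> space X \<Longrightarrow> 0 \<le> V x"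
    using U(1) b by (auto simp: V_def[abs_def])
  have UV: "exp (- \<beta> * U x) = exp (- \<beta> * b) * exp (- \<beta> * V x)" for \<beta> x
    by (simp add: V_def exp_add[symmetric] algebra_simps)
  have intV: "integrable X (\<lambda>x. exp (- \<beta>1 * V x))"
  proof -
    have "integrable X (\<lambda>x. exp (- \<beta>1 * b) * exp (- \<beta>1 * V x))" using int by (simp only: UV)
    from integrable_mult_right[OF this, of "exp (\<beta>1 * b)"] show ?thesis
      by (simp only: mult.assoc[symmetric] mult_exp_exp) simp
  qed
  have posV: "0 < ?Z \<beta>1"
  proof -
    have "0 < exp (- \<beta>1 * b) * ?Z \<beta>1" using pos by (simp only: UV integral_mult_right_zero)
    then show ?thesis by (rule zero_less_mult_pos) simp
  qed
  have i: "integrable X (\<lambda>x. exp (- \<beta> * V x))" if "\<beta>1 \<le> \<beta>" for \<beta>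
    using laplace_integrable_mono[OF V intV that] .
  have p: "0 < ?Z \<beta>" if "\<beta>1 \<le> \<beta>" for \<beta>
    using laplace_pos[OF i[OF that] posV] .
  have mono: "?Z \<beta>' \<le> ?Z \<beta>" if "\<beta>1 \<le> \<beta>" "\<beta> \<le> \<beta>'" for \<beta> \<beta>'
    using that V by (intro integral_mono i) (auto intro: mult_right_mono)
  have "exp (- \<Delta> * U x) * (\<integral>y. exp (- \<beta> * U y) \<partial>X) / (\<integral>y. exp (- (\<beta> + \<Delta>) * U y) \<partial>X) \<le> ?Z \<beta>1 / ?Z (\<beta>1 + D)"
    if \<beta>: "\<beta>1 \<le> \<beta>" and \<Delta>: "0 \<le> \<Delta>" "\<Delta> \<le> D" and x: "x \<in> space X" for \<beta> \<Delta> x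
  proof -
    have "exp (- \<Delta> * U x) * (\<integral>y. exp (- \<beta> * U y) \<partial>X) / (\<integral>y. exp (- (\<beta> + \<Delta>) * U y) \<partial>X)
        = exp (- \<Delta> * V x) * (exp (- \<Delta> * b) * exp (- \<beta> * b) / exp (- (\<beta> + \<Delta>) * b)) * (?Z \<beta> / ?Z (\<beta> + \<Delta>))"
      by (simp only: UV integral_mult_right_zero) simp
    also have "exp (- \<Delta> * b) * exp (- \<beta> * b) / exp (- (\<beta> + \<Delta>) * b) = 1"
      by (simp add: exp_add[symmetric] algebra_simps)
    also have "exp (- \<Delta> * V x) * 1 * (?Z \<beta> / ?Z (\<beta> + \<Delta>)) \<le> 1 * (?Z \<beta> / ?Z (\<beta> + \<Delta>))"
      using V(2)[OF x] \<Delta> p[of \<beta>] p[of "\<beta> + \<Delta>"] \<beta> by (intro mult_right_mono) auto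
    also have "\<dots> \<le> ?Z \<beta>1 / ?Z (\<beta>1 + \<Delta>)"
    proof -
      have "?Z (\<beta>1 + (\<beta> - \<beta>1)) * ?Z (\<beta>1 + \<Delta>) \<le> ?Z \<beta>1 * ?Z (\<beta>1 + (\<beta> - \<beta>1) + \<Delta>)"
        using \<beta> \<Delta> by (intro laplace_log_convex V intV posV) auto
      then show ?thesis using p[of "\<beta>1 + \<Delta>"] p[of "\<beta> + \<Delta>"] \<beta> \<Delta> by (simp add: field_simps)
    qed
    also have "\<dots> \<le> ?Z \<beta>1 / ?Z (\<beta>1 + D)"
      using mono[of "\<beta>1 + \<Delta>" "\<beta>1 + D"] p[of "\<beta>1 + D"] p[of "\<beta>1 + \<Delta>"] posV \<Delta> D by (intro divide_left_mono) auto
    finally show ?thesis .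
  qed
  moreover have "1 \<le> ?Z \<beta>1 / ?Z (\<beta>1 + D)"
    using mono[of \<beta>1 "\<beta>1 + D"] p[of "\<beta>1 + D"] D by (simp add: field_simps)
  ultimately show ?thesis by blast
qed

section \<open>Gibbs measures of the local mixing model\<close>

text \<open>
  Dominated convergence of the difference quotients. For increments of at most
  \<open>r = (\<beta> - \<beta>0) / 2\<close> they are bounded by \<open>V exp (- (\<beta> - r) V)\<close>, and half of the distance to \<open>\<beta>0\<close>
  absorbs the factor \<open>V\<close>.
\<close>
lemma laplace_has_derivative:
  fixes V c :: "'a \<Rightarrow> real"
  assumes V [measurable]: "V \<in> borel_measurable X" and Vnn: "\<And>x. x \<in> space X \<Longrightarrow> 0 \<le> V x"
    and c [measurable]: "c \<in> borel_measurable X" and c1: "\<And>x. x \<in> space X \<Longrightarrow> \<bar>c x\<bar> \<le> 1"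
    and int: "integrable X (\<lambda>x. exp (- \<beta>0 * V x))" and \<beta>: "\<beta>0 < \<beta>"
  shows "((\<lambda>\<beta>. \<integral>x. c x * exp (- \<beta> * V x) \<partial>X) has_real_derivative
      (\<integral>x. c x * (- V x * exp (- \<beta> * V x)) \<partial>X)) (at \<beta>)"
proof -
  define r where "r = (\<beta> - \<beta>0) / 2"
  have r: "0 < r" "\<beta> - r - \<beta>0 = r" using \<beta> by (auto simp: r_def field_simps)
  let ?\<psi> = "\<lambda>\<beta>. \<integral>x. c x * exp (- \<beta> * V x) \<partial>X"
  have i: "integrable X (\<lambda>x. c x * exp (- t * V x))" if "\<beta>0 \<le> t" for t
  proof (rule Bochner_Integration.integrable_bound[OF laplace_integrable_mono[OF V Vnn int that]])
    show "AE x in X. norm (c x * exp (- t * V x)) \<le> norm (exp (- t * V x))"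
      using c1 by (intro AE_I2) (simp add: abs_mult)
  qed auto
  have quot: "\<bar>(exp (- (\<beta> + h) * v) - exp (- \<beta> * v)) / h\<bar> \<le> (1 / r) * exp (- \<beta>0 * v)"
    if h: "h \<noteq> 0" "\<bar>h\<bar> \<le> r" and v: "0 \<le> v" for h v
  proof -
    have shift: "exp (- (\<beta> + h) * v) = exp (- \<beta> * v) * exp (- h * v)"
      by (simp only: mult_exp_exp) (simp add: algebra_simps)
    have *: "\<bar>exp (- (\<beta> + h) * v) - exp (- \<beta> * v)\<bar> \<le> \<bar>h\<bar> * (v * exp (- (\<beta> - r) * v))"
    proof (cases "0 < h")
      case True
      have "exp (- (\<beta> + h) * v) - exp (- \<beta> * v) = exp (- \<beta> * v) * (exp (- h * v) - 1)"
        unfolding shift by (simp only: right_diff_distrib mult_1_right)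
      then have "\<bar>exp (- (\<beta> + h) * v) - exp (- \<beta> * v)\<bar> = exp (- \<beta> * v) * \<bar>exp (- h * v) - 1\<bar>"
        by (simp only: abs_mult abs_exp_cancel)
      also have "\<bar>exp (- h * v) - 1\<bar> \<le> h * v"
      proof -
        have "0 \<le> h * v" using True v by simp
        then have "exp (- h * v) \<le> 1" by simp
        then show ?thesis using exp_ge_add_one_self[of "- h * v"] by simp
      qed
      also have "exp (- \<beta> * v) \<le> exp (- (\<beta> - r) * v)"
        using r v by (intro exp_le_cancel_iff[THEN iffD2] mult_right_mono) auto
      finally show ?thesis using True v by (simp add: mult_right_mono mult_ac mult_left_mono)
    next
      case False
      then have h0: "h < 0" using h by simp
      have "exp (- (\<beta> + h) * v) * exp (h * v) = exp (- \<beta> * v)"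
        by (simp only: mult_exp_exp) (simp add: algebra_simps)
      then have "exp (- (\<beta> + h) * v) - exp (- \<beta> * v) = exp (- (\<beta> + h) * v) * (1 - exp (h * v))"
        by (simp only: right_diff_distrib mult_1_right)
      then have "\<bar>exp (- (\<beta> + h) * v) - exp (- \<beta> * v)\<bar> = exp (- (\<beta> + h) * v) * \<bar>1 - exp (h * v)\<bar>"
        by (simp only: abs_mult abs_exp_cancel)
      also have "\<bar>1 - exp (h * v)\<bar> \<le> \<bar>h\<bar> * v"
      proof -
        have "h * v \<le> 0" using h0 v by (simp add: mult_nonpos_nonneg)
        then have "\<bar>1 - exp (h * v)\<bar> = 1 - exp (h * v)" by simp
        moreover have "\<bar>h\<bar> * v = - (h * v)" using h0 by simp
        ultimately show ?thesis using exp_ge_add_one_self[of "h * v"] by linarith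
      qed
      also have "exp (- (\<beta> + h) * v) \<le> exp (- (\<beta> - r) * v)"
        using h h0 v by (intro exp_le_cancel_iff[THEN iffD2] mult_right_mono) auto
      finally show ?thesis using v by (simp add: mult_right_mono mult_ac mult_left_mono)
    qed
    have "v * exp (- (\<beta> - r) * v) = (v * exp (- r * v)) * exp (- \<beta>0 * v)"
      using r(2) by (simp add: mult.assoc exp_add[symmetric] algebra_simps r_def)
    also have "\<dots> \<le> (1 / r) * exp (- \<beta>0 * v)"
      using exp_neg_mult_le[OF r(1) v] by (intro mult_right_mono) auto
    finally have "\<bar>exp (- (\<beta> + h) * v) - exp (- \<beta> * v)\<bar> \<le> \<bar>h\<bar> * ((1 / r) * exp (- \<beta>0 * v))"
      using * by (meson abs_ge_zero mult_left_mono order_trans)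
    then show ?thesis using h by (simp add: field_simps)
  qed
  have "((\<lambda>h. (?\<psi> (\<beta> + h) - ?\<psi> \<beta>) / h) \<longlongrightarrow> (\<integral>x. c x * (- V x * exp (- \<beta> * V x)) \<partial>X)) (at 0 within {-r<..<r})"
    unfolding tendsto_at_iff_sequentially
  proof (intro allI impI)
    fix h :: "nat \<Rightarrow> real" assume h: "\<forall>i. h i \<in> {-r<..<r} - {0}" and h0: "h \<longlonglongrightarrow> 0"
    have h': "h i \<noteq> 0" "\<bar>h i\<bar> \<le> r" for i using h[rule_format, of i] by auto
    have lim: "(\<lambda>i. \<integral>x. c x * ((exp (- (\<beta> + h i) * V x) - exp (- \<beta> * V x)) / h i) \<partial>X)
        \<longlonglongrightarrow> (\<integral>x. c x * (- V x * exp (- \<beta> * V x)) \<partial>X)"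
    proof (rule integral_dominated_convergence[where w="\<lambda>x. (1 / r) * exp (- \<beta>0 * V x)"])
      show "integrable X (\<lambda>x. (1 / r) * exp (- \<beta>0 * V x))" using int by simp
      show "AE x in X. norm (c x * ((exp (- (\<beta> + h i) * V x) - exp (- \<beta> * V x)) / h i)) \<le> (1 / r) * exp (- \<beta>0 * V x)" for i
      proof (intro AE_I2)
        fix x assume x: "x \<in> space X"
        have "\<bar>c x\<bar> * \<bar>(exp (- (\<beta> + h i) * V x) - exp (- \<beta> * V x)) / h i\<bar> \<le> 1 * ((1 / r) * exp (- \<beta>0 * V x))"
          by (rule mult_mono[OF c1[OF x] quot[OF h' Vnn[OF x]]]) auto
        then show "norm (c x * ((exp (- (\<beta> + h i) * V x) - exp (- \<beta> * V x)) / h i)) \<le> (1 / r) * exp (- \<beta>0 * V x)"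
          by (simp only: real_norm_def abs_mult mult_1)
      qed
      show "AE x in X. (\<lambda>i. c x * ((exp (- (\<beta> + h i) * V x) - exp (- \<beta> * V x)) / h i)) \<longlonglongrightarrow> c x * (- V x * exp (- \<beta> * V x))"
      proof (intro AE_I2 tendsto_mult tendsto_const)
        fix x
        have "((\<lambda>t. exp (- t * V x)) has_real_derivative (- V x * exp (- \<beta> * V x))) (at \<beta>)"
          by (auto intro!: derivative_eq_intros)
        then have "((\<lambda>h. (exp (- (\<beta> + h) * V x) - exp (- \<beta> * V x)) / h) \<longlongrightarrow> - V x * exp (- \<beta> * V x)) (at 0)"
          by (simp only: DERIV_def)
        then show "(\<lambda>i. (exp (- (\<beta> + h i) * V x) - exp (- \<beta> * V x)) / h i) \<longlonglongrightarrow> - V x * exp (- \<beta> * V x)"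
          using h0 h' unfolding tendsto_at_iff_sequentially comp_def by auto
      qed
    qed auto
    have eq: "(?\<psi> (\<beta> + h i) - ?\<psi> \<beta>) / h i = (\<integral>x. c x * ((exp (- (\<beta> + h i) * V x) - exp (- \<beta> * V x)) / h i) \<partial>X)" for i
    proof -
      have "\<beta>0 \<le> \<beta> + h i" "\<beta>0 \<le> \<beta>" using h'(2)[of i] r \<beta> by auto
      then have "?\<psi> (\<beta> + h i) - ?\<psi> \<beta> = (\<integral>x. c x * exp (- (\<beta> + h i) * V x) - c x * exp (- \<beta> * V x) \<partial>X)"
        by (intro Bochner_Integration.integral_diff[symmetric] i)
      then have "(?\<psi> (\<beta> + h i) - ?\<psi> \<beta>) / h i = (\<integral>x. (c x * exp (- (\<beta> + h i) * V x) - c x * exp (- \<beta> * V x)) / h i \<partial>X)"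
        by simp
      then show ?thesis by (simp add: right_diff_distrib diff_divide_distrib)
    qed
    show "((\<lambda>h. (?\<psi> (\<beta> + h) - ?\<psi> \<beta>) / h) \<circ> h) \<longlonglongrightarrow> (\<integral>x. c x * (- V x * exp (- \<beta> * V x)) \<partial>X)"
      unfolding comp_def eq by (rule lim)
  qed
  then have "((\<lambda>h. (?\<psi> (\<beta> + h) - ?\<psi> \<beta>) / h) \<longlongrightarrow> (\<integral>x. c x * (- V x * exp (- \<beta> * V x)) \<partial>X)) (at 0)"
    using r(1) by (subst (asm) at_within_open) auto
  then show ?thesis by (simp only: DERIV_def)
qed

text \<open>
  The fundamental theorem for the Henstock-Kurzweil integral holds for every derivative, continuous or
  not. Measurability of the derivative comes with it, and the finite variation integral then makes the
  derivative Lebesgue integrable.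
\<close>
lemma abs_diff_le_nn_integral_deriv:
  fixes f :: "real \<Rightarrow> real"
  assumes ab: "a \<le> b" and f: "\<And>t. t \<in> {a..b} \<Longrightarrow> f differentiable (at t)"
    and sub: "{a..b} \<subseteq> S" and fin: "(\<integral>\<^sup>+t\<in>S. ennreal \<bar>deriv f t\<bar> \<partial>lborel) \<le> ennreal C" and C: "0 \<le> C"
  shows "\<bar>f b - f a\<bar> \<le> C"
proof -
  have "(deriv f has_integral (f b - f a)) {a..b}"
  proof (rule fundamental_theorem_of_calculus[OF ab])
    fix t assume "t \<in> {a..b}"
    then have "(f has_real_derivative deriv f t) (at t)"
      using f DERIV_deriv_iff_real_differentiable by blast
    then show "(f has_vector_derivative deriv f t) (at t within {a..b})"
      using has_real_derivative_iff_has_vector_derivative has_vector_derivative_at_within by blast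
  qed
  then have I: "((\<lambda>t. if t \<in> {a..b} then deriv f t else 0) has_integral (f b - f a)) UNIV"
    by (simp only: has_integral_restrict_UNIV)
  let ?g = "\<lambda>t. if t \<in> {a..b} then deriv f t else 0"
  have m: "?g \<in> borel_measurable lebesgue"
    using has_integral_implies_lebesgue_measurable[OF I] by simp
  have "(\<integral>\<^sup>+t. ennreal (norm (?g t)) \<partial>lebesgue) = (\<integral>\<^sup>+t. ennreal (norm (?g t)) \<partial>lborel)"
    by (rule nn_integral_completion)
  also have "\<dots> \<le> (\<integral>\<^sup>+t\<in>S. ennreal \<bar>deriv f t\<bar> \<partial>lborel)"
    using sub by (intro nn_integral_mono) (auto simp: indicator_def)
  finally have nn: "(\<integral>\<^sup>+t. ennreal (norm (?g t)) \<partial>lebesgue) \<le> ennreal C" using fin by (rule order_trans)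
  then have int: "integrable lebesgue ?g"
    using m by (intro integrableI_bounded) (auto simp: le_less_trans[OF _ ennreal_less_top])
  have "f b - f a = (\<integral>t. ?g t \<partial>lebesgue)"
    by (rule has_integral_unique[OF I has_integral_integral_lebesgue[OF int]])
  also have "\<bar>\<dots>\<bar> \<le> (\<integral>t. norm (?g t) \<partial>lebesgue)" using integral_abs_bound by simp
  also have "\<dots> \<le> C"
    using nn nn_integral_eq_integral[OF integrable_norm[OF int]] C by (simp add: ennreal_le_iff)
  finally show ?thesis .
qed

lemma gibbs_pdf_measurable:
  assumes [measurable]: "U \<in> borel_measurable X"
  shows "gibbs_pdf X U \<epsilon> \<in> borel_measurable X"
  unfolding gibbs_pdf_def[abs_def] unnorm_pdf_def by measurable

lemma gibbs_integral:
  assumes "U \<in> borel_measurable X" "0 < partition_fun X U \<epsilon>" "f \<in> borel_measurable X"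
  shows "(\<integral>x. f x \<partial>gibbs X U \<epsilon>) = (\<integral>x. gibbs_pdf X U \<epsilon> x * f x \<partial>X)"
  unfolding gibbs_def using assms
  by (subst integral_density) (auto intro: gibbs_pdf_measurable intro!: AE_I2 simp: gibbs_pdf_def unnorm_pdf_def)

lemma gibbs_measure:
  assumes U: "U \<in> borel_measurable X" and Z: "0 < partition_fun X U \<epsilon>" and A: "A \<in> sets X"
  shows "measure (gibbs X U \<epsilon>) A = (\<integral>x. indicator A x * unnorm_pdf U \<epsilon> x \<partial>X) / partition_fun X U \<epsilon>"
proof -
  have "measure (gibbs X U \<epsilon>) A = (\<integral>x. indicator A x \<partial>gibbs X U \<epsilon>)"
    using A sets.sets_into_space[OF A] by (simp add: gibbs_def Int_absorb2)
  also have "\<dots> = (\<integral>x. gibbs_pdf X U \<epsilon> x * indicator A x \<partial>X)"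
    by (rule gibbs_integral[OF U Z]) (use A in auto)
  also have "\<dots> = (\<integral>x. indicator A x * unnorm_pdf U \<epsilon> x / partition_fun X U \<epsilon> \<partial>X)"
    by (simp add: gibbs_pdf_def mult.commute)
  finally show ?thesis by simp
qed

lemma gibbs_pdf_mass:
  assumes int: "integrable X (unnorm_pdf U \<epsilon>)" and Z: "0 < partition_fun X U \<epsilon>"
  shows "(\<integral>\<^sup>+x. ennreal (gibbs_pdf X U \<epsilon> x) \<partial>X) = 1"
proof -
  have "(\<integral>\<^sup>+x. ennreal (gibbs_pdf X U \<epsilon> x) \<partial>X) = ennreal (\<integral>x. gibbs_pdf X U \<epsilon> x \<partial>X)"
  proof (intro nn_integral_eq_integral AE_I2)
    show "integrable X (gibbs_pdf X U \<epsilon>)"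
      unfolding gibbs_pdf_def[abs_def] by (rule integrable_divide[OF int])
  qed (use Z in \<open>simp add: gibbs_pdf_def unnorm_pdf_def\<close>)
  also have "(\<integral>x. gibbs_pdf X U \<epsilon> x \<partial>X) = 1"
    using Z by (simp add: gibbs_pdf_def partition_fun_def)
  finally show ?thesis by simp
qed

text \<open>
  The sets \<open>{x. 1/(n+1) \<le> f x}\<close> exhaust the space and have finite measure by Markov's inequality.
\<close>
lemma sigma_finite_measure_of_integrable_pos:
  fixes f :: "'a \<Rightarrow> real"
  assumes "integrable X f" "\<And>x. x \<in> space X \<Longrightarrow> 0 < f x"
  shows "sigma_finite_measure X"
proof
  have m [measurable]: "f \<in> borel_measurable X" using assms(1) by simp
  define A where "A n = {x \<in> space X. 1 / real (Suc n) \<le> f x}" for n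
  have "emeasure X (A n) \<noteq> \<infinity>" for n
  proof -
    have "emeasure X (A n) \<le> ennreal (real (Suc n)) * (\<integral>\<^sup>+x. ennreal (f x) \<partial>X)"
    proof -
      have "emeasure X (A n) = (\<integral>\<^sup>+x. indicator (A n) x \<partial>X)" by (simp add: A_def)
      also have "\<dots> \<le> (\<integral>\<^sup>+x. ennreal (real (Suc n)) * ennreal (f x) \<partial>X)"
      proof (intro nn_integral_mono)
        fix x assume x: "x \<in> space X"
        have "1 \<le> real (Suc n) * f x" if "x \<in> A n" using that by (simp add: A_def field_simps)
        then show "indicator (A n) x \<le> ennreal (real (Suc n)) * ennreal (f x)"
          using assms(2)[OF x] by (auto simp: indicator_def ennreal_mult[symmetric] simp del: of_nat_Suc)
      qed
      also have "\<dots> = ennreal (real (Suc n)) * (\<integral>\<^sup>+x. ennreal (f x) \<partial>X)" by (rule nn_integral_cmult) simp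
      finally show ?thesis .
    qed
    also have "(\<integral>\<^sup>+x. ennreal (f x) \<partial>X) = ennreal (\<integral>x. f x \<partial>X)"
      using assms by (intro nn_integral_eq_integral AE_I2) (auto intro: less_imp_le)
    also have "ennreal (real (Suc n)) * ennreal (\<integral>x. f x \<partial>X) < \<infinity>"
      by (simp add: ennreal_mult_less_top)
    finally show ?thesis by simp
  qed
  moreover have "(\<Union>n. A n) = space X"
  proof
    show "space X \<subseteq> (\<Union>n. A n)"
    proof
      fix x assume x: "x \<in> space X"
      obtain n where "inverse (real (Suc n)) < f x" using reals_Archimedean[OF assms(2)[OF x]] by blast
      then show "x \<in> (\<Union>n. A n)" using x by (auto simp: A_def inverse_eq_divide intro!: exI[of _ n] less_imp_le)
    qed
  qed (auto simp: A_def)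
  ultimately show "\<exists>A. countable A \<and> A \<subseteq> sets X \<and> \<Union> A = space X \<and> (\<forall>a\<in>A. emeasure X a \<noteq> \<infinity>)"
    by (intro exI[of _ "range A"]) (auto simp: A_def)
qed

text \<open>
  The step density is \<open>q y\<close> times a function that is symmetric in \<open>x\<close> and \<open>y\<close> and that is a convex
  combination of \<open>1\<close> and at most \<open>1 / \<mu>(\<Omega> i)\<close>, where \<open>\<Omega> i\<close> is the well containing \<open>x\<close>.
\<close>
lemma local_mixing_reversible_density:
  assumes U: "U \<in> borel_measurable X"
    and \<Omega>: "\<And>j. j \<in> {1..J} \<Longrightarrow> \<Omega> j \<in> sets X" "disjoint_family_on \<Omega> {1..J}" "(\<Union>j\<in>{1..J}. \<Omega> j) = space X"
    and int: "integrable X (unnorm_pdf U \<epsilon>)" and Z: "0 < partition_fun X U \<epsilon>"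
    and m0: "0 < m" "m \<le> 1" and m: "\<And>j. j \<in> {1..J} \<Longrightarrow> m \<le> measure (gibbs X U \<epsilon>) (\<Omega> j)"
    and chi: "0 < chi \<epsilon>" "chi \<epsilon> < 1"
  shows "reversible_density X (local_mixing_pdf X U J \<Omega> chi \<epsilon>) (gibbs_pdf X U \<epsilon>) (1 / m)"
proof -
  let ?q = "gibbs_pdf X U \<epsilon>" and ?p = "local_mixing_pdf X U J \<Omega> chi \<epsilon>"
  let ?\<mu> = "\<lambda>j. measure (gibbs X U \<epsilon>) (\<Omega> j)"
  note [measurable] = U
  have qm [measurable]: "?q \<in> borel_measurable X"
    by (rule gibbs_pdf_measurable[OF U])
  have q0: "0 \<le> ?q x" for x using Z by (simp add: gibbs_pdf_def unnorm_pdf_def)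
  have \<mu>pos: "0 < ?\<mu> j" if "j \<in> {1..J}" for j using m[OF that] m0 by simp
  have p_eq: "?p x y = (1 - chi \<epsilon>) * ?q y + chi \<epsilon> * (indicator (\<Omega> i) y * (?q y / ?\<mu> i))"
    if i: "i \<in> {1..J}" "x \<in> \<Omega> i" for x y i
  proof -
    have "(\<Sum>j\<in>{1..J}. (if x \<in> \<Omega> j \<and> y \<in> \<Omega> j then 1 else 0) * (?q y / ?\<mu> j))
        = (\<Sum>j\<in>{1..J}. if j = i then indicator (\<Omega> i) y * (?q y / ?\<mu> i) else 0)"
    proof (intro sum.cong refl)
      fix j assume "j \<in> {1..J}"
      then have "x \<in> \<Omega> j \<longleftrightarrow> j = i" using \<Omega>(2) i unfolding disjoint_family_on_def by blast
      then show "(if x \<in> \<Omega> j \<and> y \<in> \<Omega> j then 1 else 0) * (?q y / ?\<mu> j)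
          = (if j = i then indicator (\<Omega> i) y * (?q y / ?\<mu> i) else 0)"
        by (auto simp: indicator_def)
    qed
    then show ?thesis using i by (simp add: local_mixing_pdf_def)
  qed
  have cover: "\<exists>i\<in>{1..J}. x \<in> \<Omega> i" if "x \<in> space X" for x using \<Omega>(3) that by blast
  show ?thesis
  proof (rule reversible_density.intro)
    show "sigma_finite_measure X"
      by (rule sigma_finite_measure_of_integrable_pos[OF int]) (simp add: unnorm_pdf_def)
    show "(\<lambda>(x, y). ?p x y) \<in> borel_measurable (X \<Otimes>\<^sub>M X)"
    proof -
      have "(\<lambda>z. (if fst z \<in> \<Omega> j \<and> snd z \<in> \<Omega> j then 1 else 0 :: real)) \<in> borel_measurable (X \<Otimes>\<^sub>M X)"
        if "j \<in> {1..J}" for j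
      proof -
        note [measurable] = \<Omega>(1)[OF that]
        show ?thesis by measurable
      qed
      moreover have "(\<lambda>z. ?q (snd z)) \<in> borel_measurable (X \<Otimes>\<^sub>M X)" by measurable
      ultimately show ?thesis
        unfolding local_mixing_pdf_def case_prod_beta
        by (intro borel_measurable_add borel_measurable_times borel_measurable_sum borel_measurable_divide
            borel_measurable_const)
    qed
    show "0 \<le> ?p x y" for x y
      unfolding local_mixing_pdf_def using chi q0
      by (intro add_nonneg_nonneg mult_nonneg_nonneg sum_nonneg divide_nonneg_nonneg) auto
    show "?q x * ?p x y = ?q y * ?p y x" for x y
      unfolding local_mixing_pdf_def distrib_left sum_distrib_left
      by (intro arg_cong2[where f="(+)"] sum.cong) auto
    show "?q \<in> borel_measurable X" by (rule qm)
    show "0 \<le> ?q x" for x by (rule q0)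
    show "(\<integral>\<^sup>+y. ennreal (?q y) \<partial>X) = 1" by (rule gibbs_pdf_mass[OF int Z])
    show "(\<integral>\<^sup>+y. ennreal (?p x y) \<partial>X) = 1" if "x \<in> space X" for x
    proof -
      obtain i where i: "i \<in> {1..J}" "x \<in> \<Omega> i" using cover \<open>x \<in> space X\<close> by blast
      note [measurable] = \<Omega>(1)[OF i(1)]
      have "(\<integral>\<^sup>+y. ennreal (?p x y) \<partial>X) = (\<integral>\<^sup>+y. ennreal (1 - chi \<epsilon>) * ennreal (?q y)
          + ennreal (chi \<epsilon> / ?\<mu> i) * (ennreal (?q y) * indicator (\<Omega> i) y) \<partial>X)"
        using chi q0 \<mu>pos[OF i(1)]
        by (intro nn_integral_cong)
          (auto simp: p_eq[OF i] indicator_def ennreal_mult[symmetric] ennreal_plus[symmetric] simp del: ennreal_plus)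
      also have "\<dots> = ennreal (1 - chi \<epsilon>) * (\<integral>\<^sup>+y. ennreal (?q y) \<partial>X)
          + ennreal (chi \<epsilon> / ?\<mu> i) * (\<integral>\<^sup>+y. ennreal (?q y) * indicator (\<Omega> i) y \<partial>X)"
        by (subst nn_integral_add) (auto simp: nn_integral_cmult)
      also have "(\<integral>\<^sup>+y. ennreal (?q y) * indicator (\<Omega> i) y \<partial>X) = emeasure (gibbs X U \<epsilon>) (\<Omega> i)"
        by (simp add: gibbs_def emeasure_density)
      also have "\<dots> = ennreal (?\<mu> i)"
        using \<mu>pos[OF i(1)] by (intro emeasure_eq_ennreal_measure) (auto simp: measure_def)
      also have "ennreal (1 - chi \<epsilon>) * (\<integral>\<^sup>+y. ennreal (?q y) \<partial>X) + ennreal (chi \<epsilon> / ?\<mu> i) * ennreal (?\<mu> i) = 1"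
        using chi \<mu>pos[OF i(1)]
        by (simp add: gibbs_pdf_mass[OF int Z] ennreal_mult[symmetric] ennreal_plus[symmetric] del: ennreal_plus)
      finally show ?thesis .
    qed
    show "?p x y \<le> 1 / m * ?q y" if "x \<in> space X" for x y
    proof -
      obtain i where i: "i \<in> {1..J}" "x \<in> \<Omega> i" using cover \<open>x \<in> space X\<close> by blast
      have "?q y * 1 \<le> ?q y * (1 / m)" using q0 m0 by (intro mult_left_mono) auto
      moreover have "indicator (\<Omega> i) y * (?q y / ?\<mu> i) \<le> 1 * (?q y * (1 / m))"
        using q0[of y] m[OF i(1)] m0 \<mu>pos[OF i(1)]
        by (intro mult_mono) (auto simp: indicator_def frac_le)
      ultimately have "?p x y \<le> (1 - chi \<epsilon>) * (?q y * (1 / m)) + chi \<epsilon> * (?q y * (1 / m))"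
        unfolding p_eq[OF i] using chi by (intro add_mono mult_left_mono) auto
      also have "\<dots> = 1 / m * ?q y" by (simp only: left_diff_distrib) simp
      finally show ?thesis .
    qed
  qed
qed

text \<open>
  With the energy shifted by its lower bound, the mass is a quotient of two Laplace transforms at
  \<open>1 / s\<close>, and the exponential prefactors cancel.
\<close>
lemma ln_gibbs_measure_differentiable:
  assumes U: "U \<in> borel_measurable X" "bdd_below (U ` space X)" and A: "A \<in> sets X"
    and ab: "0 < \<epsilon>" "\<epsilon> < b" "integrable X (unnorm_pdf U b)"
    and pos: "\<And>s. \<epsilon> \<le> s \<Longrightarrow> s < b \<Longrightarrow> 0 < partition_fun X U s" "0 < measure (gibbs X U \<epsilon>) A"
    and pos': "\<And>s. a < s \<Longrightarrow> s < \<epsilon> \<Longrightarrow> 0 < partition_fun X U s" "a < \<epsilon>"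
  shows "(\<lambda>s. ln (measure (gibbs X U s) A)) differentiable (at \<epsilon>)"
proof -
  obtain u where u: "\<And>x. x \<in> space X \<Longrightarrow> u \<le> U x"
    using U(2) by (auto simp: bdd_below_def)
  define V where "V x = U x - u" for x
  have V: "V \<in> borel_measurable X" "\<And>x. x \<in> space X \<Longrightarrow> 0 \<le> V x"
    using U(1) u by (auto simp: V_def[abs_def])
  have UV: "unnorm_pdf U s x = exp (- (1 / s) * u) * exp (- (1 / s) * V x)" for s x
    by (simp only: mult_exp_exp unnorm_pdf_def) (simp add: V_def algebra_simps diff_divide_distrib)
  have int: "integrable X (\<lambda>x. exp (- (1 / b) * V x))"
  proof -
    have "integrable X (\<lambda>x. exp (- (1 / b) * u) * exp (- (1 / b) * V x))"
      using ab(3) unfolding UV[abs_def] .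
    from integrable_mult_right[OF this, of "exp ((1 / b) * u)"] show ?thesis
      by (simp only: mult.assoc[symmetric] mult_exp_exp) simp
  qed
  define \<psi> where "\<psi> c \<beta> = (\<integral>x. c x * exp (- \<beta> * V x) \<partial>X)" for c \<beta>
  have diff: "(\<lambda>s. \<psi> c (1 / s)) differentiable (at \<epsilon>)"
    if "c \<in> borel_measurable X" "\<And>x. x \<in> space X \<Longrightarrow> \<bar>c x\<bar> \<le> 1" for c
  proof -
    have "1 / b < 1 / \<epsilon>" using ab by (simp add: frac_less2)
    from laplace_has_derivative[OF V that int this]
    have "\<psi> c differentiable (at (1 / \<epsilon>))"
      unfolding \<psi>_def[abs_def] real_differentiable_def by blast
    moreover have "(\<lambda>s. 1 / s) differentiable (at \<epsilon>)" using ab by simp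
    ultimately show ?thesis using differentiable_chain_at[of "\<lambda>s. 1 / s" \<epsilon> "\<psi> c"] by (simp add: comp_def)
  qed
  have Aeq: "measure (gibbs X U s) A = \<psi> (indicator A) (1 / s) / \<psi> (\<lambda>_. 1) (1 / s)"
    and Zpos: "\<psi> (\<lambda>_. 1) (1 / s) \<noteq> 0" if "0 < partition_fun X U s" for s
  proof -
    have Z: "partition_fun X U s = exp (- (1 / s) * u) * \<psi> (\<lambda>_. 1) (1 / s)"
      unfolding partition_fun_def \<psi>_def UV by simp
    then show "\<psi> (\<lambda>_. 1) (1 / s) \<noteq> 0" using that by auto
    have "measure (gibbs X U s) A = (exp (- (1 / s) * u) * \<psi> (indicator A) (1 / s)) / partition_fun X U s"
      unfolding gibbs_measure[OF U(1) that A] \<psi>_def UV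
      by (subst integral_mult_right_zero[symmetric]) (simp add: mult_ac)
    then show "measure (gibbs X U s) A = \<psi> (indicator A) (1 / s) / \<psi> (\<lambda>_. 1) (1 / s)"
      unfolding Z by simp
  qed
  let ?f = "\<lambda>s. \<psi> (indicator A) (1 / s) / \<psi> (\<lambda>_. 1) (1 / s)"
  have Z\<epsilon>: "0 < partition_fun X U \<epsilon>" using pos(1)[of \<epsilon>] ab by simp
  have "?f differentiable (at \<epsilon>)"
    using Zpos[OF Z\<epsilon>] A by (intro differentiable_divide diff) (auto simp: indicator_def)
  then obtain D' where D': "(?f has_real_derivative D') (at \<epsilon>)"
    unfolding real_differentiable_def by blast
  have "0 < ?f \<epsilon>" using pos(2) Aeq[OF Z\<epsilon>] by simp
  from DERIV_chain2[OF DERIV_ln[OF this] D']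
  obtain D where D: "((\<lambda>s. ln (?f s)) has_real_derivative D) (at \<epsilon>)" by blast
  have "((\<lambda>s. ln (measure (gibbs X U s) A)) has_real_derivative D) (at \<epsilon>)"
  proof (rule has_field_derivative_transform_within_open[OF D])
    show "open {a<..<b}" "\<epsilon> \<in> {a<..<b}" using ab pos'(2) by auto
    show "ln (?f s) = ln (measure (gibbs X U s) A)" if "s \<in> {a<..<b}" for s
      using Aeq[of s] pos(1)[of s] pos'(1)[of s] that by (cases "s < \<epsilon>") auto
  qed
  then show ?thesis unfolding real_differentiable_def by blast
qed

text \<open>
  On the open temperature interval, the logarithm of the mass of each well varies by at most the
  variation constant around its value at an interior temperature. The end points \<open>\<eta>1\<close> and, if it is
  positive, \<open>\<eta>min\<close> can lie outside the open interval; each of them contributes one more positive number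
  per well to the minimum.
\<close>
lemma gibbs_measure_bounded_below:
  fixes \<eta>min \<eta>1 :: real and \<eta>max :: ereal
  assumes U: "U \<in> borel_measurable X" "bdd_below (U ` space X)"
    and \<Omega>: "\<And>j. j \<in> {1..J} \<Longrightarrow> \<Omega> j \<in> sets X"
    and \<eta>: "0 \<le> \<eta>min" "\<eta>min < \<eta>1" "ereal \<eta>1 \<le> \<eta>max"
    and Z: "\<And>\<epsilon>. 0 < \<epsilon> \<Longrightarrow> \<eta>min \<le> \<epsilon> \<Longrightarrow> ereal \<epsilon> < \<eta>max \<or> \<epsilon> = \<eta>1 \<Longrightarrow> integrable X (unnorm_pdf U \<epsilon>)"
      "\<And>\<epsilon>. 0 < \<epsilon> \<Longrightarrow> \<eta>min \<le> \<epsilon> \<Longrightarrow> ereal \<epsilon> < \<eta>max \<or> \<epsilon> = \<eta>1 \<Longrightarrow> 0 < partition_fun X U \<epsilon>"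
    and pos: "\<And>\<epsilon> j. 0 < \<epsilon> \<Longrightarrow> \<eta>min \<le> \<epsilon> \<Longrightarrow> ereal \<epsilon> < \<eta>max \<or> \<epsilon> = \<eta>1 \<Longrightarrow> j \<in> {1..J} \<Longrightarrow>
                    0 < measure (gibbs X U \<epsilon>) (\<Omega> j)"
    and C_LBV: "C_LBV X U J \<Omega> \<eta>min \<eta>max < \<infinity>"
  shows "\<exists>m>0. m \<le> 1 \<and> (\<forall>\<epsilon> j. 0 < \<epsilon> \<longrightarrow> \<eta>min \<le> \<epsilon> \<longrightarrow> \<epsilon> \<le> \<eta>1 \<longrightarrow> j \<in> {1..J} \<longrightarrow>
      m \<le> measure (gibbs X U \<epsilon>) (\<Omega> j))"
proof -
  define I where "I = {\<epsilon>. \<eta>min < \<epsilon> \<and> ereal \<epsilon> < \<eta>max}"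
  define C where "C = enn2real (C_LBV X U J \<Omega> \<eta>min \<eta>max)"
  let ?\<mu> = "\<lambda>\<epsilon> j. measure (gibbs X U \<epsilon>) (\<Omega> j)"
  have I: "0 < \<epsilon>" "\<eta>min \<le> \<epsilon>" "ereal \<epsilon> < \<eta>max \<or> \<epsilon> = \<eta>1" if "\<epsilon> \<in> I" for \<epsilon>
    using that \<eta>(1) by (auto simp: I_def)
  have variation: "\<bar>ln (?\<mu> b j) - ln (?\<mu> a j)\<bar> \<le> C" if "a \<in> I" "b \<in> I" "a \<le> b" "j \<in> {1..J}" for a b j
  proof (rule abs_diff_le_nn_integral_deriv[where S=I and f="\<lambda>s. ln (?\<mu> s j)" and a=a and b=b])
    show sub: "{a..b} \<subseteq> I"
      using that by (auto simp: I_def intro: le_less_trans[of _ "ereal b"])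
    show "(\<lambda>s. ln (?\<mu> s j)) differentiable (at t)" if "t \<in> {a..b}" for t
    proof -
      have t: "t \<in> I" using sub that by blast
      then have "ereal t < \<eta>max" by (simp add: I_def)
      then obtain b' where b': "ereal t < ereal b'" "ereal b' < \<eta>max" using ereal_dense2 by blast
      have tI: "s \<in> I" if "\<eta>min < s" "s \<le> b'" for s
        using that b'(2) by (auto simp: I_def intro: le_less_trans[of _ "ereal b'"])
      have "\<eta>min < t" using t by (simp add: I_def)
      then show ?thesis
        using b' tI I pos[of t] \<open>j \<in> {1..J}\<close> t Z
        by (intro ln_gibbs_measure_differentiable[where a=\<eta>min and b=b' and A="\<Omega> j"] U \<Omega>) auto
    qed
    have "(\<integral>\<^sup>+t\<in>I. ennreal \<bar>deriv (\<lambda>s. ln (?\<mu> s j)) t\<bar> \<partial>lborel) \<le> C_LBV X U J \<Omega> \<eta>min \<eta>max"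
      unfolding C_LBV_def I_def[symmetric] using \<open>j \<in> {1..J}\<close>
      by (intro member_le_sum[of j "{1..J}" "\<lambda>j. \<integral>\<^sup>+t\<in>I. ennreal \<bar>deriv (\<lambda>s. ln (?\<mu> s j)) t\<bar> \<partial>lborel"]) auto
    also have "\<dots> = ennreal C" using C_LBV by (simp add: C_def)
    finally show "(\<integral>\<^sup>+t\<in>I. ennreal \<bar>deriv (\<lambda>s. ln (?\<mu> s j)) t\<bar> \<partial>lborel) \<le> ennreal C" .
  qed (use that in \<open>simp_all add: C_def\<close>)
  define \<epsilon>0 where "\<epsilon>0 = (\<eta>min + \<eta>1) / 2"
  have \<epsilon>0: "\<epsilon>0 \<in> I"
  proof -
    have "\<epsilon>0 < \<eta>1" using \<eta>(2) by (simp add: \<epsilon>0_def)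
    then have "ereal \<epsilon>0 < \<eta>max" using \<eta>(3) less_le_trans[of "ereal \<epsilon>0" "ereal \<eta>1"] by simp
    then show ?thesis using \<eta>(2) by (simp add: I_def \<epsilon>0_def)
  qed
  have interior: "?\<mu> \<epsilon>0 j * exp (- C) \<le> ?\<mu> \<epsilon> j" if "\<epsilon> \<in> I" "j \<in> {1..J}" for \<epsilon> j
  proof -
    have "\<bar>ln (?\<mu> \<epsilon>0 j) - ln (?\<mu> \<epsilon> j)\<bar> \<le> C"
      using variation[of \<epsilon> \<epsilon>0 j] variation[of \<epsilon>0 \<epsilon> j] that \<epsilon>0 by (cases "\<epsilon> \<le> \<epsilon>0") auto
    then have "exp (ln (?\<mu> \<epsilon>0 j) + (- C)) \<le> exp (ln (?\<mu> \<epsilon> j))" by (intro exp_le_cancel_iff[THEN iffD2]) linarith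
    then show ?thesis using pos[OF I] that \<epsilon>0 by (simp only: exp_add exp_ln)
  qed
  define G where "G j = min (?\<mu> \<eta>1 j) (min (if 0 < \<eta>min then ?\<mu> \<eta>min j else 1) (?\<mu> \<epsilon>0 j * exp (- C)))" for j
  define m where "m = Min (insert 1 (G ` {1..J}))"
  have \<eta>min_max: "ereal \<eta>min < \<eta>max" using \<eta>(2,3) less_le_trans[of "ereal \<eta>min" "ereal \<eta>1"] by simp
  have "0 < G j" if "j \<in> {1..J}" for j
    using that pos[of \<eta>1 j] pos[of \<eta>min j] pos[of \<epsilon>0 j] I[OF \<epsilon>0] \<eta> \<eta>min_max by (simp add: G_def)
  then have "0 < m" by (auto simp: m_def)
  moreover have "m \<le> 1" by (simp add: m_def)
  moreover have "m \<le> ?\<mu> \<epsilon> j" if "0 < \<epsilon>" "\<eta>min \<le> \<epsilon>" "\<epsilon> \<le> \<eta>1" and j: "j \<in> {1..J}" for \<epsilon> j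
  proof -
    have "m \<le> G j" unfolding m_def using j by (intro Min_le) auto
    also have "G j \<le> ?\<mu> \<epsilon> j"
    proof -
      have "\<epsilon> = \<eta>1 \<or> (\<epsilon> = \<eta>min \<and> 0 < \<eta>min) \<or> (\<eta>min < \<epsilon> \<and> \<epsilon> < \<eta>1)"
        using that by linarith
      then consider "\<epsilon> = \<eta>1" | "\<epsilon> = \<eta>min" "0 < \<eta>min" | "\<eta>min < \<epsilon>" "\<epsilon> < \<eta>1" by blast
      then show ?thesis
      proof cases
        case 3
        then have "\<epsilon> \<in> I" using \<eta>(3) less_le_trans[of "ereal \<epsilon>" "ereal \<eta>1"] by (simp add: I_def)
        from interior[OF this j] show ?thesis by (simp add: G_def)
      qed (simp_all add: G_def)
    qed
    finally show ?thesis .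
  qed
  ultimately show ?thesis by blast
qed

section \<open>The mean square error of annealed sequential Monte Carlo\<close>

text \<open>
  With \<open>C_T = 8 K\<close> the first run deviates from equilibrium by \<open>\<tau> = \<delta> / (4 K)\<close>, and its contribution is
  \<open>\<delta>\<^sup>2 / 4\<close>. With \<open>C_N = 64 K\<^sup>4\<close> the sampling noise stays below \<open>20 \<delta>\<^sup>2 / 64\<close>.
\<close>
lemma error_budget:
  fixes K \<delta> M N n :: real
  assumes K: "1 \<le> K" and \<delta>: "0 < \<delta>" "\<delta> \<le> 1" and M: "1 \<le> M" "0 \<le> n" "n \<le> M"
    and N: "64 * K ^ 4 * M\<^sup>2 / \<delta>\<^sup>2 \<le> N"
  shows "4 * K\<^sup>2 * n \<le> N"
    and "4 * (2 * (\<delta> / (8 * K)))\<^sup>2 * K\<^sup>2 + 4 * K\<^sup>2 / N + 16 * K ^ 4 * n / N \<le> \<delta>\<^sup>2"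
proof -
  have K2: "1 \<le> K\<^sup>2" using K by simp
  have K4: "K\<^sup>2 \<le> K ^ 4" using K by (intro power_increasing) auto
  have M2: "1 \<le> M\<^sup>2" "M \<le> M\<^sup>2"
    using M one_le_power[of M 2] power_increasing[of 1 2 M] by auto
  have KM: "K ^ 4 * n \<le> K ^ 4 * M\<^sup>2" "K\<^sup>2 * n \<le> K ^ 4 * M\<^sup>2" "K\<^sup>2 * 1 \<le> K ^ 4 * M\<^sup>2"
    using K4 K2 M M2 by (intro mult_mono; simp; linarith)+
  have \<delta>N: "64 * (K ^ 4 * M\<^sup>2) \<le> \<delta>\<^sup>2 * N"
    using N \<delta> by (simp add: field_simps)
  have pos: "1 \<le> K ^ 4 * M\<^sup>2" using KM(3) K2 by linarith
  then have "0 < \<delta>\<^sup>2 * N" using \<delta>N by linarith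
  then have N0: "0 < N" using \<delta> by (simp add: zero_less_mult_iff)
  have "\<delta>\<^sup>2 * N \<le> 1 * N" using \<delta> N0 by (intro mult_right_mono) (auto simp: power_le_one)
  then show "4 * K\<^sup>2 * n \<le> N" using KM(2) \<delta>N pos by linarith
  have "4 * (2 * (\<delta> / (8 * K)))\<^sup>2 * K\<^sup>2 = \<delta>\<^sup>2 / 4"
    using K by (simp add: power2_eq_square field_simps)
  moreover have "4 * K\<^sup>2 / N + 16 * K ^ 4 * n / N \<le> \<delta>\<^sup>2 / 2"
  proof -
    have "2 * (4 * a + 16 * b) \<le> D" if "a \<le> q" "b \<le> q" "1 \<le> q" "64 * q \<le> D" for a b q D :: real
    proof -
      have "2 * (4 * a + 16 * b) \<le> 2 * (4 * q + 16 * q)" using that by (intro mult_left_mono add_mono) auto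
      also have "\<dots> \<le> 64 * q" using that by simp
      finally show ?thesis using that(4) by (rule order_trans)
    qed
    from this[OF KM(3,1) pos \<delta>N] show ?thesis using N0 by (simp add: field_simps)
  qed
  moreover have "0 \<le> \<delta>\<^sup>2" by simp
  ultimately show "4 * (2 * (\<delta> / (8 * K)))\<^sup>2 * K\<^sup>2 + 4 * K\<^sup>2 / N + 16 * K ^ 4 * n / N \<le> \<delta>\<^sup>2" by linarith
qed

lemma (in prob_space) abs_minus_expectation_le_osc:
  assumes h: "h \<in> borel_measurable M" "bounded (h ` space M)" and z: "z \<in> space M"
  shows "\<bar>h z - expectation h\<bar> \<le> osc_on (space M) h"
proof -
  let ?S = "SUP x\<in>space M. h x" and ?L = "INF x\<in>space M. h x"
  have bdd: "bdd_above (h ` space M)" "bdd_below (h ` space M)"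
    using h(2) by (auto intro: bounded_imp_bdd_above bounded_imp_bdd_below)
  have S: "h x \<le> ?S" and L: "?L \<le> h x" if "x \<in> space M" for x
    using bdd that by (auto intro: cSUP_upper cINF_lower)
  obtain B where B: "\<And>x. x \<in> space M \<Longrightarrow> \<bar>h x\<bar> \<le> B"
    using h(2) by (auto simp: bounded_iff)
  have int: "integrable M h"
    using h(1) B by (intro integrable_const_bound[where B=B] AE_I2) auto
  have "expectation h \<le> ?S" "?L \<le> expectation h"
    using integral_mono[OF int integrable_const[of ?S] S] integral_mono[OF integrable_const[of ?L] int L]
    by (simp_all add: prob_space)
  then show ?thesis using S[OF z] L[OF z] by (simp add: osc_on_def abs_le_iff)
qed

text \<open>
  The common gap is at most \<open>1 / (\<eta> (M - 1))\<close>. Replacing \<open>M - 1\<close> by \<open>M / 2\<close> costs the factor \<open>2\<close> in the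
  bound \<open>2 * \<nu>\<close>.
\<close>
lemma linearly_spaced_inverse_temperature:
  assumes lin: "linearly_spaced M (\<lambda>k. 1 / \<theta> k)" and M: "2 \<le> M"
    and ends: "\<theta> 1 = \<eta>1" "\<theta> M = \<eta>" and \<eta>: "0 < \<eta>" "\<eta> < \<eta>1"
    and \<nu>: "0 < \<nu>" "1 / (\<nu> * \<eta>) \<le> real M"
  shows "\<exists>d. 0 \<le> d \<and> d \<le> 2 * \<nu> \<and> (\<forall>k<M. 1 / \<theta> (k + 1) = 1 / \<eta>1 + real k * d \<and> 0 < \<theta> (k + 1)
      \<and> \<eta> \<le> \<theta> (k + 1) \<and> \<theta> (k + 1) \<le> \<eta>1)"
proof -
  obtain d where d: "\<And>k. k \<in> {1..<M} \<Longrightarrow> 1 / \<theta> (k + 1) - 1 / \<theta> k = d"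
    using lin by (auto simp: linearly_spaced_def)
  have arith: "1 / \<theta> (k + 1) = 1 / \<eta>1 + real k * d" if "k < M" for k
    using that
  proof (induction k)
    case (Suc k)
    then show ?case using d[of "Suc k"] by (simp add: algebra_simps)
  qed (use ends(1) in simp)
  have last: "1 / \<eta> = 1 / \<eta>1 + real (M - 1) * d"
    using arith[of "M - 1"] M ends by simp
  have "1 / \<eta>1 < 1 / \<eta>" using \<eta> by (simp add: frac_less2)
  then have "0 < real (M - 1) * d" using last by linarith
  then have d0: "0 < d" using M by (simp add: zero_less_mult_iff)
  have "real M / 2 * d \<le> real (M - 1) * d" using M d0 by (intro mult_right_mono) auto
  also have "\<dots> \<le> 1 / \<eta>" using last \<eta> by simp
  also have "\<dots> \<le> real M * \<nu>" using \<nu> \<eta> by (simp add: field_simps)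
  finally have "d \<le> 2 * \<nu>" using M by (simp add: field_simps)
  moreover have "0 < \<theta> (k + 1) \<and> \<eta> \<le> \<theta> (k + 1) \<and> \<theta> (k + 1) \<le> \<eta>1" if k: "k < M" for k
  proof -
    have ge: "1 / \<eta>1 \<le> 1 / \<theta> (k + 1)" using arith[OF k] d0 by simp
    have le: "1 / \<theta> (k + 1) \<le> 1 / \<eta>"
      unfolding arith[OF k] last using k d0 by (intro add_left_mono mult_right_mono) auto
    have "0 < 1 / \<eta>1" using \<eta> by simp
    then have pos: "0 < \<theta> (k + 1)" using ge by (meson less_le_trans zero_less_divide_1_iff)
    then show ?thesis using ge le \<eta> by (simp add: field_simps)
  qed
  ultimately show ?thesis using arith d0 by (intro exI[of _ d]) auto
qed

lemma unnorm_pdf_eq: "unnorm_pdf U \<epsilon> = (\<lambda>x. exp (- (1 / \<epsilon>) * U x))"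
  by (simp add: unnorm_pdf_def fun_eq_iff)

lemma weight_ratio_eq: "1 / \<epsilon>' = 1 / \<epsilon> + \<Delta> \<Longrightarrow> weight_ratio U \<epsilon> \<epsilon>' x = exp (- \<Delta> * U x)"
  unfolding weight_ratio_def unnorm_pdf_eq exp_diff[symmetric] by (simp add: algebra_simps)

theorem theorem2p2:
  fixes X :: "'a measure" and U :: "'a \<Rightarrow> real"
    and J :: nat and \<Omega> :: "nat \<Rightarrow> 'a set"
    and \<eta>min \<eta>1 \<nu> :: real and \<eta>max :: ereal
  assumes U_measurable: "U \<in> borel_measurable X"
    and U_bounded_below: "bdd_below (U ` space X)"
    and J: "2 \<le> J"
    and \<Omega>_measurable: "\<And>j. j \<in> {1..J} \<Longrightarrow> \<Omega> j \<in> sets X"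
    and \<Omega>_disjoint: "disjoint_family_on \<Omega> {1..J}"
    and \<Omega>_cover: "(\<Union>j\<in>{1..J}. \<Omega> j) = space X"
    and \<eta>_range: "0 \<le> \<eta>min" "ereal \<eta>min < \<eta>max"
    and \<eta>1: "\<eta>min < \<eta>1" "ereal \<eta>1 \<le> \<eta>max"
    and Z_finite: "\<And>\<epsilon>. 0 < \<epsilon> \<Longrightarrow> \<eta>min \<le> \<epsilon> \<Longrightarrow> ereal \<epsilon> < \<eta>max \<or> \<epsilon> = \<eta>1 \<Longrightarrow>
                       integrable X (unnorm_pdf U \<epsilon>)"
    and Z_pos: "\<And>\<epsilon>. 0 < \<epsilon> \<Longrightarrow> \<eta>min \<le> \<epsilon> \<Longrightarrow> ereal \<epsilon> < \<eta>max \<or> \<epsilon> = \<eta>1 \<Longrightarrow>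
                    0 < partition_fun X U \<epsilon>"
    and \<Omega>_pos: "\<And>\<epsilon> j. 0 < \<epsilon> \<Longrightarrow> \<eta>min \<le> \<epsilon> \<Longrightarrow> ereal \<epsilon> < \<eta>max \<or> \<epsilon> = \<eta>1 \<Longrightarrow> j \<in> {1..J} \<Longrightarrow>
                    0 < measure (gibbs X U \<epsilon>) (\<Omega> j)"
    and C_LBV_finite: "C_LBV X U J \<Omega> \<eta>min \<eta>max < \<infinity>"
    and \<nu>: "0 < \<nu>"
  shows "\<exists>C_N C_T :: real. 0 < C_N \<and> 0 < C_T \<and>
    (\<forall>(chi :: real \<Rightarrow> real) (\<delta> :: real) (\<eta> :: real) (M :: nat) (N :: nat) (T :: nat)
      (\<theta> :: nat \<Rightarrow> real) (y :: nat \<Rightarrow> 'a) (h :: 'a \<Rightarrow> real).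
        (\<forall>\<epsilon>>0. 0 < chi \<epsilon> \<and> chi \<epsilon> < 1) \<longrightarrow>
        0 < \<delta> \<longrightarrow>
        \<eta>min \<le> \<eta> \<longrightarrow> \<eta> < \<eta>1 \<longrightarrow> 0 < \<eta> \<longrightarrow>
        2 \<le> M \<longrightarrow>
        \<lceil>1 / (\<nu> * \<eta>)\<rceil> \<le> int M \<longrightarrow>
        C_N * (real M)\<^sup>2 / \<delta>\<^sup>2 \<le> real N \<longrightarrow>
        t_mix X (local_mixing_pdf X U J \<Omega> chi \<eta>1) (gibbs_pdf X U \<eta>1) (\<delta> / C_T) \<le> enat T \<longrightarrow>
        \<theta> 1 = \<eta>1 \<longrightarrow> \<theta> M = \<eta> \<longrightarrow> linearly_spaced M (\<lambda>k. 1 / \<theta> k) \<longrightarrow>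
        (\<forall>i\<in>{1..N}. y i \<in> space X) \<longrightarrow>
        h \<in> borel_measurable X \<longrightarrow> bounded (h ` space X) \<longrightarrow>
        L2_prob_norm (asmc_law X U (local_mixing_pdf X U J \<Omega> chi) M N T \<theta> y)
          (\<lambda>x. 1 / real N * (\<Sum>i\<in>{1..N}. h (x i)) - (\<integral>z. h z * gibbs_pdf X U \<eta> z \<partial>X))
        \<le> osc_on (space X) h * \<delta>)"
proof -
  have \<eta>1_pos: "0 < \<eta>1" using \<eta>_range(1) \<eta>1(1) by simp
  obtain m where m: "0 < m" "m \<le> 1"
    and m_le: "\<And>\<epsilon> j. 0 < \<epsilon> \<Longrightarrow> \<eta>min \<le> \<epsilon> \<Longrightarrow> \<epsilon> \<le> \<eta>1 \<Longrightarrow> j \<in> {1..J} \<Longrightarrow> m \<le> measure (gibbs X U \<epsilon>) (\<Omega> j)"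
    using gibbs_measure_bounded_below[where \<Omega>=\<Omega> and J=J, OF U_measurable U_bounded_below \<Omega>_measurable
        \<eta>_range(1) \<eta>1 Z_finite Z_pos \<Omega>_pos C_LBV_finite] by blast
  have "integrable X (\<lambda>x. exp (- (1 / \<eta>1) * U x))" "0 < (\<integral>x. exp (- (1 / \<eta>1) * U x) \<partial>X)"
    using Z_finite[of \<eta>1] Z_pos[of \<eta>1] \<eta>1_pos \<eta>1(1)
    unfolding partition_fun_def unnorm_pdf_eq by auto
  then obtain R where R: "1 \<le> R" and R_le: "\<And>\<beta> \<Delta> x. 1 / \<eta>1 \<le> \<beta> \<Longrightarrow> 0 \<le> \<Delta> \<Longrightarrow> \<Delta> \<le> 2 * \<nu> \<Longrightarrow> x \<in> space X \<Longrightarrow>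
      exp (- \<Delta> * U x) * (\<integral>y. exp (- \<beta> * U y) \<partial>X) / (\<integral>y. exp (- (\<beta> + \<Delta>) * U y) \<partial>X) \<le> R"
    using gibbs_ratio_bounded[OF U_measurable U_bounded_below, of "1 / \<eta>1" "2 * \<nu>"] \<nu> by auto
  define K where "K = R * (1 / m)"
  have c: "1 \<le> 1 / m" using m by simp
  have K: "1 \<le> K" unfolding K_def using R c mult_mono[of 1 R 1 "1 / m"] by simp
  show ?thesis
  proof (rule exI[of _ "64 * K ^ 4"], rule exI[of _ "8 * K"], intro conjI allI impI)
    show "0 < 64 * K ^ 4" "0 < 8 * K" using K by simp_all
    fix chi :: "real \<Rightarrow> real" and \<delta> \<eta> :: real and M N T :: nat and \<theta> :: "nat \<Rightarrow> real"
      and y :: "nat \<Rightarrow> 'a" and h :: "'a \<Rightarrow> real"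
    assume chi: "\<forall>\<epsilon>>0. 0 < chi \<epsilon> \<and> chi \<epsilon> < 1" and \<delta>: "0 < \<delta>"
      and \<eta>: "\<eta>min \<le> \<eta>" "\<eta> < \<eta>1" "0 < \<eta>" and M: "2 \<le> M"
      and M_ge: "\<lceil>1 / (\<nu> * \<eta>)\<rceil> \<le> int M"
      and N_ge: "64 * K ^ 4 * (real M)\<^sup>2 / \<delta>\<^sup>2 \<le> real N"
      and T: "t_mix X (local_mixing_pdf X U J \<Omega> chi \<eta>1) (gibbs_pdf X U \<eta>1) (\<delta> / (8 * K)) \<le> enat T"
      and \<theta>: "\<theta> 1 = \<eta>1" "\<theta> M = \<eta>" "linearly_spaced M (\<lambda>k. 1 / \<theta> k)"
      and y: "\<forall>i\<in>{1..N}. y i \<in> space X"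
      and h: "h \<in> borel_measurable X" "bounded (h ` space X)"
    let ?p = "local_mixing_pdf X U J \<Omega> chi"
    define n where "n = M - 1"
    obtain d where d: "0 \<le> d" "d \<le> 2 * \<nu>" and temp: "\<And>k. k < M \<Longrightarrow> 1 / \<theta> (k + 1) = 1 / \<eta>1 + real k * d"
      "\<And>k. k < M \<Longrightarrow> 0 < \<theta> (k + 1)" "\<And>k. k < M \<Longrightarrow> \<eta> \<le> \<theta> (k + 1)" "\<And>k. k < M \<Longrightarrow> \<theta> (k + 1) \<le> \<eta>1"
      using linearly_spaced_inverse_temperature[OF \<theta>(3) M \<theta>(1,2) \<eta>(3,2) \<nu>] M_ge by (auto simp: ceiling_le_iff)
    have "ereal (\<theta> (k + 1)) < \<eta>max \<or> \<theta> (k + 1) = \<eta>1" if "k < M" for k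
      using temp(4)[OF that] \<eta>1(2) less_le_trans[of "ereal (\<theta> (k + 1))" "ereal \<eta>1" \<eta>max] by fastforce
    then have level: "integrable X (unnorm_pdf U (\<theta> (k + 1)))" "0 < partition_fun X U (\<theta> (k + 1))" if "k < M" for k
      using Z_finite[of "\<theta> (k + 1)"] Z_pos[of "\<theta> (k + 1)"] temp[OF that] \<eta>(1) that by auto
    have RD: "reversible_density X (?p (\<theta> (k + 1))) (gibbs_pdf X U (\<theta> (k + 1))) (1 / m)" if "k < M" for k
      using temp[OF that] \<eta>(1) chi
      by (intro local_mixing_reversible_density U_measurable \<Omega>_measurable \<Omega>_disjoint \<Omega>_cover level that m m_le) auto
    \<comment> \<open>The mixing time is at least \<open>1\<close>, hence every run makes a step and the kernels are dominated.\<close>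
    obtain T' where T': "T = Suc T'"
      using order_trans[OF one_le_t_mix T] by (cases T) (auto simp: one_enat_def)
    define P where "P k = run_law X (?p (\<theta> (k + 1))) T" for k
    define \<mu> where "\<mu> k = gibbs X U (\<theta> (k + 1))" for k
    define r where "r k = weight_ratio U (\<theta> (k + 1)) (\<theta> (k + 2))" for k
    define s where "s k = partition_fun X U (\<theta> (k + 1)) / partition_fun X U (\<theta> (k + 2))" for k
    define g where "g k x = s k * r k x" for k x
    have nM: "k < M" "k < n \<Longrightarrow> Suc k < M" if "k \<le> n" for k using that M by (auto simp: n_def)
    have "0 < real N"
    proof -
      have "0 < 64 * K ^ 4 * (real M)\<^sup>2 / \<delta>\<^sup>2" using K M \<delta> by simp
      then show ?thesis using N_ge by linarith
    qed
    then have N: "1 \<le> N" by simp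
    interpret annealed_particles X N n P \<mu> r g s R "1 / m"
    proof
      show "1 \<le> N" by (rule N)
      show "P k \<in> X \<rightarrow>\<^sub>M prob_algebra X" if "k \<le> n" for k
        unfolding P_def by (rule reversible_density.run_law_kernel[OF RD[OF nM(1)[OF that]]])
      show "\<mu> k \<in> space (prob_algebra X)" if "k \<le> n" for k
        unfolding \<mu>_def gibbs_def by (rule reversible_density.\<pi>_in_prob_algebra[OF RD[OF nM(1)[OF that]]])
      show "(\<integral>x. (\<integral>z. f z \<partial>P k x) \<partial>\<mu> k) = (\<integral>z. f z \<partial>\<mu> k)"
        if "k \<le> n" "f \<in> borel_measurable X" "\<And>x. x \<in> space X \<Longrightarrow> \<bar>f x\<bar> \<le> B" for k and f :: "'a \<Rightarrow> real" and B
        unfolding \<mu>_def P_def gibbs_def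
        by (rule reversible_density.run_law_invariant[OF RD[OF nM(1)[OF that(1)]] that(2,3)])
      show "(\<integral>z. f z \<partial>P k x) \<le> 1 / m * (\<integral>z. f z \<partial>\<mu> k)"
        if "k \<le> n" "f \<in> borel_measurable X" "\<And>x. x \<in> space X \<Longrightarrow> \<bar>f x\<bar> \<le> B"
          "\<And>x. x \<in> space X \<Longrightarrow> 0 \<le> f x" "x \<in> space X" for k and f :: "'a \<Rightarrow> real" and B x
        unfolding \<mu>_def P_def gibbs_def T'
        by (rule reversible_density.run_law_le[OF RD[OF nM(1)[OF that(1)]] that(2-5)])
      show "r k \<in> borel_measurable X" for k
      proof -
        note [measurable] = U_measurable
        show ?thesis unfolding r_def weight_ratio_def[abs_def] unnorm_pdf_def by measurable
      qed
      show "0 < r k x" for k x by (simp add: r_def weight_ratio_def unnorm_pdf_def)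
      show "0 < s k" if "k < n" for k
        using level(2)[of k] level(2)[of "Suc k"] nM[of k] that by (simp add: s_def)
      show "g k = (\<lambda>x. s k * r k x)" for k by (simp add: g_def fun_eq_iff)
      show "g k x \<le> R" if k: "k < n" and x: "x \<in> space X" for k x
      proof -
        have kM: "k < M" "Suc k < M" using nM[of k] k by auto
        have \<beta>: "1 / \<theta> (k + 2) = 1 / \<theta> (k + 1) + d"
          using temp(1)[OF kM(1)] temp(1)[OF kM(2)] by (simp add: algebra_simps)
        have "g k x = exp (- d * U x) * (\<integral>y. exp (- (1 / \<theta> (k + 1)) * U y) \<partial>X)
            / (\<integral>y. exp (- (1 / \<theta> (k + 1) + d) * U y) \<partial>X)"
          unfolding g_def r_def s_def weight_ratio_eq[OF \<beta>] partition_fun_def unnorm_pdf_eq \<beta> by simp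
        also have "\<dots> \<le> R"
          using temp(1)[OF kM(1)] d by (intro R_le x) auto
        finally show ?thesis .
      qed
      show "(\<integral>x. g k x * f x \<partial>\<mu> k) = (\<integral>x. f x \<partial>\<mu> (Suc k))"
        if k: "k < n" and f: "f \<in> borel_measurable X" for k and f :: "'a \<Rightarrow> real"
      proof -
        have kM: "k < M" "Suc k < M" using nM[of k] k by auto
        have gm: "(\<lambda>x. g k x * f x) \<in> borel_measurable X"
        proof -
          note [measurable] = U_measurable f
          show ?thesis unfolding g_def r_def weight_ratio_def[abs_def] unnorm_pdf_def by measurable
        qed
        have pointwise: "gibbs_pdf X U (\<theta> (k + 1)) x * (g k x * f x) = gibbs_pdf X U (\<theta> (Suc k + 1)) x * f x" for x
          using level(2)[OF kM(1)] level(2)[OF kM(2)]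
          by (simp add: gibbs_pdf_def g_def s_def r_def weight_ratio_def unnorm_pdf_def)
        show ?thesis
          unfolding \<mu>_def gibbs_integral[OF U_measurable level(2)[OF kM(1)] gm]
            gibbs_integral[OF U_measurable level(2)[OF kM(2)] f] pointwise ..
      qed
      show "1 \<le> R" "1 \<le> 1 / m" by (rule R, rule c)
    qed
    have "level_law X U ?p N T \<theta> y k = law y k" for k
    proof (induction k)
      case 0
      show ?case unfolding level_law.simps law.simps mutate_law_def mutate_def by (simp add: P_def)
    next
      case (Suc k)
      have "mutate_law X (?p (\<theta> (k + 2))) N T = mutate (Suc k)"
        unfolding mutate_law_def[abs_def] mutate_def[abs_def] by (simp add: P_def)
      moreover have "weight_ratio U (\<theta> (k + 1)) (\<theta> (k + 2)) = r k" by (simp only: r_def)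
      ultimately show ?case unfolding level_law.simps law.simps Suc by (simp only:)
    qed
    then have asmc: "asmc_law X U ?p M N T \<theta> y = law y n" by (simp add: asmc_law_def n_def)
    have n: "n < M" "\<theta> (n + 1) = \<eta>" using M \<theta>(2) by (auto simp: n_def)
    have y': "\<And>i. i \<in> {1..N} \<Longrightarrow> y i \<in> space X" using y by blast
    interpret target: prob_space "\<mu> n" using target[of n] by (simp add: space_prob_algebra)
    have \<mu>n: "sets (\<mu> n) = sets X" "space (\<mu> n) = space X" by (simp_all add: \<mu>_def gibbs_def)
    have h\<mu>: "h \<in> borel_measurable (\<mu> n)"
      by (subst measurable_cong_sets[OF \<mu>n(1) refl]) (rule h(1))
    define f where "f z = h z - target.expectation h" for z
    have f: "f \<in> borel_measurable X" unfolding f_def using h(1) by simp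
    have f_le: "\<bar>f z\<bar> \<le> osc_on (space X) h" if "z \<in> space X" for z
      unfolding f_def by (rule target.abs_minus_expectation_le_osc[OF h\<mu>, unfolded \<mu>n(2), OF h(2) that])
    obtain B where B: "\<And>x. x \<in> space X \<Longrightarrow> \<bar>h x\<bar> \<le> B"
      using h(2) unfolding bounded_iff by auto
    have "integrable (\<mu> n) h"
    proof (rule target.integrable_const_bound[OF _ h\<mu>])
      show "AE x in \<mu> n. norm (h x) \<le> B" by (rule AE_I2) (simp add: \<mu>n(2) B)
    qed
    then have f_mean: "(\<integral>z. f z \<partial>\<mu> n) = 0" by (simp add: f_def target.prob_space)
    have osc: "0 \<le> osc_on (space X) h"
      using f_le[of "y 1"] y' N abs_ge_zero[of "f (y 1)"] by fastforce
    have expectation: "(\<integral>z. h z * gibbs_pdf X U \<eta> z \<partial>X) = target.expectation h"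
    proof -
      have "0 < partition_fun X U \<eta>" using level(2)[OF n(1)] unfolding n(2) .
      from gibbs_integral[OF U_measurable this h(1)] show ?thesis
        unfolding \<mu>_def n(2) by (simp only: mult.commute)
    qed
    have avg_f: "1 / real N * (\<Sum>i\<in>{1..N}. h (x i)) - (\<integral>z. h z * gibbs_pdf X U \<eta> z \<partial>X) = avg x f" for x
      unfolding expectation avg_def f_def using N by (simp add: sum_subtractf field_simps)
    have "(\<integral>x. (avg x f)\<^sup>2 \<partial>law y n) \<le> (osc_on (space X) h * \<delta>)\<^sup>2"
    \<comment> \<open>For \<open>\<delta> > 1\<close> the number of particles need not dominate the number of levels, but the
        oscillation of \<open>h\<close> already bounds the error.\<close>
    proof (cases "\<delta> \<le> 1")
      case True
      note budget = error_budget[OF K \<delta> True, of "real M" "real n" "real N"]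
      have mixing: "\<bar>(\<integral>z. \<phi> z \<partial>P 0 x) - (\<integral>z. \<phi> z \<partial>\<mu> 0)\<bar> \<le> 2 * (\<delta> / (8 * K)) * B"
        if "\<phi> \<in> borel_measurable X" "\<And>z. z \<in> space X \<Longrightarrow> \<bar>\<phi> z\<bar> \<le> B" "x \<in> space X" for \<phi> B x
      proof -
        have "reversible_density X (?p \<eta>1) (gibbs_pdf X U \<eta>1) (1 / m)" using RD[of 0] M \<theta>(1) by simp
        from reversible_density.t_mix_le_imp_run_law_close[OF this T _ that] show ?thesis
          using \<delta> K \<theta>(1) by (simp add: P_def \<mu>_def gibbs_def)
      qed
      have "(\<integral>x. (avg x f)\<^sup>2 \<partial>law y n) \<le> (osc_on (space X) h)\<^sup>2 *
          (4 * (2 * (\<delta> / (8 * K)))\<^sup>2 * K\<^sup>2 + 4 * K\<^sup>2 / N + 16 * K ^ 4 * n / N)"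
        unfolding K_def
        by (rule mean_square_error_le[OF y' _ mixing[unfolded K_def] f f_le f_mean])
          (use budget(1) M N_ge in \<open>auto simp: n_def K_def\<close>)
      also have "\<dots> \<le> (osc_on (space X) h)\<^sup>2 * \<delta>\<^sup>2"
        using budget(2) M N_ge by (intro mult_left_mono) (auto simp: n_def)
      finally show ?thesis by (simp add: power_mult_distrib)
    next
      case False
      have u: "(\<lambda>_. law y n) \<in> count_space {()} \<rightarrow>\<^sub>M prob_algebra CX" "() \<in> space (count_space {()})"
        using law_in_prob_algebra[of y n] y' by auto
      have "\<bar>\<integral>x. (1 * avg x f - 0)\<^sup>2 \<partial>law y n\<bar> \<le> (\<bar>1\<bar> * osc_on (space X) h + \<bar>0\<bar>)\<^sup>2"
      proof (rule kernel_integral_abs_le[OF u])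
        show "(\<lambda>x. (1 * avg x f - 0)\<^sup>2) \<in> borel_measurable CX" using f by measurable
      qed (rule avg_square_bound[OF f_le])
      then have "(\<integral>x. (avg x f)\<^sup>2 \<partial>law y n) \<le> (osc_on (space X) h)\<^sup>2" by simp
      also have "\<dots> \<le> (osc_on (space X) h * \<delta>)\<^sup>2"
        using osc False by (intro power_mono mult_right_mono[of 1 \<delta>, simplified mult.commute[of _ \<delta>]]) (auto simp: mult_le_cancel_left1)
      finally show ?thesis .
    qed
    then show "L2_prob_norm (asmc_law X U ?p M N T \<theta> y)
          (\<lambda>x. 1 / real N * (\<Sum>i\<in>{1..N}. h (x i)) - (\<integral>z. h z * gibbs_pdf X U \<eta> z \<partial>X))
        \<le> osc_on (space X) h * \<delta>"
      unfolding L2_prob_norm_def asmc avg_f using osc \<delta> by (intro real_le_lsqrt) auto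
  qed
qed

end
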